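(* Let $a,b\in\mathbb{Q}$ with $b\in\mathbb{Q}^2$ and suppose that $f(x)=x^8+ax^4+b\in\mathbb{Q}[x]$ is irreducible over $\mathbb{Q}$. Then $\mathrm{Gal}(f)$ is 8T2, 8T3, 8T4, 8T9, 8T11 or 8T22. Moreover, each of these six possibilities does occur, i.e. for each of these six groups there exists such an irreducible polynomial $f$ having it as its Galois group.
   Context: $\mathbb{Q}^2=\{k^2:k\in\mathbb{Q}\}$. $\mathrm{Gal}(f)$ is the Galois group over $\mathbb{Q}$ of (the splitting field of) $f$, viewed as a transitive permutation group on the eight roots of $f$, i.e. as a transitive subgroup of $S_8$ up to conjugacy. 8Tj denotes the $j$-th conjugacy class of transitive subgroups of $S_8$ in the Butler–McKay (LMFDB) numbering. The classes used here are identified as follows; each consists of exactly the transitive subgroups of $S_8$ that are isomorphic, as abstract groups, to the indicated group: 8T2: $C_4\times C_2$ (order 8); 8T3: $C_2^3$ (order 8); 8T4: the dihedral group $D_4$ of order 8; 8T9: $C_2\times D_4$ (order 16); 8T11: the central product $C_4\circ D_4$ (order 16); 8T22: the central product $D_4\circ D_4$, i.e. the extraspecial group $2^{1+4}_+$ (order 32). *)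

theory Defs
  imports
    "HOL-Algebra.Algebra"
    "HOL-Algebra.Sym_Groups"
    "HOL-Algebra.Bij"
    "HOL-Algebra.Algebraic_Closure_Type"
begin

section \<open>The Galois group of a rational polynomial\<close>

definition rat_squares :: "rat set" where
  "rat_squares = {k\<^sup>2 | k. True}"

abbreviation complex_ring :: "complex ring" where
  "complex_ring \<equiv> ring_of_type_algebra"

definition complex_roots :: "rat poly \<Rightarrow> complex set" where
  "complex_roots f = {z. poly (map_poly of_rat f) z = 0}"

text \<open>Every subfield of the complex numbers contains the rationals, so adjoining the roots to the
  prime field gives the splitting field over the rationals.\<close>

definition splitting_field :: "rat poly \<Rightarrow> complex set" where
  "splitting_field f = generate_field complex_ring (complex_roots f)"

definition galois_group :: "rat poly \<Rightarrow> (complex \<Rightarrow> complex) set" where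
  "galois_group f =
     {\<sigma> \<in> Bij (splitting_field f).
        \<sigma> \<in> ring_hom (complex_ring\<lparr>carrier := splitting_field f\<rparr>)
                    (complex_ring\<lparr>carrier := splitting_field f\<rparr>)
        \<and> (\<forall>q. \<sigma> (of_rat q) = of_rat q)}"

text \<open>The Galois group as a set of permutations of \<open>{1..n}\<close>, for a numbering \<open>r\<close> of the roots of a
  polynomial with \<open>n\<close> distinct roots.\<close>

definition galois_perms :: "rat poly \<Rightarrow> (nat \<Rightarrow> complex) \<Rightarrow> (nat \<Rightarrow> nat) set" where
  "galois_perms f r =
     {p. p permutes {1..degree f} \<and>
         (\<exists>\<sigma>\<in>galois_group f. \<forall>i\<in>{1..degree f}. \<sigma> (r i) = r (p i))}"

text \<open>Renumbering the roots conjugates \<open>galois_perms f r\<close> in the symmetric group, so for a conjugation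
  invariant \<open>\<C>\<close> (as are all the classes below) the choice of numbering is immaterial.\<close>

definition galois_type_in :: "rat poly \<Rightarrow> (nat \<Rightarrow> nat) set set \<Rightarrow> bool" where
  "galois_type_in f \<C> \<longleftrightarrow>
     (\<exists>r. bij_betw r {1..degree f} (complex_roots f) \<and> galois_perms f r \<in> \<C>)"


section \<open>The transitive groups of degree eight\<close>

definition transitive_subgroup :: "nat \<Rightarrow> (nat \<Rightarrow> nat) set \<Rightarrow> bool" where
  "transitive_subgroup n H \<longleftrightarrow>
     subgroup H (sym_group n) \<and> (\<forall>i\<in>{1..n}. \<forall>j\<in>{1..n}. \<exists>p\<in>H. p i = j)"

text \<open>The pair \<open>(i, s)\<close> stands for \<open>\<rho>\<^sup>i \<tau>\<^sup>s\<close>, where \<open>\<rho>\<close> is a rotation of order \<open>n\<close> and \<open>\<tau>\<close> a reflection, so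
  \<open>\<tau> \<rho> = \<rho>\<^sup>-\<^sup>1 \<tau>\<close>; the order of \<open>dihedral_group n\<close> is \<open>2 * n\<close>.\<close>

definition dihedral_group :: "nat \<Rightarrow> (int \<times> bool) monoid" where
  "dihedral_group n =
     \<lparr>carrier = {0..<int n} \<times> UNIV,
      monoid.mult = (\<lambda>(i, s) (j, t). ((if s then i - j else i + j) mod int n, s \<noteq> t)),
      one = (0, False)\<rparr>"

text \<open>The central product of \<open>G\<close> and \<open>H\<close> in which the subgroup \<open>Z\<close> of the centre of \<open>G\<close> is identified
  with its image under an injective homomorphism \<open>\<theta>\<close> into the centre of \<open>H\<close>.\<close>

definition central_product ::
    "'a monoid \<Rightarrow> 'b monoid \<Rightarrow> 'a set \<Rightarrow> ('a \<Rightarrow> 'b) \<Rightarrow> ('a \<times> 'b) set monoid" where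
  "central_product G H Z \<theta> = (G \<times>\<times> H) Mod ((\<lambda>z. (z, inv\<^bsub>H\<^esub> (\<theta> z))) ` Z)"

text \<open>\<open>C\<^sub>4 \<circ> D\<^sub>4\<close> and \<open>D\<^sub>4 \<circ> D\<^sub>4\<close> amalgamate the subgroups of order two of the centres; the centre of
  \<open>D\<^sub>4\<close> is generated by \<open>(2, False)\<close>.\<close>

definition C4_circ_D4 :: "(int \<times> int \<times> bool) set monoid" where
  "C4_circ_D4 =
     central_product (integer_mod_group 4) (dihedral_group 4) {0, 2} (\<lambda>i. (i, False))"

definition D4_circ_D4 :: "((int \<times> bool) \<times> int \<times> bool) set monoid" where
  "D4_circ_D4 =
     central_product (dihedral_group 4) (dihedral_group 4) {(0, False), (2, False)} (\<lambda>z. z)"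

definition transitive_octic :: "('a, 'b) monoid_scheme \<Rightarrow> (nat \<Rightarrow> nat) set set" where
  "transitive_octic G =
     {H. transitive_subgroup 8 H \<and> (sym_group 8)\<lparr>carrier := H\<rparr> \<cong> G}"

text \<open>Butler--McKay classes of transitive subgroups of the symmetric group of degree eight; each of
  those below consists of all transitive subgroups of the indicated isomorphism type.\<close>

definition T8_2 :: "(nat \<Rightarrow> nat) set set" where
  "T8_2 = transitive_octic (integer_mod_group 4 \<times>\<times> integer_mod_group 2)"

definition T8_3 :: "(nat \<Rightarrow> nat) set set" where
  "T8_3 = transitive_octic (integer_mod_group 2 \<times>\<times> integer_mod_group 2 \<times>\<times> integer_mod_group 2)"

definition T8_4 :: "(nat \<Rightarrow> nat) set set" where
  "T8_4 = transitive_octic (dihedral_group 4)"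

definition T8_9 :: "(nat \<Rightarrow> nat) set set" where
  "T8_9 = transitive_octic (integer_mod_group 2 \<times>\<times> dihedral_group 4)"

definition T8_11 :: "(nat \<Rightarrow> nat) set set" where
  "T8_11 = transitive_octic C4_circ_D4"

definition T8_22 :: "(nat \<Rightarrow> nat) set set" where
  "T8_22 = transitive_octic D4_circ_D4"

definition octic_poly :: "rat \<Rightarrow> rat \<Rightarrow> rat poly" where
  "octic_poly a b = Polynomial.monom 1 8 + Polynomial.monom a 4 + [:b:]"

end

theory Submission
  imports Defs "HOL-Computational_Algebra.Polynomial_Factorial"
begin

text \<open>
  Let \<open>f = x\<^sup>8 + a x\<^sup>4 + c\<^sup>2\<close> be irreducible, \<open>\<alpha>\<close> a root and \<open>\<gamma>\<^sup>2 = c\<close>. The roots are \<open>\<i>\<^sup>k \<alpha>\<close> and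
  \<open>\<i>\<^sup>k \<gamma> / \<alpha>\<close>, so an automorphism of the splitting field is determined by what it does to \<open>\<i>\<close>, \<open>\<gamma>\<close> and \<open>\<alpha>\<close>.
  Put \<open>A = \<alpha>\<^sup>2\<close>, \<open>p = A + c / A\<close> and \<open>q = A - c / A\<close>. Then \<open>p\<^sup>2 = 2 c - a\<close> and \<open>q\<^sup>2 = - 2 c - a\<close> are rational, and
  \<open>A = (p + q) / 2\<close>: the splitting field arises from the multiquadratic field \<open>\<rat>(\<i>, \<gamma>, p, q)\<close> by
  adjoining one square root \<open>\<alpha>\<close>. The signs by which an automorphism \<open>\<sigma>\<close> acts on \<open>p\<close>, \<open>\<i> \<gamma> q\<close>, \<open>q\<close>, \<open>\<gamma>\<close> form a
  vector in \<open>\<bbbF>\<^sub>2\<^sup>4\<close>; this is a homomorphism whose kernel is generated by the automorphism \<open>z\<close> that fixes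
  \<open>\<i>\<close> and \<open>\<gamma>\<close> and negates \<open>\<alpha>\<close>. The point of this choice of coordinates is that \<open>\<sigma>\<^sup>2\<close> is \<open>z\<close> or the
  identity according to the value of the quadratic form \<open>v\<^sub>1 v\<^sub>2 + v\<^sub>3 v\<^sub>4\<close> (\<open>square_action\<close>). Hence the
  Galois group is the preimage of a subspace \<open>W\<close> of \<open>\<bbbF>\<^sub>2\<^sup>4\<close> in the extraspecial group \<open>2\<^sub>+\<^sup>1\<^sup>+\<^sup>4\<close>
  (\<open>galois_plus_type\<close>), and its commutators are given by the polar form.

  Transitivity on the eight roots leaves the orders 8, 16 and 32. If \<open>W\<close> is everything, the group is
  \<open>D\<^sub>4 \<circ> D\<^sub>4\<close>, one factor for each hyperbolic plane. If \<open>W\<close> is a hyperplane, it is the orthogonal complement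
  of a vector \<open>w\<close> in \<open>W\<close>; the group is generated by a dihedral group and a central element over \<open>w\<close>, so it is
  \<open>C\<^sub>2 \<times> D\<^sub>4\<close> or \<open>C\<^sub>4 \<circ> D\<^sub>4\<close> according to the value of the form at \<open>w\<close>. In order 8 the candidates are
  \<open>C\<^sub>2\<^sup>3\<close>, \<open>C\<^sub>4 \<times> C\<^sub>2\<close>, \<open>D\<^sub>4\<close> and the quaternion group. The quaternion group is a regular subgroup
  of the extraspecial group, so it cannot be excluded by group theory alone; but complex conjugation is an
  involution which moves \<open>\<i>\<close> and so differs from \<open>z\<close>, whereas a quaternion group has a single involution.

  For the examples, Kummer theory (\<open>kummer_criterion\<close>) says that \<open>W\<close> is the annihilator of the multiplicative
  relations modulo squares between \<open>2 c - a\<close>, \<open>c (2 c + a)\<close>, \<open>- 2 c - a\<close> and \<open>c\<close>. Two independent relations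
  leave order 8. If \<open>f\<close> has a real root, complex conjugation lies in a point stabilizer, so the order is at
  least 16, and it is 32 precisely if there are no relations.
\<close>

section \<open>Subspaces of a four-dimensional quadratic space over the field with two elements\<close>

text \<open>The space \<open>\<bbbF>\<^sub>2\<^sup>4\<close>, with \<open>True\<close> for \<open>1\<close>; addition of bits is then inequality.\<close>
type_synonym vec4 = "bool \<times> bool \<times> bool \<times> bool"

fun vadd :: "vec4 \<Rightarrow> vec4 \<Rightarrow> vec4" where
  "vadd (a, b, c, d) (a', b', c', d') = (a \<noteq> a', b \<noteq> b', c \<noteq> c', d \<noteq> d')"

definition vzero :: vec4 where "vzero = (False, False, False, False)"

fun quad :: "vec4 \<Rightarrow> bool" where
  "quad (a, b, c, d) = ((a \<and> b) \<noteq> (c \<and> d))"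

fun polar :: "vec4 \<Rightarrow> vec4 \<Rightarrow> bool" where
  "polar (a, b, c, d) (a', b', c', d') = (((a \<and> b') \<noteq> (b \<and> a')) \<noteq> ((c \<and> d') \<noteq> (d \<and> c')))"

text \<open>Identifies \<open>polar\<close> as the symplectic form that belongs to \<open>quad\<close>.\<close>
lemma polar_eq: "polar u w \<longleftrightarrow> (quad (vadd u w) \<noteq> (quad u \<noteq> quad w))"
  by (cases u; cases w) auto

lemma vadd_assoc: "vadd (vadd u w) x = vadd u (vadd w x)"
  by (cases u; cases w; cases x) auto

lemma vadd_commute: "vadd u w = vadd w u"
  by (cases u; cases w) auto

lemma vadd_self [simp]: "vadd u u = vzero"
  by (cases u) (auto simp: vzero_def)

lemma vadd_zero [simp]: "vadd vzero u = u" "vadd u vzero = u"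
  by (cases u; simp add: vzero_def)+

lemma vadd_cancel [simp]: "vadd u (vadd u w) = w"
  by (simp flip: vadd_assoc)

lemma vadd_eq_zero_iff [simp]: "vadd u w = vzero \<longleftrightarrow> u = w"
  by (metis vadd_cancel vadd_self vadd_zero(2))

lemma quad_zero [simp]: "\<not> quad vzero"
  by (simp add: vzero_def)

lemma polar_zero [simp]: "\<not> polar vzero u" "\<not> polar u vzero"
  by (cases u; simp add: vzero_def)+

lemma polar_self [simp]: "\<not> polar u u"
  by (simp add: polar_eq)

lemma polar_add: "polar u (vadd w x) \<longleftrightarrow> (polar u w \<noteq> polar u x)"
proof -
  obtain a b c d where u: "u = (a, b, c, d)" by (cases u)
  show ?thesis by (cases w; cases x; cases a; cases b; cases c; cases d; simp add: u; argo)
qed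

lemma card_vec4: "card (UNIV :: vec4 set) = 16"
  by (simp flip: UNIV_Times_UNIV add: UNIV_bool)

fun dot :: "vec4 \<Rightarrow> vec4 \<Rightarrow> bool" where
  "dot (a, b, c, d) (a', b', c', d') = (((a \<and> a') \<noteq> (b \<and> b')) \<noteq> ((c \<and> c') \<noteq> (d \<and> d')))"

lemma dot_add: "dot l (vadd u w) \<longleftrightarrow> (dot l u \<noteq> dot l w)"
proof -
  obtain a b c d where l: "l = (a, b, c, d)" by (cases l)
  show ?thesis by (cases u; cases w; cases a; cases b; cases c; cases d; simp add: l; argo)
qed

text \<open>A proper subspace is disjoint from its translate by an outside vector, so it has at most half of
  the sixteen vectors.\<close>
lemma large_subspace_eq_UNIV:
  assumes add: "\<And>u w. u \<in> W \<Longrightarrow> w \<in> W \<Longrightarrow> vadd u w \<in> W" and card: "card W > 8"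
  shows "W = UNIV"
proof (rule ccontr)
  assume "W \<noteq> UNIV"
  then obtain x where x: "x \<notin> W" by auto
  have "vadd x w \<notin> W" if "w \<in> W" for w
    using that x add[of w "vadd x w"] by (metis vadd_cancel vadd_commute)
  then have "W \<inter> vadd x ` W = {}" by auto
  moreover have "inj_on (vadd x) W" by (metis inj_onI vadd_cancel)
  ultimately have "card (W \<union> vadd x ` W) = card W + card W"
    by (simp add: card_Un_disjoint card_image)
  moreover have "card (W \<union> vadd x ` W) \<le> 16"
    using card_mono[of UNIV "W \<union> vadd x ` W"] by (simp add: card_vec4)
  ultimately show False using card by simp
qed

text \<open>The sum of two vectors outside a subspace of index two lies inside it. Lying outside is therefore
  an additive functional, and its values at the standard basis are the coefficients \<open>l\<close>.\<close>
lemma hyperplane_of_index_two: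
  assumes add: "\<And>u w. u \<in> W \<Longrightarrow> w \<in> W \<Longrightarrow> vadd u w \<in> W" and card: "card W = 8"
  obtains l where "l \<noteq> vzero" "\<And>u. u \<in> W \<longleftrightarrow> \<not> dot l u"
proof -
  have zero: "vzero \<in> W"
  proof -
    have "W \<noteq> {}" using card by auto
    then obtain u where "u \<in> W" by auto
    then show ?thesis using add[of u u] by simp
  qed
  have add_out: "vadd u w \<in> W" if u: "u \<notin> W" and w: "w \<notin> W" for u w
  proof -
    have "vadd u w \<notin> W" if "w \<in> W" for w
      using that u add[of w "vadd u w"] by (metis vadd_cancel vadd_commute)
    then have "W \<inter> vadd u ` W = {}" by auto
    moreover have "inj_on (vadd u) W" by (metis inj_onI vadd_cancel)
    ultimately have "card (W \<union> vadd u ` W) = 16"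
      by (simp add: card_Un_disjoint card_image card)
    then have "W \<union> vadd u ` W = UNIV" by (intro card_subset_eq) (auto simp: card_vec4)
    then obtain x where "x \<in> W" "w = vadd u x" using w by blast
    then show ?thesis by simp
  qed
  have add_mixed: "vadd u w \<notin> W" if "u \<in> W" "w \<notin> W" for u w
    using that add[of u "vadd u w"] by auto
  have in_add: "vadd u w \<in> W \<longleftrightarrow> (u \<in> W \<longleftrightarrow> w \<in> W)" for u w
    using add[of u w] add_out[of u w] add_mixed[of u w] add_mixed[of w u] by (auto simp: vadd_commute)
  define e1 e2 e3 e4 :: vec4 where
    e: "e1 = (True, False, False, False)" "e2 = (False, True, False, False)"
       "e3 = (False, False, True, False)" "e4 = (False, False, False, True)"
  define l where "l = (e1 \<notin> W, e2 \<notin> W, e3 \<notin> W, e4 \<notin> W)"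
  have "u \<in> W \<longleftrightarrow> \<not> dot l u" for u
  proof -
    obtain a b c d where u: "u = (a, b, c, d)" by (cases u)
    have decomp: "u = vadd (if a then e1 else vzero) (vadd (if b then e2 else vzero)
        (vadd (if c then e3 else vzero) (if d then e4 else vzero)))"
      by (simp add: u e vzero_def)
    then have "u \<in> W \<longleftrightarrow> ((if a then e1 else vzero) \<in> W \<longleftrightarrow> ((if b then e2 else vzero) \<in> W \<longleftrightarrow>
        ((if c then e3 else vzero) \<in> W \<longleftrightarrow> (if d then e4 else vzero) \<in> W)))"
      by (subst decomp) (simp only: in_add)
    then show ?thesis using zero by (auto simp: u l_def)
  qed
  moreover have "l \<noteq> vzero"
  proof
    assume "l = vzero"
    then have "W = UNIV" using \<open>\<And>u. u \<in> W \<longleftrightarrow> \<not> dot l u\<close> by (auto simp: vzero_def)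
    then show False using card card_vec4 by simp
  qed
  ultimately show thesis using that by blast
qed

text \<open>Pairing a vanishing combination with \<open>r\<close> isolates the coefficient of \<open>s\<close>, and conversely.\<close>
lemma symplectic_independent:
  assumes "polar r s" "\<not> polar w r" "\<not> polar w s" "w \<noteq> vzero"
    and eq: "vadd (if i then w else vzero) (vadd (if j then r else vzero) (if t then s else vzero)) = vzero"
  shows "\<not> i \<and> \<not> j \<and> \<not> t"
proof -
  have sym: "polar u x = polar x u" for u x by (simp add: polar_eq vadd_commute) blast
  have "\<not> t"
  proof
    assume t
    then have "polar r (vadd (if i then w else vzero) (vadd (if j then r else vzero) (if t then s else vzero)))"
      using assms(1-4) by (simp add: polar_add sym[of r w])
    then show False by (simp add: eq)
  qed
  moreover have "\<not> j"
  proof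
    assume j
    then have "polar s (vadd (if i then w else vzero) (vadd (if j then r else vzero) (if t then s else vzero)))"
      using assms(1-4) by (simp add: polar_add sym[of s w] sym[of s r])
    then show False by (simp add: eq)
  qed
  ultimately show ?thesis using eq assms(4) by (auto split: if_splits)
qed

text \<open>The hyperplane of \<open>l\<close> is the orthogonal complement of the vector \<open>w\<close> that arises from \<open>l\<close> by exchanging
  the coordinates within each hyperbolic pair, and \<open>w\<close> lies in it because the polar form is alternating.
  The vectors \<open>r\<close> and \<open>s\<close> will be lifted to a rotation and a reflection that generate a dihedral group.\<close>
lemma hyperplane_frame:
  assumes "l \<noteq> vzero"
  obtains w r s where "\<not> dot l w" "\<not> dot l r" "\<not> dot l s"
    "w \<noteq> vzero" "quad r" "\<not> quad s" "polar r s" "\<not> polar w r" "\<not> polar w s"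
proof -
  obtain a b c d where l: "l = (a, b, c, d)" by (cases l)
  \<comment> \<open>Each of the fifteen hyperplanes contains at least one of these six pairs.\<close>
  have "\<exists>(r, s) \<in> {((False, False, True, True), (False, False, False, True)),
      ((False, True, True, True), (False, False, False, True)),
      ((True, False, True, True), (False, True, False, False)),
      ((True, True, False, False), (False, True, False, True)),
      ((True, True, False, True), (False, True, False, True)),
      ((True, True, True, False), (False, True, False, False))}.
    \<not> dot l r \<and> \<not> dot l s \<and> quad r \<and> \<not> quad s \<and> polar r s"
    using assms by (cases a; cases b; cases c; cases d; simp add: l vzero_def)
  then obtain r s where rs: "\<not> dot l r" "\<not> dot l s" "quad r" "\<not> quad s" "polar r s" by blast
  have polar: "polar (b, a, d, c) u \<longleftrightarrow> dot l u" for u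
    by (cases u; cases a; cases b; cases c; cases d; simp add: l; argo)
  have "\<not> dot l (b, a, d, c)" using polar[of "(b, a, d, c)"] by simp
  moreover have "(b, a, d, c) \<noteq> vzero" using assms by (auto simp: l vzero_def)
  ultimately show thesis using that[of "(b, a, d, c)" r s] rs polar by blast
qed

section \<open>Homomorphisms out of cyclic and dihedral groups\<close>

lemma (in group) cyclic_word_hom:
  assumes "x \<in> carrier G" "x [^] int n = \<one>"
  shows "(\<lambda>i::int. x [^] i) \<in> hom (integer_mod_group n) G"
proof (rule homI)
  fix i j :: int
  have "i + j = int n * ((i + j) div int n) + (i + j) mod int n" by simp
  then have "x [^] (i + j) = x [^] (int n * ((i + j) div int n)) \<otimes> x [^] ((i + j) mod int n)"
    by (metis assms(1) int_pow_mult)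
  then show "x [^] (i \<otimes>\<^bsub>integer_mod_group n\<^esub> j) = x [^] i \<otimes> x [^] j"
    using assms by (simp add: int_pow_mult flip: int_pow_pow)
qed (use assms in auto)

lemma group_dihedral_group:
  assumes "n > 0" shows "group (dihedral_group n)"
proof (rule groupI)
  fix x assume "x \<in> carrier (dihedral_group n)"
  then obtain i s where x: "x = (i, s)" "0 \<le> i" "i < int n" by (auto simp: dihedral_group_def)
  show "\<exists>y\<in>carrier (dihedral_group n). y \<otimes>\<^bsub>dihedral_group n\<^esub> x = \<one>\<^bsub>dihedral_group n\<^esub>"
    by (rule bexI[of _ "(if s then i else (- i) mod int n, s)"])
      (use assms x in \<open>auto simp: dihedral_group_def mod_simps\<close>)
qed (use assms in \<open>auto simp: dihedral_group_def mod_simps algebra_simps\<close>)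

lemma card_dihedral: "card (carrier (dihedral_group n)) = 2 * n"
  by (simp add: dihedral_group_def card_cartesian_product UNIV_bool)

lemma dihedral_carrierD: "(j, t) \<in> carrier (dihedral_group 4) \<Longrightarrow> 0 \<le> j \<and> j < 4"
  by (simp add: dihedral_group_def)

lemma one_dihedral: "\<one>\<^bsub>dihedral_group n\<^esub> = (0, False)"
  by (simp add: dihedral_group_def)

lemma finite_dihedral: "finite (carrier (dihedral_group n))"
  by (simp add: dihedral_group_def)

lemma inv_dihedral_two: "inv\<^bsub>dihedral_group 4\<^esub> (2, False) = (2, False)"
  by (rule group.inv_equality[OF group_dihedral_group]) (auto simp: dihedral_group_def)

lemma inv_dihedral_zero: "inv\<^bsub>dihedral_group 4\<^esub> (0, False) = (0, False)"
  by (rule group.inv_equality[OF group_dihedral_group]) (auto simp: dihedral_group_def)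

text \<open>The value at \<open>\<rho>\<^sup>i \<tau>\<^sup>t\<close> of the homomorphism that sends the rotation \<open>\<rho>\<close> to \<open>r\<close> and the reflection \<open>\<tau>\<close> to \<open>s\<close>.\<close>
definition dihedral_word :: "('a, 'b) monoid_scheme \<Rightarrow> 'a \<Rightarrow> 'a \<Rightarrow> int \<times> bool \<Rightarrow> 'a" where
  "dihedral_word G r s = (\<lambda>(i, t). r [^]\<^bsub>G\<^esub> i \<otimes>\<^bsub>G\<^esub> (if t then s else \<one>\<^bsub>G\<^esub>))"

lemma (in group) dihedral_word_hom:
  assumes r: "r \<in> carrier G" "r [^] int n = \<one>"
    and s: "s \<in> carrier G" "s \<otimes> s = \<one>" and sr: "s \<otimes> r = inv r \<otimes> s"
  shows "dihedral_word G r s \<in> hom (dihedral_group n) G"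
proof (rule homI)
  have red: "r [^] (i mod int n) = r [^] i" for i
  proof -
    have "r [^] i = r [^] (int n * (i div int n) + i mod int n)" by simp
    also have "\<dots> = r [^] (i mod int n)"
      using r by (simp only: int_pow_mult) (simp flip: int_pow_pow)
    finally show ?thesis by simp
  qed
  have inv_s: "inv s = s" using s by (simp add: inv_equality)
  \<comment> \<open>Conjugation by \<open>s\<close> inverts \<open>r\<close>, hence all its powers.\<close>
  have flip: "s \<otimes> r [^] (i::int) = r [^] (- i) \<otimes> s" for i
  proof -
    have conj_pow: "(s \<otimes> r \<otimes> s) [^] k = s \<otimes> r [^] k \<otimes> s" for k :: nat
    proof (induction k)
      case (Suc k)
      have "s \<otimes> (s \<otimes> y) = y" if "y \<in> carrier G" for y
        using s that by (simp flip: m_assoc)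
      then show ?case using Suc r s by (simp add: m_assoc)
    qed (use s in simp)
    have srs: "s \<otimes> r \<otimes> s = inv r" using r s sr by (simp add: m_assoc)
    have nat: "s \<otimes> r [^] k \<otimes> s = inv (r [^] k)" for k :: nat
      using conj_pow[of k] srs r by (simp add: nat_pow_inv)
    have nat': "s \<otimes> inv (r [^] k) \<otimes> s = r [^] k" for k :: nat
    proof -
      have "s \<otimes> inv (r [^] k) \<otimes> s = inv (s \<otimes> r [^] k \<otimes> s)"
        using r s inv_s by (simp add: inv_mult_group m_assoc)
      then show ?thesis using nat[of k] r by simp
    qed
    have "s \<otimes> r [^] i \<otimes> s = r [^] (- i)"
    proof (cases i)
      case (nonneg k) then show ?thesis using nat[of k] r by (simp add: int_pow_neg int_pow_int)
    next
      case (neg k)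
      have "s \<otimes> r [^] (- int (Suc k)) \<otimes> s = r [^] Suc k"
        using nat'[of "Suc k"] r by (simp only: int_pow_neg int_pow_int)
      then show ?thesis using neg by (simp only: minus_minus int_pow_int)
    qed
    then have "s \<otimes> r [^] i \<otimes> s \<otimes> s = r [^] (- i) \<otimes> s" by simp
    then show ?thesis using r s by (simp add: m_assoc)
  qed
  fix x y assume "x \<in> carrier (dihedral_group n)" "y \<in> carrier (dihedral_group n)"
  obtain i t where x: "x = (i, t)" by force
  obtain j u where y: "y = (j, u)" by force
  have 1: "r [^] (i + j) = r [^] i \<otimes> r [^] j" and 2: "r [^] (i - j) = r [^] i \<otimes> r [^] (- j)"
    using r int_pow_mult[of r i j] int_pow_mult[of r i "- j"] by simp_all
  have 3: "s \<otimes> (r [^] j \<otimes> y) = r [^] (- j) \<otimes> (s \<otimes> y)" if "y \<in> carrier G" for y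
    using flip[of j] r s that by (metis int_pow_closed m_assoc)
  show "dihedral_word G r s (x \<otimes>\<^bsub>dihedral_group n\<^esub> y)
      = dihedral_word G r s x \<otimes> dihedral_word G r s y"
    using r s by (cases t; cases u)
      (simp_all add: x y dihedral_word_def dihedral_group_def red 1 2 3 flip m_assoc)
qed (use r s in \<open>auto simp: dihedral_word_def\<close>)

lemma (in group) commuting_product_hom:
  assumes "f \<in> hom A G" "g \<in> hom B G"
    and "\<And>x y. x \<in> carrier A \<Longrightarrow> y \<in> carrier B \<Longrightarrow> f x \<otimes> g y = g y \<otimes> f x"
  shows "(\<lambda>(x, y). f x \<otimes> g y) \<in> hom (A \<times>\<times> B) G"
proof (rule homI)
  fix p q assume "p \<in> carrier (A \<times>\<times> B)" "q \<in> carrier (A \<times>\<times> B)"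
  then obtain x y x' y' where p: "p = (x, y)" "q = (x', y')"
    and c: "x \<in> carrier A" "y \<in> carrier B" "x' \<in> carrier A" "y' \<in> carrier B" by auto
  have cl: "f x \<in> carrier G" "f x' \<in> carrier G" "g y \<in> carrier G" "g y' \<in> carrier G"
    using c assms(1,2) by (auto simp: hom_def)
  have "f x \<otimes> f x' \<otimes> (g y \<otimes> g y') = f x \<otimes> (f x' \<otimes> g y) \<otimes> g y'" using cl by (simp add: m_assoc)
  also have "\<dots> = f x \<otimes> (g y \<otimes> f x') \<otimes> g y'" using assms(3) c by simp
  finally show "(case p \<otimes>\<^bsub>A \<times>\<times> B\<^esub> q of (x, y) \<Rightarrow> f x \<otimes> g y)
      = (case p of (x, y) \<Rightarrow> f x \<otimes> g y) \<otimes> (case q of (x, y) \<Rightarrow> f x \<otimes> g y)"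
    using c assms(1,2) cl by (simp add: p hom_mult m_assoc)
qed (use assms in \<open>auto simp: hom_def\<close>)

lemma (in group) is_iso_of_trivial_kernel:
  assumes A: "group A" and h: "h \<in> hom A G"
    and ker: "\<And>x. x \<in> carrier A \<Longrightarrow> h x = \<one> \<Longrightarrow> x = \<one>\<^bsub>A\<^esub>"
    and card: "card (carrier A) = card (carrier G)" and fin: "finite (carrier G)"
  shows "G \<cong> A"
proof -
  interpret h: group_hom A G h by (simp add: A group_hom_axioms_def group_hom_def h is_group)
  have "inj_on h (carrier A)"
    by (rule h.trivial_ker_imp_inj) (use ker in \<open>auto simp: kernel_def\<close>)
  then have "card (h ` carrier A) = card (carrier G)" by (simp add: card_image card)
  moreover have "h ` carrier A \<subseteq> carrier G" by auto
  ultimately have "h ` carrier A = carrier G" using fin card_subset_eq by blast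
  then have "h \<in> iso A G"
    using \<open>inj_on h (carrier A)\<close> h by (simp add: iso_def bij_betw_def)
  then show ?thesis using A group.iso_sym is_iso_def by blast
qed

text \<open>The quotient is isomorphic to the image of \<open>h\<close>, so the assumption on the orders forces \<open>h\<close> to be onto.\<close>
lemma (in group) is_iso_factor_group:
  assumes A: "group A" and h: "h \<in> hom A G"
    and ker: "kernel A G h = N"
    and card: "card (carrier A) = card N * card (carrier G)" and fin: "finite (carrier A)" "finite (carrier G)"
  shows "G \<cong> A Mod N"
proof -
  interpret h: group_hom A G h by (simp add: A group_hom_axioms_def group_hom_def h is_group)
  have img: "subgroup (h ` carrier A) G" by (rule h.img_is_subgroup)
  interpret hi: group_hom A "G\<lparr>carrier := h ` carrier A\<rparr>" h
    using h by (simp add: group_hom_def group_hom_axioms_def A is_group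
        subgroup.subgroup_is_group[OF img] hom_def Pi_def)
  have 1: "A Mod kernel A (G\<lparr>carrier := h ` carrier A\<rparr>) h \<cong> G\<lparr>carrier := h ` carrier A\<rparr>"
    by (rule hi.FactGroup_iso) simp
  have 2: "kernel A (G\<lparr>carrier := h ` carrier A\<rparr>) h = N" using ker by (simp add: kernel_def)
  have N: "subgroup N A" using h.subgroup_kernel ker by simp
  have "card (carrier (A Mod N)) * card N = card (carrier A)"
    using group.lagrange[OF A N] by (simp add: FactGroup_def Coset.order_def)
  moreover have "card N > 0"
    using N fin(1) by (meson subgroup.finite_imp_card_positive)
  ultimately have "card (carrier (A Mod N)) = card (carrier G)" using card by simp
  moreover have "card (carrier (A Mod N)) = card (h ` carrier A)"
    using 1 2 iso_same_card by fastforce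
  ultimately have "h ` carrier A = carrier G"
    using card_subset_eq[OF fin(2) subgroup.subset[OF img]] by simp
  then have "A Mod N \<cong> G" using h.FactGroup_iso ker by simp
  moreover have "group (A Mod N)"
    using ker h.normal_kernel normal.factorgroup_is_group by blast
  ultimately show ?thesis by (simp add: group.iso_sym)
qed

section \<open>Groups with a quadratic form modulo a central involution\<close>

text \<open>These groups are the preimages of the subspaces of \<open>\<bbbF>\<^sub>2\<^sup>4\<close> in the extraspecial group \<open>2\<^sub>+\<^sup>1\<^sup>+\<^sup>4\<close>:
  \<open>v\<close> is reduction modulo the central involution \<open>z\<close>.\<close>
locale plus_type_group = group G for G (structure) +
  fixes z and v :: "'a \<Rightarrow> vec4"
  assumes fin: "finite (carrier G)"
    and z_closed [simp]: "z \<in> carrier G" and z_neq_one: "z \<noteq> \<one>"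
    and v_mult: "\<And>x y. x \<in> carrier G \<Longrightarrow> y \<in> carrier G \<Longrightarrow> v (x \<otimes> y) = vadd (v x) (v y)"
    and v_zero_iff: "\<And>x. x \<in> carrier G \<Longrightarrow> v x = vzero \<longleftrightarrow> x = \<one> \<or> x = z"
    and square: "\<And>x. x \<in> carrier G \<Longrightarrow> x \<otimes> x = (if quad (v x) then z else \<one>)"
begin

lemma v_one [simp]: "v \<one> = vzero" and v_z [simp]: "v z = vzero"
  by (simp_all add: v_zero_iff)

lemma z_square: "z \<otimes> z = \<one>"
  by (simp add: square)

lemma v_inv: "x \<in> carrier G \<Longrightarrow> v (inv x) = v x"
  using v_mult[of x "inv x"] by (metis inv_closed r_inv v_one vadd_cancel vadd_zero(2))

text \<open>The elements \<open>x\<close> and \<open>x z\<close> have the same image under \<open>v\<close>, hence the same square.\<close>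
lemma z_central:
  assumes x: "x \<in> carrier G" shows "x \<otimes> z = z \<otimes> x"
proof -
  have "(x \<otimes> z) \<otimes> (x \<otimes> z) = x \<otimes> x"
    using x by (simp add: square v_mult)
  then have "z \<otimes> (x \<otimes> z) = x" using x by (simp add: m_assoc)
  then have "z \<otimes> (x \<otimes> z) \<otimes> z = x \<otimes> z" by simp
  then show ?thesis using x by (simp add: m_assoc z_square)
qed

text \<open>Commutators come for free from squares: \<open>(x y)\<^sup>2 = x (y x) y\<close>, so comparing it with \<open>x\<^sup>2 y\<^sup>2\<close> shows that the
  polar form decides whether \<open>x\<close> and \<open>y\<close> commute.\<close>
lemma swap:
  assumes x: "x \<in> carrier G" and y: "y \<in> carrier G"
  shows "x \<otimes> y = (if polar (v x) (v y) then z \<otimes> (y \<otimes> x) else y \<otimes> x)"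
proof -
  define m where "m = x \<otimes> y"
  have m: "m \<in> carrier G" using x y by (simp add: m_def)
  have zz: "z \<otimes> (z \<otimes> u) = u" if "u \<in> carrier G" for u
    using that z_square by (simp flip: m_assoc)
  have solve: "u = w \<otimes> inv m" if "u \<otimes> m = w" "u \<in> carrier G" "w \<in> carrier G" for u w
    using that m by (metis inv_solve_right)
  have "y \<otimes> x \<otimes> m = y \<otimes> (x \<otimes> x) \<otimes> y" using x y by (simp add: m_def m_assoc)
  also have "\<dots> = (if quad (v x) then z \<otimes> (y \<otimes> y) else y \<otimes> y)"
    using y z_central[OF y] by (simp add: square[OF x] flip: m_assoc)
  also have "\<dots> = (if quad (v x) \<noteq> quad (v y) then z else \<one>)"
    by (simp add: square[OF y] z_square)
  finally have yx: "y \<otimes> x = (if quad (v x) \<noteq> quad (v y) then z else \<one>) \<otimes> inv m"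
    using x y by (intro solve) auto
  have mm: "m = (if quad (v m) then z else \<one>) \<otimes> inv m"
    by (rule solve) (use m in \<open>auto simp: square\<close>)
  have "polar (v x) (v y) \<longleftrightarrow> (quad (v m) \<noteq> (quad (v x) \<noteq> quad (v y)))"
    using x y by (simp add: polar_eq m_def v_mult)
  then have "m = (if polar (v x) (v y) then z \<otimes> (y \<otimes> x) else y \<otimes> x)"
    using m by (subst mm) (auto simp: yx zz)
  then show ?thesis by (simp only: m_def)
qed

lemma commute: "x \<in> carrier G \<Longrightarrow> y \<in> carrier G \<Longrightarrow> \<not> polar (v x) (v y) \<Longrightarrow> x \<otimes> y = y \<otimes> x"
  by (simp add: swap)

text \<open>The fibres of \<open>v\<close> are the cosets of its kernel, the subgroup consisting of the identity and \<open>z\<close>.\<close>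
lemma card_carrier: "card (carrier G) = 2 * card (v ` carrier G)"
proof -
  have fibre: "card {x \<in> carrier G. v x = u} = 2" if u: "u \<in> v ` carrier G" for u
  proof -
    obtain x where x: "x \<in> carrier G" "u = v x" using u by (elim imageE)
    have "y = x \<or> y = x \<otimes> z" if "y \<in> carrier G" "v y = v x" for y
    proof -
      have "v (inv x \<otimes> y) = vzero" using x that by (simp add: v_mult v_inv)
      then have "inv x \<otimes> y = \<one> \<or> inv x \<otimes> y = z" using x that by (simp add: v_zero_iff)
      then show ?thesis using x that inv_solve_left' by (metis inv_equality inv_inv inv_closed r_one inv_solve_left m_closed z_closed)
    qed
    then have "{y \<in> carrier G. v y = u} = {x, x \<otimes> z}" using x by (auto simp: v_mult)
    moreover have "x \<noteq> x \<otimes> z" using x z_neq_one by (metis l_cancel_one' z_closed)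
    ultimately show ?thesis by simp
  qed
  have "card (carrier G) = (\<Sum>x\<in>carrier G. 1)" by simp
  also have "\<dots> = (\<Sum>u\<in>v ` carrier G. \<Sum>x\<in>{x \<in> carrier G. v x = u}. 1)"
    by (rule sum.image_gen[OF fin])
  also have "\<dots> = (\<Sum>u\<in>v ` carrier G. 2)" by (rule sum.cong) (use fibre in auto)
  finally show ?thesis by simp
qed

lemma v_image_closed: "u \<in> v ` carrier G \<Longrightarrow> w \<in> v ` carrier G \<Longrightarrow> vadd u w \<in> v ` carrier G"
  by (force simp flip: v_mult)

lemma v_pow: "x \<in> carrier G \<Longrightarrow> v (x [^] (i::int)) = (if odd i then v x else vzero)"
proof -
  assume x: "x \<in> carrier G"
  have even: "v (x [^] (k + k)) = vzero" for k :: int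
    using x int_pow_mult[of x k k] by (simp only: v_mult int_pow_closed vadd_self)
  show ?thesis
  proof (cases "even i")
    case True then show ?thesis using even by (auto elim!: evenE simp flip: mult_2)
  next
    case False
    then obtain k where "i = (k + k) + 1" by (metis oddE mult_2)
    then have "x [^] i = x [^] (k + k) \<otimes> x" using x int_pow_mult[of x "k + k" 1] by simp
    then show ?thesis using x False even by (simp add: v_mult)
  qed
qed

lemma pow_two: "x \<in> carrier G \<Longrightarrow> x [^] (2::int) = (if quad (v x) then z else \<one>)"
  using int_pow_mult[of x 1 1] by (simp add: square)

lemma pow_four: "x \<in> carrier G \<Longrightarrow> x [^] (4::int) = \<one>"
  using int_pow_mult[of x 2 2] by (simp add: pow_two z_square)

lemma dihedral_word_hom_D4:
  assumes r: "r \<in> carrier G" "quad (v r)" and s: "s \<in> carrier G" "\<not> quad (v s)"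
    and rs: "polar (v r) (v s)"
  shows "dihedral_word G r s \<in> hom (dihedral_group 4) G"
proof (rule dihedral_word_hom)
  show "r [^] int 4 = \<one>" using pow_four[OF r(1)] by simp
  show "s \<otimes> s = \<one>" using s by (simp add: square)
  have "(z \<otimes> r) \<otimes> r = \<one>" using r by (simp add: m_assoc square z_square)
  then have "inv r = z \<otimes> r" using r by (simp add: inv_equality)
  moreover have "polar (v s) (v r)" using rs by (simp add: polar_eq vadd_commute) blast
  ultimately show "s \<otimes> r = inv r \<otimes> s" using swap[of s r] r s by (simp add: m_assoc)
qed (use r s in auto)

lemma v_dihedral_word:
  assumes "r \<in> carrier G" "s \<in> carrier G"
  shows "v (dihedral_word G r s (j, t)) = vadd (if odd j then v r else vzero) (if t then v s else vzero)"
  using assms by (simp add: dihedral_word_def v_mult v_pow)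

lemma dihedral_word_closed [simp]:
  assumes "r \<in> carrier G" "s \<in> carrier G" shows "dihedral_word G r s x \<in> carrier G"
  using assms by (auto simp: dihedral_word_def split: prod.split)

lemma dihedral_word_commute:
  assumes "r \<in> carrier G" "s \<in> carrier G" "x \<in> carrier G" "\<not> polar (v x) (v r)" "\<not> polar (v x) (v s)"
  shows "x \<otimes> dihedral_word G r s y = dihedral_word G r s y \<otimes> x"
  using assms by (intro commute) (cases y; auto simp: v_dihedral_word polar_add)+

lemma pow_even: "x \<in> carrier G \<Longrightarrow> quad (v x) \<Longrightarrow> even i \<Longrightarrow> 0 \<le> i \<Longrightarrow> i < 4
    \<Longrightarrow> x [^] (i::int) = (if i = 0 then \<one> else z)"
proof -
  assume "x \<in> carrier G" "quad (v x)" "even i" "0 \<le> i" "i < 4"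
  then have "i = 0 \<or> i = 2" by presburger
  then show ?thesis using \<open>x \<in> carrier G\<close> \<open>quad (v x)\<close> by (auto simp: pow_two)
qed

text \<open>Without elements of order four the group is elementary abelian; \<open>z\<close> and lifts \<open>t\<close>, \<open>x\<close> of a basis of the
  image of \<open>v\<close> form a basis of the group. In this and the following lemmas, a word in the generators
  that equals the identity is treated by applying \<open>v\<close>, which leaves a power of \<open>z\<close>.\<close>
lemma iso_C2_C2_C2:
  assumes card: "card (carrier G) = 8" and nq: "\<And>x. x \<in> carrier G \<Longrightarrow> \<not> quad (v x)"
  shows "G \<cong> integer_mod_group 2 \<times>\<times> integer_mod_group 2 \<times>\<times> integer_mod_group 2"
proof -
  have card_v: "card (v ` carrier G) = 4" using card card_carrier by simp
  have "\<not> v ` carrier G \<subseteq> {vzero}" using card_v card_mono[of "{vzero}" "v ` carrier G"] by auto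
  then obtain t where t: "t \<in> carrier G" "v t \<noteq> vzero" by blast
  have "\<not> v ` carrier G \<subseteq> {vzero, v t}"
    using card_v card_mono[of "{vzero, v t}" "v ` carrier G"] t by auto
  then obtain x where x: "x \<in> carrier G" "v x \<noteq> vzero" "v x \<noteq> v t" by blast
  have comm: "a \<otimes> b = b \<otimes> a" if "a \<in> carrier G" "b \<in> carrier G" for a b
    using that nq[of "a \<otimes> b"] nq[of a] nq[of b] by (intro commute) (auto simp: polar_eq v_mult)
  have cyc: "(\<lambda>i::int. a [^] i) \<in> hom (integer_mod_group 2) G" if "a \<in> carrier G" for a
    using that nq[of a] by (intro cyclic_word_hom) (auto simp: pow_two)
  have car: "i = 0 \<or> i = 1" if "i \<in> carrier (integer_mod_group 2)" for i
    using that by (auto simp: carrier_integer_mod_group)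
  let ?h = "\<lambda>(i, j, k). z [^] (i::int) \<otimes> (t [^] (j::int) \<otimes> x [^] (k::int))"
  have "?h \<in> hom (integer_mod_group 2 \<times>\<times> integer_mod_group 2 \<times>\<times> integer_mod_group 2) G"
    using commuting_product_hom[OF cyc commuting_product_hom[OF cyc cyc], of z t x] x t comm
    by (simp add: case_prod_unfold)
  then show ?thesis
  proof (rule is_iso_of_trivial_kernel[rotated])
    fix q assume q: "q \<in> carrier (integer_mod_group 2 \<times>\<times> integer_mod_group 2 \<times>\<times> integer_mod_group 2)"
      and 1: "?h q = \<one>"
    obtain i j k where ijk: "q = (i, j, k)" by (cases q)
    have 2: "z [^] i \<otimes> (t [^] j \<otimes> x [^] k) = \<one>" using 1 by (simp add: ijk)
    have "v (z [^] i \<otimes> (t [^] j \<otimes> x [^] k))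
        = vadd (if odd j then v t else vzero) (if odd k then v x else vzero)"
      using t x by (simp add: v_mult v_pow)
    then have "vadd (if odd j then v t else vzero) (if odd k then v x else vzero) = vzero"
      by (simp only: 2 v_one)
    then have "j = 0" "k = 0" using car[of j] car[of k] q t x by (auto simp: ijk split: if_splits)
    then have "z [^] i = \<one>" using 1 by (simp add: ijk)
    then have "i = 0" using car[of i] q z_neq_one by (auto simp: ijk)
    then show "q = \<one>\<^bsub>integer_mod_group 2 \<times>\<times> integer_mod_group 2 \<times>\<times> integer_mod_group 2\<^esub>"
      using \<open>j = 0\<close> \<open>k = 0\<close> by (simp add: ijk)
  qed (auto simp: carrier_integer_mod_group card fin intro!: DirProd_group)
qed

lemma iso_C4_C2:
  assumes card: "card (carrier G) = 8"
    and x: "x \<in> carrier G" "quad (v x)" and t: "t \<in> carrier G" "\<not> quad (v t)" "v t \<noteq> vzero"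
    and comm: "\<not> polar (v x) (v t)"
  shows "G \<cong> integer_mod_group 4 \<times>\<times> integer_mod_group 2"
proof -
  have [simp]: "v x \<noteq> v t" "v x \<noteq> vzero" using x t by auto
  have "(\<lambda>i::int. x [^] i) \<in> hom (integer_mod_group 4) G"
    using x pow_four[of x] by (intro cyclic_word_hom) auto
  moreover have "(\<lambda>i::int. t [^] i) \<in> hom (integer_mod_group 2) G"
    using t by (intro cyclic_word_hom) (auto simp: pow_two)
  moreover have "x [^] i \<otimes> t [^] j = t [^] j \<otimes> x [^] i" for i j :: int
    using x t comm by (intro commute) (auto simp: v_pow)
  ultimately have "(\<lambda>(i, j). x [^] i \<otimes> t [^] j) \<in> hom (integer_mod_group 4 \<times>\<times> integer_mod_group 2) G"
    by (intro commuting_product_hom) auto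
  then show ?thesis
  proof (rule is_iso_of_trivial_kernel[rotated])
    fix q assume q: "q \<in> carrier (integer_mod_group 4 \<times>\<times> integer_mod_group 2)"
      and 1: "(\<lambda>(i, j). x [^] i \<otimes> t [^] j) q = \<one>"
    obtain i j where ij: "q = (i, j)" by (cases q)
    have b: "0 \<le> i" "i < 4" "0 \<le> j" "j < 2" using q by (auto simp: ij carrier_integer_mod_group)
    have "v (x [^] i \<otimes> t [^] j) = vzero" using 1 by (simp add: ij)
    then have "vadd (if odd i then v x else vzero) (if odd j then v t else vzero) = vzero"
      using t x by (simp add: v_mult v_pow)
    then have e: "even i" "even j" using t by (auto split: if_splits)
    then have "j = 0" using b by presburger
    moreover from this have "i = 0"
      using 1 pow_even[OF x e(1) b(1,2)] z_neq_one by (auto simp: ij split: if_splits)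
    ultimately show "q = \<one>\<^bsub>integer_mod_group 4 \<times>\<times> integer_mod_group 2\<^esub>" by (simp add: ij)
  qed (auto simp: carrier_integer_mod_group card fin intro!: DirProd_group)
qed

lemma iso_D4:
  assumes card: "card (carrier G) = 8"
    and x: "x \<in> carrier G" "quad (v x)" and t: "t \<in> carrier G" "\<not> quad (v t)"
    and comm: "polar (v x) (v t)"
  shows "G \<cong> dihedral_group 4"
proof (rule is_iso_of_trivial_kernel[OF _ dihedral_word_hom_D4[OF x t comm]])
  have ne: "v x \<noteq> v t" "v x \<noteq> vzero" "v t \<noteq> vzero" using x t comm by auto
  fix q assume q: "q \<in> carrier (dihedral_group 4)" and 1: "dihedral_word G x t q = \<one>"
  obtain j u where ju: "q = (j, u)" by (cases q)
  have b: "0 \<le> j" "j < 4" using q dihedral_carrierD ju by auto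
  have "v (dihedral_word G x t (j, u)) = vzero" using 1 by (simp add: ju)
  then have e: "even j" "\<not> u" using ne x t by (auto simp: v_dihedral_word split: if_splits)
  then have "x [^] j = \<one>" using 1 x by (simp add: ju dihedral_word_def)
  then have "j = 0" using pow_even[OF x e(1) b] z_neq_one by (auto split: if_splits)
  then show "q = \<one>\<^bsub>dihedral_group 4\<^esub>" using e by (simp add: ju one_dihedral)
qed (auto simp: card_dihedral card fin group_dihedral_group)

lemma central_dihedral_hom:
  assumes r: "r \<in> carrier G" "quad (v r)" and s: "s \<in> carrier G" "\<not> quad (v s)"
    and rs: "polar (v r) (v s)"
    and w: "w \<in> carrier G" "\<not> polar (v w) (v r)" "\<not> polar (v w) (v s)" and n: "w [^] int n = \<one>"
  shows "(\<lambda>(i, y). w [^] i \<otimes> dihedral_word G r s y) \<in> hom (integer_mod_group n \<times>\<times> dihedral_group 4) G"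
  using r s w
  by (intro commuting_product_hom cyclic_word_hom[OF w(1) n] dihedral_word_hom_D4[OF r s rs]
      dihedral_word_commute) (auto simp: v_pow)

text \<open>The words in a central element \<open>w\<close> and a dihedral group that represent the identity. Apart from powers of
  \<open>z\<close> there are none, because the images of the generators in \<open>\<bbbF>\<^sub>2\<^sup>4\<close> are linearly independent.\<close>
lemma central_dihedral_kernel:
  assumes r: "r \<in> carrier G" and s: "s \<in> carrier G"
    and rs: "polar (v r) (v s)"
    and w: "w \<in> carrier G" "\<not> polar (v w) (v r)" "\<not> polar (v w) (v s)" "v w \<noteq> vzero"
    and 1: "w [^] (i::int) \<otimes> dihedral_word G r s (j, t) = \<one>"
  shows "even i" "even j" "\<not> t" "w [^] i \<otimes> r [^] j = \<one>"
proof -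
  have "v (w [^] i \<otimes> dihedral_word G r s (j, t)) = vadd (if odd i then v w else vzero)
      (vadd (if odd j then v r else vzero) (if t then v s else vzero))"
    using w(1) r s by (simp add: v_mult v_pow v_dihedral_word)
  then have "vadd (if odd i then v w else vzero)
      (vadd (if odd j then v r else vzero) (if t then v s else vzero)) = vzero"
    by (simp only: 1 v_one)
  then show "even i" "even j" "\<not> t" using symplectic_independent[OF rs w(2-4)] by blast+
  then show "w [^] i \<otimes> r [^] j = \<one>" using 1 r by (simp add: dihedral_word_def)
qed

lemma iso_C2_D4:
  assumes card: "card (carrier G) = 16"
    and r: "r \<in> carrier G" "quad (v r)" and s: "s \<in> carrier G" "\<not> quad (v s)"
    and rs: "polar (v r) (v s)"
    and w: "w \<in> carrier G" "\<not> polar (v w) (v r)" "\<not> polar (v w) (v s)" "v w \<noteq> vzero"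
    and sq: "\<not> quad (v w)"
  shows "G \<cong> integer_mod_group 2 \<times>\<times> dihedral_group 4"
proof (rule is_iso_of_trivial_kernel[OF _ central_dihedral_hom[OF r s rs w(1-3)]])
  fix q assume q: "q \<in> carrier (integer_mod_group 2 \<times>\<times> dihedral_group 4)"
    and 1: "(\<lambda>(i, y). w [^] i \<otimes> dihedral_word G r s y) q = \<one>"
  obtain i j t where ijt: "q = (i, j, t)" by (cases q)
  have b: "0 \<le> i" "i < 2" "0 \<le> j" "j < 4"
    using q dihedral_carrierD by (auto simp: ijt carrier_integer_mod_group)
  note k = central_dihedral_kernel[OF r(1) s(1) rs w, of i j t]
  have e: "even i" "even j" "\<not> t" "w [^] i \<otimes> r [^] j = \<one>" using 1 k by (simp_all add: ijt)
  then have "i = 0" using b by presburger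
  then have "j = 0" using e pow_even[OF r e(2) b(3,4)] z_neq_one r by (auto split: if_splits)
  then show "q = \<one>\<^bsub>integer_mod_group 2 \<times>\<times> dihedral_group 4\<^esub>"
    using \<open>i = 0\<close> e by (simp add: ijt one_dihedral)
next
  show "w [^] int 2 = \<one>" using w sq by (simp add: pow_two)
qed (auto simp: carrier_integer_mod_group card_dihedral card fin card_cartesian_product
      group_dihedral_group intro!: DirProd_group)

text \<open>Here \<open>w\<close> has order four, and the only coincidence between the two factors is \<open>w\<^sup>2 = z = r\<^sup>2\<close>.\<close>
lemma iso_C4_circ_D4:
  assumes card: "card (carrier G) = 16"
    and r: "r \<in> carrier G" "quad (v r)" and s: "s \<in> carrier G" "\<not> quad (v s)"
    and rs: "polar (v r) (v s)"
    and w: "w \<in> carrier G" "\<not> polar (v w) (v r)" "\<not> polar (v w) (v s)" "quad (v w)"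
  shows "G \<cong> C4_circ_D4"
  unfolding C4_circ_D4_def central_product_def
proof (rule is_iso_factor_group[OF _ central_dihedral_hom[OF r s rs w(1-3)]])
  have w0: "v w \<noteq> vzero" using w by auto
  let ?h = "\<lambda>(i, y). w [^] i \<otimes> dihedral_word G r s y"
  have N: "(\<lambda>z. (z, inv\<^bsub>dihedral_group 4\<^esub> (z, False))) ` {0, 2} = {(0, 0, False), (2, 2, False)}"
    by (simp add: inv_dihedral_two inv_dihedral_zero)
  show "kernel (integer_mod_group 4 \<times>\<times> dihedral_group 4) G ?h
      = (\<lambda>z. (z, inv\<^bsub>dihedral_group 4\<^esub> (z, False))) ` {0, 2}" (is "?K = _")
  proof
    show "?K \<subseteq> (\<lambda>z. (z, inv\<^bsub>dihedral_group 4\<^esub> (z, False))) ` {0, 2}"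
    proof
      fix q assume q: "q \<in> ?K"
      obtain i j t where ijt: "q = (i, j, t)" by (cases q)
      have b: "0 \<le> i" "i < 4" "0 \<le> j" "j < 4"
        using q dihedral_carrierD by (auto simp: ijt carrier_integer_mod_group kernel_def)
      have "?h (i, j, t) = \<one>" using q by (simp add: kernel_def ijt)
      then have e: "even i" "even j" "\<not> t" "w [^] i \<otimes> r [^] j = \<one>"
        using central_dihedral_kernel[OF r(1) s(1) rs w(1-3) w0, of i j t] by simp_all
      have "i = 0 \<or> i = 2" "j = 0 \<or> j = 2" using e b by presburger+
      then have "i = j" using e(4) r w z_neq_one by (auto simp: pow_two)
      then show "q \<in> (\<lambda>z. (z, inv\<^bsub>dihedral_group 4\<^esub> (z, False))) ` {0, 2}"
        using \<open>i = 0 \<or> i = 2\<close> e unfolding N by (auto simp: ijt)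
    qed
  next
    show "(\<lambda>z. (z, inv\<^bsub>dihedral_group 4\<^esub> (z, False))) ` {0, 2} \<subseteq> ?K"
      unfolding N using r w
      by (auto simp: kernel_def carrier_integer_mod_group dihedral_group_def dihedral_word_def
          pow_two z_square)
  qed
  show "card (carrier (integer_mod_group 4 \<times>\<times> dihedral_group 4))
      = card ((\<lambda>z. (z, inv\<^bsub>dihedral_group 4\<^esub> (z, False))) ` {0, 2}) * card (carrier G)"
    unfolding N by (simp add: card carrier_integer_mod_group card_dihedral card_cartesian_product)
next
  show "w [^] int 4 = \<one>" using pow_four[OF w(1)] by simp
qed (auto simp: carrier_integer_mod_group finite_dihedral fin group_dihedral_group intro!: DirProd_group)

text \<open>The first two coordinates span a hyperbolic plane, whose lifts form a dihedral group, and so do the last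
  two. The planes are orthogonal, so the dihedral groups commute, and they meet in the powers of \<open>z\<close>.\<close>
lemma iso_D4_circ_D4:
  assumes card: "card (carrier G) = 32"
  shows "G \<cong> D4_circ_D4"
proof -
  have "card (v ` carrier G) = 16" using card card_carrier by simp
  then have UN: "v ` carrier G = UNIV" by (intro large_subspace_eq_UNIV v_image_closed) auto
  then have "\<exists>x\<in>carrier G. v x = u" for u by (metis UNIV_I imageE)
  then obtain g where g: "g u \<in> carrier G" "v (g u) = u" for u by metis
  define r s r' s' where rs: "r = g (True, True, False, False)" "s = g (True, False, False, False)"
    "r' = g (False, False, True, True)" "s' = g (False, False, True, False)"
  have [simp]: "r \<in> carrier G" "s \<in> carrier G" "r' \<in> carrier G" "s' \<in> carrier G"
    and v: "v r = (True, True, False, False)" "v s = (True, False, False, False)"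
    "v r' = (False, False, True, True)" "v s' = (False, False, True, False)"
    by (simp_all add: rs g)
  let ?h = "\<lambda>(x, y). dihedral_word G r s x \<otimes> dihedral_word G r' s' y"
  have hom: "?h \<in> hom (dihedral_group 4 \<times>\<times> dihedral_group 4) G"
  proof (intro commuting_product_hom dihedral_word_hom_D4 dihedral_word_commute)
    fix x
    show "\<not> polar (v (dihedral_word G r s x)) (v r')" "\<not> polar (v (dihedral_word G r s x)) (v s')"
      by (cases x; simp add: v_dihedral_word v vzero_def)+
  qed (simp_all add: v)
  have N: "(\<lambda>z. (z, inv\<^bsub>dihedral_group 4\<^esub> z)) ` {(0, False), (2, False)}
      = {((0, False), (0, False)), ((2, False), (2, False))}"
    by (simp add: inv_dihedral_two inv_dihedral_zero)
  show ?thesis unfolding D4_circ_D4_def central_product_def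
  proof (rule is_iso_factor_group[OF _ hom])
    show "kernel (dihedral_group 4 \<times>\<times> dihedral_group 4) G ?h
      = (\<lambda>z. (z, inv\<^bsub>dihedral_group 4\<^esub> z)) ` {(0, False), (2, False)}" (is "?K = _")
      unfolding N
    proof
      show "?K \<subseteq> {((0, False), (0, False)), ((2, False), (2, False))}"
      proof
        fix q assume q: "q \<in> ?K"
        obtain i t j u where ij: "q = ((i, t), (j, u))" by (metis surj_pair)
        have b: "0 \<le> i" "i < 4" "0 \<le> j" "j < 4"
          using q dihedral_carrierD by (auto simp: ij kernel_def)
        have 1: "?h ((i, t), (j, u)) = \<one>" using q by (simp add: kernel_def ij)
        then have "v (?h ((i, t), (j, u))) = vzero" by simp
        then have e: "even i" "even j" "\<not> t" "\<not> u"
          by (auto simp: v_mult v_dihedral_word v vzero_def split: if_splits)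
        have "i = 0 \<or> i = 2" "j = 0 \<or> j = 2" using e b by presburger+
        moreover from this have "i = j" using e 1 z_neq_one by (auto simp: pow_two v dihedral_word_def)
        ultimately show "q \<in> {((0, False), (0, False)), ((2, False), (2, False))}"
          using e by (auto simp: ij)
      qed
    next
      show "{((0, False), (0, False)), ((2, False), (2, False))} \<subseteq> ?K"
        by (auto simp: kernel_def dihedral_group_def dihedral_word_def pow_two z_square v)
    qed
    show "card (carrier (dihedral_group 4 \<times>\<times> dihedral_group 4))
      = card ((\<lambda>z. (z, inv\<^bsub>dihedral_group 4\<^esub> z)) ` {(0, False), (2, False)}) * card (carrier G)"
      unfolding N by (simp add: card card_dihedral card_cartesian_product)
  qed (auto simp: finite_dihedral fin group_dihedral_group intro!: DirProd_group)
qed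

text \<open>The element \<open>t\<close> is an involution other than \<open>z\<close>. In order eight it excludes the
  quaternion group: if \<open>x\<close> has order four, then \<open>x\<close> and \<open>t\<close> generate \<open>C\<^sub>4 \<times> C\<^sub>2\<close> or \<open>D\<^sub>4\<close>, depending on
  whether they commute.\<close>
theorem classification:
  assumes card: "card (carrier G) \<in> {8, 16, 32}"
    and t: "t \<in> carrier G" "v t \<noteq> vzero" "\<not> quad (v t)"
  shows "G \<cong> integer_mod_group 4 \<times>\<times> integer_mod_group 2
    \<or> G \<cong> integer_mod_group 2 \<times>\<times> integer_mod_group 2 \<times>\<times> integer_mod_group 2
    \<or> G \<cong> dihedral_group 4 \<or> G \<cong> integer_mod_group 2 \<times>\<times> dihedral_group 4
    \<or> G \<cong> C4_circ_D4 \<or> G \<cong> D4_circ_D4"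
proof -
  consider "card (carrier G) = 8" "\<And>x. x \<in> carrier G \<Longrightarrow> \<not> quad (v x)"
    | x where "card (carrier G) = 8" "x \<in> carrier G" "quad (v x)"
    | "card (carrier G) = 16" | "card (carrier G) = 32"
    using card by blast
  then show ?thesis
  proof cases
    case 1
    then show ?thesis using iso_C2_C2_C2 by blast
  next
    case 2
    then show ?thesis using iso_C4_C2[OF 2 t(1,3,2)] iso_D4[OF 2 t(1,3)] by blast
  next
    case 3
    then have "card (v ` carrier G) = 8" using card_carrier by simp
    then obtain l where l: "l \<noteq> vzero" "\<And>u. u \<in> v ` carrier G \<longleftrightarrow> \<not> dot l u"
      using hyperplane_of_index_two[OF v_image_closed] by blast
    obtain w r s where wrs: "\<not> dot l w" "\<not> dot l r" "\<not> dot l s"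
      "w \<noteq> vzero" "quad r" "\<not> quad s" "polar r s" "\<not> polar w r" "\<not> polar w s"
      using hyperplane_frame[OF l(1)] by blast
    have "\<exists>x\<in>carrier G. v x = u" if "\<not> dot l u" for u
      using that l(2)[of u] by (metis imageE)
    then obtain x y g where g: "x \<in> carrier G" "v x = w" "y \<in> carrier G" "v y = r" "g \<in> carrier G" "v g = s"
      using wrs(1-3) by metis
    show ?thesis
      using iso_C2_D4[OF 3 g(3) _ g(5) _ _ g(1)] iso_C4_circ_D4[OF 3 g(3) _ g(5) _ _ g(1)] wrs(4-9)
      unfolding g(2,4,6) by blast
  next
    case 4
    then show ?thesis using iso_D4_circ_D4 by blast
  qed
qed

end

section \<open>Embeddings of subfields of the complex numbers and Galois groups\<close>

definition complex_subfield :: "complex set \<Rightarrow> bool" where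
  "complex_subfield K \<longleftrightarrow> 1 \<in> K \<and> (\<forall>x\<in>K. - x \<in> K \<and> inverse x \<in> K)
     \<and> (\<forall>x\<in>K. \<forall>y\<in>K. x + y \<in> K \<and> x * y \<in> K)"

lemma complex_subfieldD:
  assumes "complex_subfield K"
  shows "1 \<in> K" "0 \<in> K" "x \<in> K \<Longrightarrow> - x \<in> K" "x \<in> K \<Longrightarrow> inverse x \<in> K"
    "x \<in> K \<Longrightarrow> y \<in> K \<Longrightarrow> x + y \<in> K" "x \<in> K \<Longrightarrow> y \<in> K \<Longrightarrow> x * y \<in> K"
    "x \<in> K \<Longrightarrow> y \<in> K \<Longrightarrow> x - y \<in> K" "x \<in> K \<Longrightarrow> y \<in> K \<Longrightarrow> x / y \<in> K" "x \<in> K \<Longrightarrow> x ^ n \<in> K"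
proof -
  show 1: "1 \<in> K" and neg: "x \<in> K \<Longrightarrow> - x \<in> K" and inv: "x \<in> K \<Longrightarrow> inverse x \<in> K"
    and add: "x \<in> K \<Longrightarrow> y \<in> K \<Longrightarrow> x + y \<in> K" and mult: "x \<in> K \<Longrightarrow> y \<in> K \<Longrightarrow> x * y \<in> K" for x y
    using assms by (auto simp: complex_subfield_def)
  show "0 \<in> K" using add[OF 1 neg[OF 1]] by simp
  show "x \<in> K \<Longrightarrow> y \<in> K \<Longrightarrow> x - y \<in> K" using add[of x "- y"] neg by simp
  show "x \<in> K \<Longrightarrow> y \<in> K \<Longrightarrow> x / y \<in> K" using mult[of x "inverse y"] inv by (simp add: divide_inverse)
  show "x \<in> K \<Longrightarrow> x ^ n \<in> K" by (induction n) (use 1 mult in auto)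
qed

lemma of_rat_in_complex_subfield:
  assumes K: "complex_subfield K" shows "of_rat q \<in> K"
proof -
  note D = complex_subfieldD[OF K]
  have nat: "of_nat n \<in> K" for n by (induction n) (use D in auto)
  have int: "of_int k \<in> K" for k
    by (cases k rule: int_cases2) (use nat D(3) in auto)
  show ?thesis by (cases q) (simp add: of_rat_rat D int)
qed

text \<open>Only the values on \<open>K\<close> matter; outside \<open>K\<close> the function is arbitrary. This makes it possible to extend an
  embedding without changing its type.\<close>
definition subfield_embedding :: "complex set \<Rightarrow> (complex \<Rightarrow> complex) \<Rightarrow> bool" where
  "subfield_embedding K \<sigma> \<longleftrightarrow> complex_subfield K \<and> \<sigma> 1 = 1
     \<and> (\<forall>x\<in>K. \<forall>y\<in>K. \<sigma> (x + y) = \<sigma> x + \<sigma> y \<and> \<sigma> (x * y) = \<sigma> x * \<sigma> y)"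

lemma subfield_embeddingD:
  assumes "subfield_embedding K \<sigma>"
  shows "complex_subfield K" "\<sigma> 1 = 1" "\<sigma> 0 = 0"
    "x \<in> K \<Longrightarrow> y \<in> K \<Longrightarrow> \<sigma> (x + y) = \<sigma> x + \<sigma> y" "x \<in> K \<Longrightarrow> y \<in> K \<Longrightarrow> \<sigma> (x * y) = \<sigma> x * \<sigma> y"
    "x \<in> K \<Longrightarrow> \<sigma> (- x) = - \<sigma> x" "x \<in> K \<Longrightarrow> y \<in> K \<Longrightarrow> \<sigma> (x - y) = \<sigma> x - \<sigma> y"
    "x \<in> K \<Longrightarrow> \<sigma> x = 0 \<longleftrightarrow> x = 0" "x \<in> K \<Longrightarrow> \<sigma> (inverse x) = inverse (\<sigma> x)"
    "x \<in> K \<Longrightarrow> y \<in> K \<Longrightarrow> \<sigma> (x / y) = \<sigma> x / \<sigma> y" "x \<in> K \<Longrightarrow> \<sigma> (x ^ n) = \<sigma> x ^ n"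
    "inj_on \<sigma> K"
proof -
  show K: "complex_subfield K" and 1: "\<sigma> 1 = 1"
    and add: "x \<in> K \<Longrightarrow> y \<in> K \<Longrightarrow> \<sigma> (x + y) = \<sigma> x + \<sigma> y"
    and mult: "x \<in> K \<Longrightarrow> y \<in> K \<Longrightarrow> \<sigma> (x * y) = \<sigma> x * \<sigma> y" for x y
    using assms by (auto simp: subfield_embedding_def)
  note D = complex_subfieldD[OF K]
  show 0: "\<sigma> 0 = 0" using add[OF D(2,2)] by simp
  show neg: "\<sigma> (- x) = - \<sigma> x" if "x \<in> K" for x
    using add[OF that D(3)[OF that]] 0 by (simp add: add_eq_0_iff)
  show diff: "\<sigma> (x - y) = \<sigma> x - \<sigma> y" if "x \<in> K" "y \<in> K" for x y
    using add[of x "- y"] neg[of y] D(3) that by simp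
  show nz: "\<sigma> x = 0 \<longleftrightarrow> x = 0" if "x \<in> K" for x
    using mult[OF that D(4)[OF that]] 0 1 by (cases "x = 0") auto
  show inv: "\<sigma> (inverse x) = inverse (\<sigma> x)" if "x \<in> K" for x
  proof (cases "x = 0")
    case False then show ?thesis
      using mult[OF that D(4)[OF that]] 1 nz[OF that] by (simp add: field_simps)
  qed (use 0 in simp)
  show "\<sigma> (x / y) = \<sigma> x / \<sigma> y" if "x \<in> K" "y \<in> K"
    using mult[of x "inverse y"] inv[of y] D(4) that by (simp add: divide_inverse)
  show "\<sigma> (x ^ n) = \<sigma> x ^ n" if "x \<in> K" by (induction n) (use that 1 mult D(9) in auto)
  show "inj_on \<sigma> K"
  proof (rule inj_onI)
    fix x y assume "x \<in> K" "y \<in> K" "\<sigma> x = \<sigma> y"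
    then show "x = y" using diff[of x y] nz[of "x - y"] D(7)[of x y] by simp
  qed
qed

lemma subfield_embedding_of_rat:
  assumes "subfield_embedding K \<sigma>" shows "\<sigma> (of_rat q) = of_rat q"
proof -
  note D = subfield_embeddingD[OF assms] and K = complex_subfieldD[OF subfield_embeddingD(1)[OF assms]]
  have nat: "of_nat n \<in> K \<and> \<sigma> (of_nat n) = of_nat n" for n
    by (induction n) (use D K in auto)
  have int: "of_int k \<in> K \<and> \<sigma> (of_int k) = of_int k" for k
    by (cases k rule: int_cases2) (use nat K(3) D(6) in auto)
  show ?thesis by (cases q) (simp add: of_rat_rat D int)
qed

lemma subfield_embedding_poly:
  assumes "subfield_embedding K \<sigma>" "x \<in> K"
  shows "poly (map_poly of_rat f) x \<in> K \<and> \<sigma> (poly (map_poly of_rat f) x) = poly (map_poly of_rat f) (\<sigma> x)"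
proof (induction f)
  case (pCons a f)
  note D = subfield_embeddingD[OF assms(1)] and K = complex_subfieldD[OF subfield_embeddingD(1)[OF assms(1)]]
  have "of_rat a \<in> K" "\<sigma> (of_rat a) = of_rat a"
    using of_rat_in_complex_subfield[OF D(1)] subfield_embedding_of_rat[OF assms(1)] by auto
  then show ?case using pCons assms(2) K by (simp add: map_poly_pCons D)
qed (use subfield_embeddingD(3)[OF assms(1)] complex_subfieldD(2)[OF subfield_embeddingD(1)[OF assms(1)]] in simp)

lemma quadratic_subfield:
  assumes K: "complex_subfield K" and s: "s\<^sup>2 \<in> K"
  shows "complex_subfield {x + y * s | x y. x \<in> K \<and> y \<in> K}" (is "complex_subfield ?L")
  unfolding complex_subfield_def
proof (intro conjI ballI)
  note K = complex_subfieldD[OF K]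
  have K_in: "x \<in> ?L" if "x \<in> K" for x using that K(2) by force
  have s2: "s * s \<in> K" using s by (simp add: power2_eq_square)
  show "1 \<in> ?L" using K_in K(1) by blast
  {
    fix u u' assume "u \<in> ?L" "u' \<in> ?L"
    then obtain x y x' y' where u: "u = x + y * s" "u' = x' + y' * s"
      and k: "x \<in> K" "y \<in> K" "x' \<in> K" "y' \<in> K" by blast
    have "u + u' = (x + x') + (y + y') * s" by (simp add: u algebra_simps)
    then show "u + u' \<in> ?L" using K(5) k by blast
    have "u * u' = (x * x' + y * y' * (s * s)) + (x * y' + y * x') * s"
      by (simp add: u algebra_simps)
    moreover have "x * x' + y * y' * (s * s) \<in> K" "x * y' + y * x' \<in> K" using k s2 K(5,6) by auto
    ultimately show "u * u' \<in> ?L" by blast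
  }
  fix u assume "u \<in> ?L"
  then obtain x y where u: "u = x + y * s" and k: "x \<in> K" "y \<in> K" by blast
  have "- u = - x + (- y) * s" by (simp add: u)
  then show "- u \<in> ?L" using K(3) k by blast
  define N where "N = x * x - y * y * (s * s)"
  have N: "N = u * (x - y * s)" by (simp add: N_def u algebra_simps)
  show "inverse u \<in> ?L"
  proof (cases "x - y * s = 0")
    case True
    then have "u = x + x" by (simp add: u)
    then show ?thesis using K_in K(4,5) k by blast
  next
    case nz: False
    show ?thesis
    proof (cases "u = 0")
      case True
      show ?thesis unfolding True inverse_zero by (rule K_in[OF K(2)])
    next
      case False
      then have "inverse u = (x - y * s) / N" using nz by (simp add: N inverse_eq_divide)
      then have "inverse u = x / N + (- y / N) * s" by (simp add: diff_divide_distrib)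
      moreover have "N \<in> K" unfolding N_def using K(6,7) k s2 by auto
      ultimately show ?thesis using K(3,8) k by blast
    qed
  qed
qed

text \<open>If \<open>s\<close> is not in \<open>K\<close>, elements of \<open>K(s)\<close> are uniquely of the form \<open>x + y s\<close>, and the image of \<open>s\<close> can be
  either square root of \<open>\<sigma>(s\<^sup>2)\<close>.\<close>
lemma quadratic_extension:
  assumes emb: "subfield_embedding K \<sigma>" and s: "s\<^sup>2 \<in> K" "s \<notin> K" and w: "w\<^sup>2 = \<sigma> (s\<^sup>2)"
  obtains L \<tau> where "subfield_embedding L \<tau>" "K \<subseteq> L" "s \<in> L" "\<tau> s = w" "\<And>x. x \<in> K \<Longrightarrow> \<tau> x = \<sigma> x"
proof -
  note D = subfield_embeddingD[OF emb] and K = complex_subfieldD[OF subfield_embeddingD(1)[OF emb]]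
  define L where "L = {x + y * s | x y. x \<in> K \<and> y \<in> K}"
  have unique: "x = x' \<and> y = y'" if "x \<in> K" "y \<in> K" "x' \<in> K" "y' \<in> K" "x + y * s = x' + y' * s" for x y x' y'
  proof -
    have "y = y'"
    proof (rule ccontr)
      assume "y \<noteq> y'"
      then have "s = (x' - x) / (y - y')" using that(5) by (simp add: field_simps)
      then show False using s(2) K(7,8) that by metis
    qed
    then show ?thesis using that(5) by simp
  qed
  define \<tau> where "\<tau> u = (THE c. \<exists>x y. x \<in> K \<and> y \<in> K \<and> u = x + y * s \<and> c = \<sigma> x + \<sigma> y * w)" for u
  have \<tau>: "\<tau> (x + y * s) = \<sigma> x + \<sigma> y * w" if "x \<in> K" "y \<in> K" for x y
    unfolding \<tau>_def
  proof (rule the_equality)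
    fix c assume "\<exists>x' y'. x' \<in> K \<and> y' \<in> K \<and> x + y * s = x' + y' * s \<and> c = \<sigma> x' + \<sigma> y' * w"
    then obtain x' y' where "x' \<in> K" "y' \<in> K" "x + y * s = x' + y' * s" "c = \<sigma> x' + \<sigma> y' * w"
      by blast
    then show "c = \<sigma> x + \<sigma> y * w" using unique[OF that] by metis
  qed (use that in blast)
  have s2: "s * s \<in> K" "\<sigma> (s * s) = w * w" using s w by (simp_all add: power2_eq_square)
  have prod_eq: "(x + y * s) * (x' + y' * s) = (x * x' + y * y' * (s * s)) + (x * y' + y * x') * s" for x y x' y'
    by (simp add: algebra_simps)
  have \<tau>_K: "x \<in> L \<and> \<tau> x = \<sigma> x" if "x \<in> K" for x
    using \<tau>[OF that K(2)] D(3) that K(2) unfolding L_def by force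
  have s_in: "s \<in> L \<and> \<tau> s = w"
    using \<tau>[OF K(2,1)] K(1,2) D(2,3) unfolding L_def by force
  have "complex_subfield L"
    unfolding L_def by (rule quadratic_subfield[OF subfield_embeddingD(1)[OF emb] s(1)])
  moreover have "\<tau> (u + u') = \<tau> u + \<tau> u' \<and> \<tau> (u * u') = \<tau> u * \<tau> u'" if uL: "u \<in> L" "u' \<in> L" for u u'
  proof -
    obtain x y x' y' where u: "u = x + y * s" "u' = x' + y' * s"
      and k: "x \<in> K" "y \<in> K" "x' \<in> K" "y' \<in> K" using uL unfolding L_def by blast
    have "u + u' = (x + x') + (y + y') * s" by (simp add: u algebra_simps)
    then have "\<tau> (u + u') = \<sigma> (x + x') + \<sigma> (y + y') * w" using k K(5) by (simp only: \<tau>)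
    then have 1: "\<tau> (u + u') = \<tau> u + \<tau> u'" using k by (simp add: \<tau> D u(1,2) ring_distribs)
    have "\<tau> (u * u') = \<sigma> (x * x' + y * y' * (s * s)) + \<sigma> (x * y' + y * x') * w"
      unfolding u prod_eq using k s2 K(5,6) by (intro \<tau>) auto
    also have "\<dots> = (\<sigma> x * \<sigma> x' + \<sigma> y * \<sigma> y' * (w * w)) + (\<sigma> x * \<sigma> y' + \<sigma> y * \<sigma> x') * w"
      using k s2 K(5,6) by (simp add: D)
    also have "\<dots> = (\<sigma> x + \<sigma> y * w) * (\<sigma> x' + \<sigma> y' * w)"
      by (simp add: algebra_simps)
    also have "\<dots> = \<tau> u * \<tau> u'" using k by (simp only: u \<tau>)
    finally show ?thesis using 1 by simp
  qed
  ultimately have "subfield_embedding L \<tau>"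
    unfolding subfield_embedding_def using \<tau>_K[OF K(1)] D(2) by auto
  then show thesis using that \<tau>_K s_in by blast
qed

text \<open>For extensions through a tower of square roots the value at the new element does not matter.\<close>
corollary adjoin_sqrt:
  assumes emb: "subfield_embedding K \<sigma>" and s: "s\<^sup>2 \<in> K"
  obtains L \<tau> where "subfield_embedding L \<tau>" "K \<subseteq> L" "s \<in> L" "\<And>x. x \<in> K \<Longrightarrow> \<tau> x = \<sigma> x"
proof (cases "s \<in> K")
  case True then show ?thesis using that[OF emb] by blast
next
  case False
  then show ?thesis
    using quadratic_extension[OF emb s False, of "csqrt (\<sigma> (s\<^sup>2))"] that by (metis power2_csqrt)
qed

lemma splitting_field_subfield: "complex_subfield (splitting_field f)"
  and complex_roots_in_splitting_field: "complex_roots f \<subseteq> splitting_field f"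
  and splitting_field_least: "complex_subfield K \<Longrightarrow> complex_roots f \<subseteq> K \<Longrightarrow> splitting_field f \<subseteq> K"
proof -
  interpret C: field complex_ring by (rule field_from_type_algebra)
  have [simp]: "\<one>\<^bsub>complex_ring\<^esub> = 1" "\<zero>\<^bsub>complex_ring\<^esub> = 0" "carrier complex_ring = UNIV"
    "x \<oplus>\<^bsub>complex_ring\<^esub> y = x + y" "x \<otimes>\<^bsub>complex_ring\<^esub> y = x * y" for x y
    by (simp_all add: ring_of_type_algebra_def)
  have neg: "\<ominus>\<^bsub>complex_ring\<^esub> x = - x" for x by (rule C.minus_equality) auto
  have inv: "inv\<^bsub>complex_ring\<^esub> x = inverse x" if "x \<noteq> 0" for x
    using that by (intro C.comm_inv_char) auto
  let ?S = "generate_field complex_ring (complex_roots f)"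
  have S: "complex_subfield ?S"
    unfolding complex_subfield_def
  proof (intro conjI ballI)
    show "1 \<in> ?S" using generate_field.one[of complex_ring] by simp
  next
    fix x assume x: "x \<in> ?S"
    show "- x \<in> ?S" using generate_field.a_inv[OF x] by (simp add: neg)
    show "inverse x \<in> ?S"
    proof (cases "x = 0")
      case False then show ?thesis using generate_field.m_inv[OF x] by (simp add: inv)
    qed (use x in simp)
  next
    fix x y assume x: "x \<in> ?S" "y \<in> ?S"
    show "x + y \<in> ?S" using generate_field.eng_add[OF x] by simp
    show "x * y \<in> ?S" using generate_field.eng_mult[OF x] by simp
  qed
  then show "complex_subfield (splitting_field f)" by (simp add: splitting_field_def)
  show "complex_roots f \<subseteq> splitting_field f"
    unfolding splitting_field_def by (auto intro: generate_field.incl)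
  assume K: "complex_subfield K" "complex_roots f \<subseteq> K"
  note D = complex_subfieldD[OF K(1)]
  have "x \<in> K" if "x \<in> ?S" for x
    using that by induction (use D K(2) in \<open>auto simp: neg inv\<close>)
  then show "splitting_field f \<subseteq> K" by (auto simp: splitting_field_def)
qed

lemma finite_complex_roots: "f \<noteq> 0 \<Longrightarrow> finite (complex_roots f)"
  unfolding complex_roots_def by (rule poly_roots_finite) (simp add: map_poly_eq_0_iff)

lemma ring_hom_splitting_field_iff:
  "\<sigma> \<in> ring_hom (complex_ring\<lparr>carrier := S\<rparr>) (complex_ring\<lparr>carrier := S\<rparr>) \<longleftrightarrow>
    \<sigma> ` S \<subseteq> S \<and> (\<forall>x\<in>S. \<forall>y\<in>S. \<sigma> (x * y) = \<sigma> x * \<sigma> y \<and> \<sigma> (x + y) = \<sigma> x + \<sigma> y) \<and> \<sigma> 1 = 1"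
  by (auto simp: ring_hom_def ring_of_type_algebra_def)

lemma galois_groupD:
  assumes "\<sigma> \<in> galois_group f"
  shows "subfield_embedding (splitting_field f) \<sigma>" "bij_betw \<sigma> (splitting_field f) (splitting_field f)"
    "\<sigma> \<in> extensional (splitting_field f)"
  using assms splitting_field_subfield[of f]
  by (auto simp: galois_group_def ring_hom_splitting_field_iff Bij_def subfield_embedding_def)

lemma embedding_permutes_roots:
  assumes emb: "subfield_embedding K \<sigma>" and K: "complex_roots f \<subseteq> K" and f: "f \<noteq> 0"
  shows "\<sigma> ` complex_roots f = complex_roots f"
proof (rule endo_inj_surj)
  show "finite (complex_roots f)" using f by (rule finite_complex_roots)
  show "\<sigma> ` complex_roots f \<subseteq> complex_roots f"
  proof safe
    fix x assume x: "x \<in> complex_roots f"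
    then have "\<sigma> (poly (map_poly of_rat f) x) = 0"
      using subfield_embeddingD(3)[OF emb] by (simp add: complex_roots_def)
    then show "\<sigma> x \<in> complex_roots f"
      using subfield_embedding_poly[OF emb, of x f] K x by (auto simp: complex_roots_def)
  qed
  show "inj_on \<sigma> (complex_roots f)"
    using subfield_embeddingD(12)[OF emb] K by (rule inj_on_subset)
qed

text \<open>An embedding maps the finite set of roots injectively into itself, so it permutes the roots and maps the
  field that they generate onto itself.\<close>
lemma restrict_embedding_in_galois_group:
  assumes emb: "subfield_embedding K \<sigma>" and roots: "complex_roots f \<subseteq> K" and f: "f \<noteq> 0"
  shows "restrict \<sigma> (splitting_field f) \<in> galois_group f"
proof -
  let ?S = "splitting_field f"
  note D = subfield_embeddingD[OF emb]
  note K = complex_subfieldD[OF D(1)] and S = complex_subfieldD[OF splitting_field_subfield[of f]]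
  have SK: "?S \<subseteq> K" using splitting_field_least[OF D(1) roots] .
  note perm = embedding_permutes_roots[OF emb roots f]
  have "complex_subfield {x \<in> K. \<sigma> x \<in> ?S}"
    using K S D by (auto simp: complex_subfield_def)
  then have "?S \<subseteq> {x \<in> K. \<sigma> x \<in> ?S}"
    using perm roots complex_roots_in_splitting_field[of f] by (intro splitting_field_least) auto
  moreover have "?S \<subseteq> \<sigma> ` ?S"
  proof (rule splitting_field_least)
    show "complex_subfield (\<sigma> ` ?S)"
      unfolding complex_subfield_def
    proof (intro conjI ballI)
      show "1 \<in> \<sigma> ` ?S" using D(2) S(1) by force
    next
      fix x assume "x \<in> \<sigma> ` ?S"
      then obtain u where u: "u \<in> ?S" "x = \<sigma> u" by auto
      show "- x \<in> \<sigma> ` ?S" by (rule image_eqI[of _ _ "- u"]) (use u SK D S in auto)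
      show "inverse x \<in> \<sigma> ` ?S" by (rule image_eqI[of _ _ "inverse u"]) (use u SK D S in auto)
    next
      fix x y assume "x \<in> \<sigma> ` ?S" "y \<in> \<sigma> ` ?S"
      then obtain u u' where u: "u \<in> ?S" "x = \<sigma> u" "u' \<in> ?S" "y = \<sigma> u'" by auto
      have uK: "u \<in> K" "u' \<in> K" using u SK by auto
      show "x + y \<in> \<sigma> ` ?S" by (rule image_eqI[of _ _ "u + u'"]) (use u uK D S in auto)
      show "x * y \<in> \<sigma> ` ?S" by (rule image_eqI[of _ _ "u * u'"]) (use u uK D S in auto)
    qed
    show "complex_roots f \<subseteq> \<sigma> ` ?S"
      using perm complex_roots_in_splitting_field[of f] by blast
  qed
  ultimately have img: "\<sigma> ` ?S = ?S" by blast
  have inj: "inj_on \<sigma> ?S" using D(12) SK by (rule inj_on_subset)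
  have "restrict \<sigma> ?S \<in> Bij ?S"
    unfolding Bij_def using img inj by (auto simp: bij_betw_def inj_on_def)
  moreover have "restrict \<sigma> ?S (of_rat q) = of_rat q" for q
    using of_rat_in_complex_subfield[OF splitting_field_subfield[of f], of q]
      subfield_embedding_of_rat[OF emb] by simp
  moreover have "\<sigma> x \<in> ?S" if "x \<in> ?S" for x using img that by blast
  ultimately show ?thesis
    unfolding galois_group_def ring_hom_splitting_field_iff
    using S SK by (auto simp: D subset_iff)
qed

text \<open>The elements at which two automorphisms agree form a subfield.\<close>
lemma galois_group_eqI:
  assumes \<sigma>: "\<sigma> \<in> galois_group f" and \<tau>: "\<tau> \<in> galois_group f"
    and eq: "\<And>x. x \<in> complex_roots f \<Longrightarrow> \<sigma> x = \<tau> x"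
  shows "\<sigma> = \<tau>"
proof -
  let ?S = "splitting_field f"
  note S = complex_subfieldD[OF splitting_field_subfield[of f]]
  note D = subfield_embeddingD[OF galois_groupD(1)[OF \<sigma>]] subfield_embeddingD[OF galois_groupD(1)[OF \<tau>]]
  have "complex_subfield {x \<in> ?S. \<sigma> x = \<tau> x}"
    using S by (auto simp: complex_subfield_def D)
  then have "?S \<subseteq> {x \<in> ?S. \<sigma> x = \<tau> x}"
    using eq complex_roots_in_splitting_field[of f] by (intro splitting_field_least) auto
  then show ?thesis
    using galois_groupD(3)[OF \<sigma>] galois_groupD(3)[OF \<tau>] by (intro extensionalityI) auto
qed

lemma galois_group_compose:
  assumes \<sigma>: "\<sigma> \<in> galois_group f" and \<tau>: "\<tau> \<in> galois_group f" and f: "f \<noteq> 0"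
  shows "compose (splitting_field f) \<sigma> \<tau> \<in> galois_group f"
proof -
  have "\<tau> x \<in> splitting_field f" if "x \<in> splitting_field f" for x
    using galois_groupD(2)[OF \<tau>] that by (auto simp: bij_betw_def)
  then have "subfield_embedding (splitting_field f) (\<sigma> \<circ> \<tau>)"
    using galois_groupD(1)[OF \<sigma>] galois_groupD(1)[OF \<tau>] by (auto simp: subfield_embedding_def)
  then show ?thesis
    using restrict_embedding_in_galois_group[OF _ complex_roots_in_splitting_field f, of "\<sigma> \<circ> \<tau>"]
    by (simp add: compose_def comp_def)
qed

lemma galois_group_inverse:
  assumes \<sigma>: "\<sigma> \<in> galois_group f" and f: "f \<noteq> 0"
  obtains \<tau> where "\<tau> \<in> galois_group f" "\<And>x. x \<in> splitting_field f \<Longrightarrow> \<tau> (\<sigma> x) = x"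
proof -
  let ?S = "splitting_field f" and ?\<tau> = "inv_into (splitting_field f) \<sigma>"
  note S = complex_subfieldD[OF splitting_field_subfield[of f]]
  note D = subfield_embeddingD[OF galois_groupD(1)[OF \<sigma>]]
  have img: "\<sigma> ` ?S = ?S" using galois_groupD(2)[OF \<sigma>] by (simp add: bij_betw_def)
  have left: "?\<tau> (\<sigma> x) = x" if "x \<in> ?S" for x using D(12) that by (rule inv_into_f_f)
  have "subfield_embedding ?S ?\<tau>"
    unfolding subfield_embedding_def
  proof (intro conjI ballI splitting_field_subfield)
    show "?\<tau> 1 = 1" using left[OF S(1)] D(2) by simp
  next
    fix x y assume "x \<in> ?S" "y \<in> ?S"
    then have "x \<in> \<sigma> ` ?S" "y \<in> \<sigma> ` ?S" by (simp_all add: img)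
    then obtain u w where u: "u \<in> ?S" "w \<in> ?S" "x = \<sigma> u" "y = \<sigma> w" by (elim imageE)
    show "?\<tau> (x + y) = ?\<tau> x + ?\<tau> y" unfolding u(3,4) using left[OF S(5)[OF u(1,2)]] left[OF u(1)] left[OF u(2)] D(4)[OF u(1,2)] by simp
    show "?\<tau> (x * y) = ?\<tau> x * ?\<tau> y" unfolding u(3,4) using left[OF S(6)[OF u(1,2)]] left[OF u(1)] left[OF u(2)] D(5)[OF u(1,2)] by simp
  qed
  from restrict_embedding_in_galois_group[OF this complex_roots_in_splitting_field f]
  have 1: "restrict ?\<tau> ?S \<in> galois_group f" .
  show thesis by (rule that[OF 1]) (use left img in auto)
qed

locale numbered_roots =
  fixes f :: "rat poly" and r :: "nat \<Rightarrow> complex"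
  assumes f_nonzero: "f \<noteq> 0" and numbering: "bij_betw r {1..degree f} (complex_roots f)"
begin

lemma r_root: "i \<in> {1..degree f} \<Longrightarrow> r i \<in> complex_roots f"
  by (rule bij_betw_apply[OF numbering])

lemma r_inj: "i \<in> {1..degree f} \<Longrightarrow> j \<in> {1..degree f} \<Longrightarrow> r i = r j \<longleftrightarrow> i = j"
  by (rule inj_on_eq_iff[OF bij_betw_imp_inj_on[OF numbering]])

lemma r_in: "i \<in> {1..degree f} \<Longrightarrow> r i \<in> splitting_field f"
  by (rule subsetD[OF complex_roots_in_splitting_field r_root])

lemma induced_permutation:
  assumes \<sigma>: "\<sigma> \<in> galois_group f"
  obtains p where "p \<in> galois_perms f r" "\<And>i. i \<in> {1..degree f} \<Longrightarrow> \<sigma> (r i) = r (p i)"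
proof -
  let ?I = "{1..degree f}"
  define p where "p i = (if i \<in> ?I then inv_into ?I r (\<sigma> (r i)) else i)" for i
  have img: "\<sigma> ` complex_roots f = complex_roots f"
    using embedding_permutes_roots[OF galois_groupD(1)[OF \<sigma>] complex_roots_in_splitting_field f_nonzero] .
  have inj: "inj_on \<sigma> (complex_roots f)"
    using subfield_embeddingD(12)[OF galois_groupD(1)[OF \<sigma>]] complex_roots_in_splitting_field by (rule inj_on_subset)
  have "bij_betw \<sigma> (complex_roots f) (complex_roots f)" using img inj by (simp add: bij_betw_def)
  then have "bij_betw (inv_into ?I r \<circ> (\<sigma> \<circ> r)) ?I ?I"
    by (rule bij_betw_trans[OF bij_betw_trans[OF numbering] bij_betw_inv_into[OF numbering]])
  moreover have "bij_betw p ?I ?I \<longleftrightarrow> bij_betw (inv_into ?I r \<circ> (\<sigma> \<circ> r)) ?I ?I"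
    by (rule bij_betw_cong) (simp add: p_def)
  ultimately have "bij_betw p ?I ?I" by blast
  then have "p permutes ?I" by (rule bij_imp_permutes) (auto simp: p_def)
  moreover have p: "\<sigma> (r i) = r (p i)" if "i \<in> ?I" for i
  proof -
    have "\<sigma> (r i) \<in> \<sigma> ` complex_roots f" using r_root[OF that] by (rule imageI)
    also have "\<dots> = r ` ?I" using img numbering by (simp add: bij_betw_def)
    finally have "r (inv_into ?I r (\<sigma> (r i))) = \<sigma> (r i)" by (rule f_inv_into_f)
    then show ?thesis using that by (simp only: p_def if_True)
  qed
  ultimately have "p \<in> galois_perms f r"
    unfolding galois_perms_def using \<sigma> by (intro CollectI conjI bexI[of _ \<sigma>]) auto
  from this p show thesis by (rule that)
qed

text \<open>The automorphism that induces a permutation is unique because the roots generate the splitting field.\<close>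
definition lift :: "(nat \<Rightarrow> nat) \<Rightarrow> complex \<Rightarrow> complex" where
  "lift p = (THE \<sigma>. \<sigma> \<in> galois_group f \<and> (\<forall>i\<in>{1..degree f}. \<sigma> (r i) = r (p i)))"

lemma lift_eqI:
  assumes "\<sigma> \<in> galois_group f" "\<And>i. i \<in> {1..degree f} \<Longrightarrow> \<sigma> (r i) = r (p i)"
  shows "lift p = \<sigma>"
  unfolding lift_def
proof (rule the_equality)
  fix \<tau> assume \<tau>: "\<tau> \<in> galois_group f \<and> (\<forall>i\<in>{1..degree f}. \<tau> (r i) = r (p i))"
  show "\<tau> = \<sigma>"
  proof (rule galois_group_eqI)
    fix x assume "x \<in> complex_roots f"
    then have "x \<in> r ` {1..degree f}" using numbering by (simp add: bij_betw_def)
    then obtain i where "i \<in> {1..degree f}" "x = r i" by (elim imageE)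
    then show "\<tau> x = \<sigma> x" using \<tau> assms(2) by simp
  qed (use \<tau> assms(1) in auto)
qed (use assms in auto)

lemma lift:
  assumes "p \<in> galois_perms f r"
  shows "lift p \<in> galois_group f" "i \<in> {1..degree f} \<Longrightarrow> lift p (r i) = r (p i)"
proof -
  obtain \<sigma> where \<sigma>: "\<sigma> \<in> galois_group f" "\<And>i. i \<in> {1..degree f} \<Longrightarrow> \<sigma> (r i) = r (p i)"
    using assms by (auto simp: galois_perms_def)
  then have eq: "lift p = \<sigma>" by (rule lift_eqI)
  show "lift p \<in> galois_group f" "i \<in> {1..degree f} \<Longrightarrow> lift p (r i) = r (p i)"
    unfolding eq using \<sigma> by simp_all
qed

lemma lift_inj:
  assumes p: "p \<in> galois_perms f r" and q: "q \<in> galois_perms f r" and eq: "lift p = lift q"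
  shows "p = q"
proof
  fix i show "p i = q i"
  proof (cases "i \<in> {1..degree f}")
    case True
    have pq: "p permutes {1..degree f}" "q permutes {1..degree f}"
      using p q by (auto simp: galois_perms_def)
    have "r (p i) = r (q i)" using lift(2)[OF p True] lift(2)[OF q True] eq by simp
    then show ?thesis
      using r_inj permutes_in_image[OF pq(1)] permutes_in_image[OF pq(2)] True by blast
  next
    case False
    then show ?thesis using p q by (auto simp: galois_perms_def permutes_not_in)
  qed
qed

lemma galois_perms_permutes: "p \<in> galois_perms f r \<Longrightarrow> p permutes {1..degree f}"
  by (simp add: galois_perms_def)

lemma galois_perms_comp:
  assumes p: "p \<in> galois_perms f r" and q: "q \<in> galois_perms f r"
  shows "p \<circ> q \<in> galois_perms f r" "lift (p \<circ> q) = compose (splitting_field f) (lift p) (lift q)"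
proof -
  have q_in: "q i \<in> {1..degree f}" if "i \<in> {1..degree f}" for i
    by (rule permutes_in_image[OF galois_perms_permutes[OF q], THEN iffD2, OF that])
  have c: "compose (splitting_field f) (lift p) (lift q) \<in> galois_group f"
    by (rule galois_group_compose[OF lift(1)[OF p] lift(1)[OF q] f_nonzero])
  have e: "compose (splitting_field f) (lift p) (lift q) (r i) = r ((p \<circ> q) i)"
    if "i \<in> {1..degree f}" for i
    using that q_in[OF that] by (simp add: compose_def r_in lift(2)[OF p] lift(2)[OF q])
  show "lift (p \<circ> q) = compose (splitting_field f) (lift p) (lift q)"
    using c e by (rule lift_eqI)
  show "p \<circ> q \<in> galois_perms f r"
    unfolding galois_perms_def
    using c e permutes_compose[OF galois_perms_permutes[OF q] galois_perms_permutes[OF p]]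
    by (intro CollectI conjI bexI[OF _ c]) auto
qed

lemma galois_perms_subgroup: "subgroup (galois_perms f r) (sym_group (degree f))"
proof (rule group.subgroupI[OF sym_group_is_group])
  show "galois_perms f r \<subseteq> carrier (sym_group (degree f))"
    by (intro subsetI) (simp only: sym_group_carrier galois_perms_permutes)
  have "restrict id (splitting_field f) \<in> galois_group f"
    by (rule restrict_embedding_in_galois_group[OF _ complex_roots_in_splitting_field f_nonzero])
      (simp add: subfield_embedding_def splitting_field_subfield)
  then obtain p where "p \<in> galois_perms f r" by (rule induced_permutation) blast
  then show "galois_perms f r \<noteq> {}" by auto
next
  fix p assume p: "p \<in> galois_perms f r"
  obtain \<tau> where \<tau>: "\<tau> \<in> galois_group f" "\<And>x. x \<in> splitting_field f \<Longrightarrow> \<tau> (lift p x) = x"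
    by (rule galois_group_inverse[OF lift(1)[OF p] f_nonzero]) blast
  have perm: "p permutes {1..degree f}" using p by (rule galois_perms_permutes)
  have "\<tau> (r i) = r (inv' p i)" if "i \<in> {1..degree f}" for i
  proof -
    have j: "inv' p i \<in> {1..degree f}"
      by (rule permutes_in_image[OF permutes_inv[OF perm], THEN iffD2, OF that])
    then have "r i = lift p (r (inv' p i))"
      using lift(2)[OF p j] permutes_inverses(1)[OF perm] by simp
    then show ?thesis using \<tau>(2)[OF r_in[OF j]] by simp
  qed
  then have "inv' p \<in> galois_perms f r"
    unfolding galois_perms_def using permutes_inv[OF perm]
    by (intro CollectI conjI bexI[OF _ \<tau>(1)]) auto
  then show "inv\<^bsub>sym_group (degree f)\<^esub> p \<in> galois_perms f r"
    using perm by (simp add: sym_group_carrier)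
next
  fix p q assume "p \<in> galois_perms f r" "q \<in> galois_perms f r"
  then show "p \<otimes>\<^bsub>sym_group (degree f)\<^esub> q \<in> galois_perms f r"
    by (simp add: sym_group_mult galois_perms_comp)
qed

end

section \<open>Irreducibility of the octic polynomials\<close>

text \<open>By coprimality of numerator and denominator, a rational square root of an integer is an integer.\<close>
lemma not_square_between:
  assumes "int k ^ 2 < n" "n < (int k + 1) ^ 2"
  shows "(q::rat)\<^sup>2 \<noteq> of_int n"
proof
  assume eq: "q\<^sup>2 = of_int n"
  obtain a b where ab: "quotient_of q = (a, b)" by force
  then have q: "q = of_int a / of_int b" and b: "b > 0" and cop: "coprime a b"
    by (simp_all add: quotient_of_div quotient_of_denom_pos quotient_of_coprime)
  have "of_int (a\<^sup>2) = (of_int (n * b\<^sup>2) :: rat)"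
    using eq b by (simp add: q power_divide field_simps)
  then have ab2: "a\<^sup>2 = n * b\<^sup>2" by (simp only: of_int_eq_iff)
  then have "b dvd a\<^sup>2" by (simp add: power2_eq_square)
  moreover have "coprime b (a\<^sup>2)" using cop by (simp add: coprime_commute)
  ultimately have "is_unit b" by (meson coprime_absorb_left)
  then have "b = 1" using b by simp
  then have "a\<^sup>2 = n" using ab2 by simp
  then have "int k ^ 2 < \<bar>a\<bar> ^ 2" "\<bar>a\<bar> ^ 2 < (int k + 1) ^ 2" using assms by simp_all
  then have "int k < \<bar>a\<bar>" "\<bar>a\<bar> < int k + 1"
    using power_less_imp_less_base[of "int k" 2 "\<bar>a\<bar>"] power_less_imp_less_base[of "\<bar>a\<bar>" 2 "int k + 1"]
    by simp_all
  then show False by simp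
qed

lemma not_square_negative: "n < 0 \<Longrightarrow> (q::rat)\<^sup>2 \<noteq> n"
  by (metis not_less zero_le_power2)

definition cpoly :: "rat poly \<Rightarrow> complex \<Rightarrow> complex" where
  "cpoly g = poly (map_poly of_rat g)"

lemma cpoly_simps [simp]: "cpoly 0 z = 0" "cpoly (pCons k g) z = of_rat k + z * cpoly g z"
    "cpoly 1 z = 1"
  by (simp_all add: cpoly_def map_poly_pCons)

lemma cpoly_add: "cpoly (g + h) z = cpoly g z + cpoly h z"
proof (induction g arbitrary: h)
  case (pCons k g)
  then show ?case by (cases h) (simp add: of_rat_add algebra_simps)
qed simp

lemma cpoly_smult: "cpoly (Polynomial.smult k g) z = of_rat k * cpoly g z"
  by (induction g) (simp_all add: of_rat_mult algebra_simps)

lemma cpoly_mult: "cpoly (g * h) z = cpoly g z * cpoly h z"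
  by (induction g) (simp_all add: cpoly_add cpoly_smult algebra_simps)

lemma cpoly_monom: "cpoly (Polynomial.monom k n) z = of_rat k * z ^ n"
  by (simp add: cpoly_def map_poly_monom poly_monom)

lemma cpoly_octic: "cpoly (octic_poly a b) z = z ^ 8 + of_rat a * z ^ 4 + of_rat b"
  by (simp add: octic_poly_def cpoly_add cpoly_monom)

lemma complex_roots_iff: "z \<in> complex_roots g \<longleftrightarrow> cpoly g z = 0"
  by (simp add: complex_roots_def cpoly_def)

lemma degree_octic: "degree (octic_poly a b) = 8"
proof -
  have "degree (Polynomial.monom a 4 + [:b:]) \<le> 4"
    by (intro degree_add_le degree_monom_le) simp
  then show ?thesis
    unfolding octic_poly_def add.assoc by (subst degree_add_eq_left) (simp_all add: degree_monom_eq)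
qed

lemma octic_nonzero: "octic_poly a b \<noteq> 0"
  using degree_octic[of a b] by auto

lemma octic_root:
  obtains \<alpha> where "cpoly (octic_poly a b) \<alpha> = 0"
proof -
  let ?q = "of_rat :: rat \<Rightarrow> complex"
  have "degree (map_poly ?q (octic_poly a b)) = 8" by (simp add: degree_map_poly degree_octic)
  then have "\<not> constant (poly (map_poly ?q (octic_poly a b)))" by (simp add: constant_degree)
  then show ?thesis using fundamental_theorem_of_algebra that unfolding cpoly_def by blast
qed

text \<open>Otherwise a Bezout identity \<open>u f + w g = 1\<close> could be evaluated at the common root.\<close>
lemma irreducible_dvd_of_common_root:
  assumes "Factorial_Ring.irreducible f" "cpoly f z = 0" "cpoly g z = 0"
  shows "f dvd g"
proof (rule ccontr)
  assume "\<not> f dvd g"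
  then have "coprime f g" using assms(1) by (simp add: irreducible_imp_prime_elem_gcd prime_elem_imp_coprime)
  then obtain u w where "u * f + w * g = 1"
    using bezout_coefficients_fst_snd[of f g] by (metis coprime_imp_gcd_eq_1)
  then have "cpoly (u * f + w * g) z = 1" by simp
  then show False using assms(2,3) by (simp add: cpoly_add cpoly_mult)
qed

lemma sqrt_independent:
  assumes K: "complex_subfield K" and s: "s \<notin> K" and x: "x \<in> K" "y \<in> K" and eq: "x + y * s = 0"
  shows "x = 0" "y = 0"
proof -
  note K = complex_subfieldD[OF K]
  show "y = 0"
  proof (rule ccontr)
    assume "y \<noteq> 0"
    then have "s = - x / y" using eq by (simp add: field_simps add_eq_0_iff)
    then show False using s K(8)[OF K(3)[OF x(1)] x(2)] by simp
  qed
  then show "x = 0" using eq by simp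
qed

lemma rationals_subfield: "complex_subfield (range of_rat)"
  unfolding complex_subfield_def
proof (intro conjI ballI)
  show "1 \<in> range of_rat" by (rule range_eqI[of _ _ 1]) simp
qed (auto simp flip: of_rat_add of_rat_mult of_rat_minus of_rat_inverse)

lemma inverse_square_eq: "d * y\<^sup>2 = 1 \<Longrightarrow> (1 / y)\<^sup>2 = (d::rat)"
  by (cases "y = 0") (auto simp: power_divide divide_eq_eq)

lemmas of_rat_simps = of_rat_add of_rat_diff of_rat_minus of_rat_mult of_rat_divide of_rat_power
  algebra_simps

text \<open>In the tower \<open>\<rat> \<subseteq> \<rat>(\<alpha>\<^sup>4) \<subseteq> \<rat>(\<alpha>\<^sup>2) \<subseteq> \<rat>(\<alpha>)\<close> of quadratic extensions every step is proper: the third assumption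
  takes care of the first step, the first two of the second. For the last step, \<open>\<alpha>\<^sup>2\<close> must not be a square in
  \<open>\<rat>(\<alpha>\<^sup>2)\<close>, and the fourth assumption is this condition written in the basis \<open>1, \<alpha>\<^sup>4\<close>. Hence \<open>\<alpha>\<close> has degree
  eight and no polynomial of smaller degree vanishes at it.\<close>
lemma octic_irreducible:
  fixes a c :: rat
  assumes 1: "\<And>k. k\<^sup>2 \<noteq> 2 * c - a" and 2: "\<And>k. k\<^sup>2 \<noteq> - 2 * c - a" and 3: "\<And>k. k\<^sup>2 \<noteq> a\<^sup>2 - 4 * c\<^sup>2"
    and 4: "\<And>\<eta> s m n. \<eta> = c \<or> \<eta> = - c \<Longrightarrow> s\<^sup>2 = a - 2 * \<eta> \<Longrightarrow> s * (m\<^sup>2 - n\<^sup>2 * c\<^sup>2) = 2 * \<eta>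
      \<Longrightarrow> s * (2 * m * n - a * n\<^sup>2) = 2 \<Longrightarrow> False"
  shows "Factorial_Ring.irreducible (octic_poly a (c\<^sup>2))"
proof -
  let ?f = "octic_poly a (c\<^sup>2)" and ?q = "of_rat :: rat \<Rightarrow> complex"
  have small: "cpoly g \<alpha> \<noteq> 0" if root: "cpoly ?f \<alpha> = 0" and g: "g \<noteq> 0" "degree g < 8" for \<alpha> g
  proof
    assume g0: "cpoly g \<alpha> = 0"
    define A B D where "A = \<alpha>\<^sup>2" and "B = A\<^sup>2" and "D = 2 * B + ?q a"
    define K0 where "K0 = range ?q"
    define K1 where "K1 = {x + y * D | x y. x \<in> K0 \<and> y \<in> K0}"
    define K2 where "K2 = {x + y * A | x y. x \<in> K1 \<and> y \<in> K1}"
    have B2: "B * B = - ?q a * B - ?q (c\<^sup>2)"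
    proof -
      have "B * B + ?q a * B + ?q (c\<^sup>2) = 0"
        using root by (simp add: cpoly_octic A_def B_def power_mult[symmetric] flip: power_add)
      then show ?thesis by (simp add: eq_diff_eq eq_neg_iff_add_eq_0 algebra_simps)
    qed
    \<comment> \<open>\<open>D\<close> is a square root of the discriminant of \<open>y\<^sup>2 + a y + c\<^sup>2\<close>, of which \<open>B\<close> is a root.\<close>
    have D2: "D\<^sup>2 = ?q (a\<^sup>2 - 4 * c\<^sup>2)"
    proof -
      have "D\<^sup>2 = 4 * (B * B) + 4 * ?q a * B + ?q a * ?q a"
        by (simp add: D_def power2_eq_square algebra_simps)
      then show ?thesis
        by (simp add: B2 of_rat_diff of_rat_mult of_rat_power power2_eq_square algebra_simps)
    qed
    have K0: "complex_subfield K0" unfolding K0_def by (rule rationals_subfield)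
    have K1: "complex_subfield K1"
      unfolding K1_def by (rule quadratic_subfield[OF K0]) (simp add: D2 K0_def)
    have B_K1: "B = ?q (- a / 2) + ?q (1 / 2) * D"
      by (simp add: D_def of_rat_minus of_rat_divide algebra_simps)
    then have "B \<in> K1" unfolding K1_def K0_def by blast
    then have K2: "complex_subfield K2"
      unfolding K2_def by (intro quadratic_subfield[OF K1]) (simp add: B_def)
    have rat_K1: "?q k \<in> K1" for k
      using K1 by (rule of_rat_in_complex_subfield)
    have "D \<notin> K0"
    proof
      assume "D \<in> K0"
      then obtain k where "D = ?q k" by (auto simp: K0_def)
      then have "?q (k\<^sup>2) = ?q (a\<^sup>2 - 4 * c\<^sup>2)" using D2 by (simp add: of_rat_power)
      then show False using 3 by (simp only: of_rat_eq_iff)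
    qed
    have indep1: "x = 0 \<and> y = 0" if "?q x + ?q y * B = 0" for x y
    proof -
      have "?q (x - a / 2 * y) + ?q (y / 2) * D = ?q x + ?q y * B"
        by (simp add: D_def of_rat_diff of_rat_mult of_rat_divide algebra_simps)
      then have eq: "?q (x - a / 2 * y) + ?q (y / 2) * D = 0" using that by (simp only:)
      have in0: "?q k \<in> K0" for k unfolding K0_def by (rule rangeI)
      have "x - a / 2 * y = 0" "y / 2 = 0"
        using sqrt_independent[OF K0 \<open>D \<notin> K0\<close> in0 in0 eq] by (simp_all only: of_rat_eq_0_iff)
      then show ?thesis by simp
    qed
    have coord: "\<exists>x y. u = ?q x + ?q y * B" if u: "u \<in> K1" for u
    proof -
      obtain x y where "u = ?q x + ?q y * D" using u unfolding K1_def K0_def by blast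
      then have "u = ?q (x + y * a) + ?q (2 * y) * B"
        by (simp add: D_def of_rat_add of_rat_mult algebra_simps)
      then show ?thesis by blast
    qed
    have sq: "(?q x + ?q y * B)\<^sup>2 = ?q (x\<^sup>2 - y\<^sup>2 * c\<^sup>2) + ?q (2 * x * y - a * y\<^sup>2) * B" for x y
    proof -
      have "(?q x + ?q y * B)\<^sup>2 = ?q x * ?q x + 2 * ?q x * ?q y * B + ?q y * ?q y * (B * B)"
        by (simp add: power2_eq_square algebra_simps)
      then show ?thesis
        by (simp add: B2 of_rat_diff of_rat_mult of_rat_power power2_eq_square algebra_simps)
    qed
    have "A \<notin> K1"
    proof
      assume "A \<in> K1"
      then obtain x y where A: "A = ?q x + ?q y * B" using coord[of A] by blast
      have "?q (x\<^sup>2 - y\<^sup>2 * c\<^sup>2) + ?q (2 * x * y - a * y\<^sup>2 - 1) * B = (?q x + ?q y * B)\<^sup>2 - B"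
        unfolding sq by (simp add: of_rat_simps)
      also have "\<dots> = 0" by (simp only: A[symmetric]) (simp add: B_def)
      finally have "x\<^sup>2 - y\<^sup>2 * c\<^sup>2 = 0" and xy: "2 * x * y - a * y\<^sup>2 - 1 = 0" using indep1 by blast+
      then have "x\<^sup>2 = (y * c)\<^sup>2" by (simp add: power_mult_distrib)
      then have "x = y * c \<or> x = - (y * c)" by (simp add: power2_eq_iff)
      then have "(2 * c - a) * y\<^sup>2 = 1 \<or> (- 2 * c - a) * y\<^sup>2 = 1"
        using xy by (elim disjE) (simp_all add: power2_eq_square algebra_simps)
      then have "(1 / y)\<^sup>2 = 2 * c - a \<or> (1 / y)\<^sup>2 = - 2 * c - a"
        by (elim disjE) (simp_all only: inverse_square_eq simp_thms)
      then show False using 1 2 by blast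
    qed
    have "\<alpha> \<notin> K2"
    proof
      assume "\<alpha> \<in> K2"
      then obtain u w where \<alpha>: "\<alpha> = u + w * A" and uw: "u \<in> K1" "w \<in> K1" unfolding K2_def by blast
      note D1 = complex_subfieldD[OF K1]
      have "(u * u + w * w * B) + (2 * (u * w) - 1) * A = (u + w * A)\<^sup>2 - A"
        by (simp add: B_def power2_eq_square algebra_simps)
      also have "\<dots> = 0" by (simp only: \<alpha>[symmetric]) (simp add: A_def)
      finally have eq: "(u * u + w * w * B) + (2 * (u * w) - 1) * A = 0" .
      have in1: "u * u + w * w * B \<in> K1" "2 * (u * w) - 1 \<in> K1"
        unfolding mult_2 by (intro D1(1,5,6,7) uw \<open>B \<in> K1\<close>)+
      have e1: "u * u + w * w * B = 0" and e2: "2 * (u * w) - 1 = 0"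
        using sqrt_independent[OF K1 \<open>A \<notin> K1\<close> in1 eq] by auto
      have w_nz: "w \<noteq> 0" using e2 by auto
      \<comment> \<open>From \<open>u\<^sup>2 + w\<^sup>2 B = 0\<close> and \<open>2 u w = 1\<close>: the quotient \<open>u / w\<close> is a square root of \<open>- B\<close>, and twice it is \<open>(1 / w)\<^sup>2\<close>.\<close>
      obtain w0 w1 where W: "u / w = ?q w0 + ?q w1 * B" using coord[of "u / w"] uw D1(8) by blast
      obtain m n where V: "1 / w = ?q m + ?q n * B" using coord[of "1 / w"] uw D1(1,8) by blast
      have "?q (w0\<^sup>2 - w1\<^sup>2 * c\<^sup>2) + ?q (2 * w0 * w1 - a * w1\<^sup>2 + 1) * B = (u / w)\<^sup>2 + B"
        unfolding W sq by (simp add: of_rat_simps)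
      also have "\<dots> = (u * u + w * w * B) / (w * w)"
        using w_nz by (simp add: add_divide_distrib power2_eq_square)
      also have "\<dots> = 0" by (simp add: e1)
      finally have w01: "w0\<^sup>2 - w1\<^sup>2 * c\<^sup>2 = 0" "2 * w0 * w1 - a * w1\<^sup>2 + 1 = 0" using indep1 by blast+
      have "?q (m\<^sup>2 - n\<^sup>2 * c\<^sup>2 - 2 * w0) + ?q (2 * m * n - a * n\<^sup>2 - 2 * w1) * B = (1 / w)\<^sup>2 - 2 * (u / w)"
        unfolding W V sq by (simp add: of_rat_simps)
      also have "\<dots> = - (2 * (u * w) - 1) / (w * w)"
        using w_nz by (simp add: diff_divide_distrib power2_eq_square)
      also have "\<dots> = 0" by (simp add: e2)
      finally have mn: "m\<^sup>2 - n\<^sup>2 * c\<^sup>2 - 2 * w0 = 0" "2 * m * n - a * n\<^sup>2 - 2 * w1 = 0" using indep1 by blast+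
      have w1: "w1 \<noteq> 0" using w01(2) by (intro notI) simp
      show False
      proof (rule 4[of "w0 / w1" "1 / w1" m n])
        have "(w0 / w1)\<^sup>2 = c\<^sup>2" using w01(1) w1 by (simp add: power_divide field_simps)
        then show "w0 / w1 = c \<or> w0 / w1 = - c" by (simp only: power2_eq_iff)
        show "(1 / w1)\<^sup>2 = a - 2 * (w0 / w1)"
          by (rule inverse_square_eq) (use w01(2) w1 in \<open>simp add: left_diff_distrib power2_eq_square\<close>)
        show "1 / w1 * (m\<^sup>2 - n\<^sup>2 * c\<^sup>2) = 2 * (w0 / w1)" using mn(1) w1 by (simp add: field_simps)
        show "1 / w1 * (2 * m * n - a * n\<^sup>2) = 2" using mn(2) w1 by (simp add: field_simps)
      qed
    qed
    let ?g = "\<lambda>i. ?q (coeff g i)"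
    have "cpoly g \<alpha> = (\<Sum>i\<le>7. ?g i * \<alpha> ^ i)"
      unfolding cpoly_def poly_altdef using g(2)
      by (intro sum.mono_neutral_cong_left) (auto simp: coeff_map_poly degree_map_poly coeff_eq_0)
    \<comment> \<open>Exponents are written in binary: \<open>\<alpha>\<close>, \<open>A = \<alpha>\<^sup>2\<close> and \<open>B = \<alpha>\<^sup>4\<close>.\<close>
    also have "\<dots> = ((?g 0 + ?g 4 * B) + (?g 2 + ?g 6 * B) * A)
        + ((?g 1 + ?g 5 * B) + (?g 3 + ?g 7 * B) * A) * \<alpha>"
      by (simp add: eval_nat_numeral A_def B_def algebra_simps)
    finally have eq: "((?g 0 + ?g 4 * B) + (?g 2 + ?g 6 * B) * A)
        + ((?g 1 + ?g 5 * B) + (?g 3 + ?g 7 * B) * A) * \<alpha> = 0" using g0 by simp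
    have in1: "?q x + ?q y * B \<in> K1" for x y
      using complex_subfieldD(5,6)[OF K1] rat_K1 \<open>B \<in> K1\<close> by blast
    then have in2: "(?q x + ?q y * B) + (?q x' + ?q y' * B) * A \<in> K2" for x y x' y'
      unfolding K2_def by blast
    note e = sqrt_independent[OF K2 \<open>\<alpha> \<notin> K2\<close> in2 in2 eq]
    note e' = sqrt_independent[OF K1 \<open>A \<notin> K1\<close> in1 in1 e(1)] sqrt_independent[OF K1 \<open>A \<notin> K1\<close> in1 in1 e(2)]
    have z: "coeff g 0 = 0" "coeff g 4 = 0" "coeff g 2 = 0" "coeff g 6 = 0"
      "coeff g 1 = 0" "coeff g 5 = 0" "coeff g 3 = 0" "coeff g 7 = 0"
      using e'[THEN indep1] by auto
    have "coeff g i = 0" for i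
    proof (cases "i < 8")
      case True
      then have "i = 0 \<or> i = 1 \<or> i = 2 \<or> i = 3 \<or> i = 4 \<or> i = 5 \<or> i = 6 \<or> i = 7" by linarith
      then show ?thesis using z by auto
    qed (use g(2) in \<open>simp add: coeff_eq_0\<close>)
    then have "g = 0" by (simp add: poly_eq_iff)
    then show False using g(1) by simp
  qed
  obtain \<alpha> where root: "cpoly ?f \<alpha> = 0" by (rule octic_root)
  show ?thesis
  proof (rule Factorial_Ring.irreducibleI)
    show "?f \<noteq> 0" by (rule octic_nonzero)
    show "\<not> ?f dvd 1" using degree_octic[of a "c\<^sup>2"] by (auto simp: is_unit_iff_degree octic_nonzero)
    fix g h assume gh: "?f = g * h"
    then have nz: "g \<noteq> 0" "h \<noteq> 0" using octic_nonzero[of a "c\<^sup>2"] by auto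
    then have deg: "degree g + degree h = 8" using degree_octic[of a "c\<^sup>2"] by (simp add: gh degree_mult_eq)
    have "cpoly g \<alpha> = 0 \<or> cpoly h \<alpha> = 0" using root by (simp add: gh cpoly_mult)
    then have "\<not> degree g < 8 \<or> \<not> degree h < 8" using small[OF root] nz by blast
    then have "degree g = 0 \<or> degree h = 0" using deg by linarith
    then show "g dvd 1 \<or> h dvd 1" using nz by (simp add: is_unit_iff_degree)
  qed
qed

section \<open>The splitting field of the octic\<close>

text \<open>Conjugate roots satisfy the same rational relations: a polynomial that vanishes at \<open>\<alpha>\<close> is a multiple of
  \<open>f\<close>, so it vanishes at \<open>\<beta>\<close> too.\<close>
lemma simple_extension_embedding:
  assumes irr: "Factorial_Ring.irreducible f" and \<alpha>: "cpoly f \<alpha> = 0" and \<beta>: "cpoly f \<beta> = 0"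
  obtains K \<sigma> where "subfield_embedding K \<sigma>" "\<alpha> \<in> K" "\<sigma> \<alpha> = \<beta>"
proof -
  define K where "K = range (\<lambda>g. cpoly g \<alpha>)"
  define \<sigma> where "\<sigma> x = cpoly (SOME g. cpoly g \<alpha> = x) \<beta>" for x
  have cpoly_minus: "cpoly (- g) z = - cpoly g z" for g z
    using cpoly_smult[of "- 1" g z] by simp
  have transfer: "cpoly g \<beta> = cpoly h \<beta>" if "cpoly g \<alpha> = cpoly h \<alpha>" for g h
  proof -
    have "cpoly (g + - h) \<alpha> = 0" using that by (simp only: cpoly_add cpoly_minus) simp
    then have "f dvd g + - h" by (rule irreducible_dvd_of_common_root[OF irr \<alpha>])
    then obtain k where "g + - h = f * k" by (elim dvdE)
    then have "cpoly (g + - h) \<beta> = 0" by (simp only: cpoly_mult \<beta>) simp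
    then show ?thesis by (simp only: cpoly_add cpoly_minus) simp
  qed
  have \<sigma>: "\<sigma> (cpoly g \<alpha>) = cpoly g \<beta>" for g
    unfolding \<sigma>_def by (rule transfer, rule someI[of _ g]) simp
  have K_in: "cpoly g \<alpha> \<in> K" for g unfolding K_def by (rule rangeI)
  have "complex_subfield K"
    unfolding complex_subfield_def
  proof (intro conjI ballI)
    show "1 \<in> K" using K_in[of 1] by simp
  next
    fix x assume "x \<in> K"
    then obtain g where g: "x = cpoly g \<alpha>" unfolding K_def by blast
    show "- x \<in> K" using K_in[of "- g"] by (simp add: g cpoly_minus)
    show "inverse x \<in> K"
    proof (cases "x = 0")
      case True then show ?thesis using K_in[of 0] by simp
    next
      case False
      then have "\<not> f dvd g" using \<alpha> by (auto simp: g cpoly_mult elim!: dvdE)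
      then have "coprime f g" using irr by (simp add: irreducible_imp_prime_elem_gcd prime_elem_imp_coprime)
      then obtain u w where "u * f + w * g = 1"
        using bezout_coefficients_fst_snd[of f g] by (metis coprime_imp_gcd_eq_1)
      then have "cpoly (u * f + w * g) \<alpha> = 1" by simp
      then have "cpoly w \<alpha> * x = 1" using \<alpha> by (simp add: cpoly_add cpoly_mult g)
      then have "inverse x = cpoly w \<alpha>" by (metis inverse_unique mult.commute)
      then show ?thesis using K_in by simp
    qed
  next
    fix x y assume "x \<in> K" "y \<in> K"
    then obtain g h where gh: "x = cpoly g \<alpha>" "y = cpoly h \<alpha>" unfolding K_def by blast
    show "x + y \<in> K" using K_in[of "g + h"] by (simp add: gh cpoly_add)
    show "x * y \<in> K" using K_in[of "g * h"] by (simp add: gh cpoly_mult)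
  qed
  moreover have "\<sigma> (x + y) = \<sigma> x + \<sigma> y \<and> \<sigma> (x * y) = \<sigma> x * \<sigma> y" if xy: "x \<in> K" "y \<in> K" for x y
  proof -
    obtain g h where gh: "x = cpoly g \<alpha>" "y = cpoly h \<alpha>" using xy unfolding K_def by blast
    show ?thesis
      using \<sigma>[of "g + h"] \<sigma>[of "g * h"] \<sigma>[of g] \<sigma>[of h] by (simp add: gh cpoly_add cpoly_mult)
  qed
  moreover have "\<sigma> 1 = 1" using \<sigma>[of 1] by simp
  ultimately have "subfield_embedding K \<sigma>" unfolding subfield_embedding_def by blast
  moreover have "\<alpha> \<in> K" "\<sigma> \<alpha> = \<beta>" using K_in[of "[:0, 1:]"] \<sigma>[of "[:0, 1:]"] by simp_all
  ultimately show thesis by (rule that)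
qed

lemma complex_neg_eq [simp]: "- x = x \<longleftrightarrow> x = (0::complex)" "x = - x \<longleftrightarrow> x = (0::complex)"
  by (auto simp: eq_neg_iff_add_eq_0 neg_eq_iff_add_eq_0)

lemma fourth_root_of_unity:
  assumes "(x::complex) ^ 4 = 1" shows "x = 1 \<or> x = \<i> \<or> x = - 1 \<or> x = - \<i>"
proof -
  have "(x - 1) * (x + 1) * ((x - \<i>) * (x + \<i>)) = x ^ 4 - 1"
    by (simp add: algebra_simps eval_nat_numeral)
  then have "(x - 1) * (x + 1) * ((x - \<i>) * (x + \<i>)) = 0" using assms by simp
  then show ?thesis by (simp flip: eq_neg_iff_add_eq_0) blast
qed

locale octic =
  fixes a c :: rat and \<alpha> \<gamma> :: complex
  assumes irr: "Factorial_Ring.irreducible (octic_poly a (c\<^sup>2))"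
    and root: "cpoly (octic_poly a (c\<^sup>2)) \<alpha> = 0" and \<gamma>_sq: "\<gamma>\<^sup>2 = of_rat c"
begin

abbreviation f where "f \<equiv> octic_poly a (c\<^sup>2)"
definition A where "A = \<alpha>\<^sup>2"
definition p where "p = A + \<gamma>\<^sup>2 / A"
definition q where "q = A - \<gamma>\<^sup>2 / A"
definition \<beta> where "\<beta> = \<gamma> / \<alpha>"

text \<open>Otherwise \<open>\<alpha>\<close> would be a root of a polynomial of degree four. The cases \<open>k = 0, c, - c\<close> ensure that \<open>A\<close>, \<open>p\<close>
  and \<open>q\<close> do not vanish and that the eight roots are distinct.\<close>
lemma A_sq_irrational: "A\<^sup>2 \<noteq> of_rat k"
proof
  assume eq: "A\<^sup>2 = of_rat k"
  let ?g = "Polynomial.monom 1 4 + [:- k:]"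
  have "cpoly ?g \<alpha> = 0" using eq by (simp add: cpoly_add cpoly_monom A_def of_rat_minus flip: power_mult)
  then have dvd: "f dvd ?g" by (rule irreducible_dvd_of_common_root[OF irr root])
  have "degree ?g = 4" by (subst degree_add_eq_left) (simp_all add: degree_monom_eq)
  then show False using dvd_imp_degree_le[OF dvd] degree_octic[of a "c\<^sup>2"] by force
qed

lemma A_nonzero: "A \<noteq> 0" using A_sq_irrational[of 0] by auto
lemma \<alpha>_nonzero: "\<alpha> \<noteq> 0" using A_nonzero by (auto simp: A_def)

lemma A_quartic: "A ^ 4 + of_rat a * A\<^sup>2 + \<gamma> ^ 4 = 0"
proof -
  have "\<gamma> ^ 4 = (\<gamma>\<^sup>2)\<^sup>2" by (simp flip: power_mult)
  then show ?thesis using root by (simp add: cpoly_octic A_def \<gamma>_sq of_rat_power flip: power_mult)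
qed

lemma \<gamma>_nonzero: "\<gamma> \<noteq> 0"
proof
  assume "\<gamma> = 0"
  then have "A\<^sup>2 * (A\<^sup>2 + of_rat a) = 0"
    using A_quartic by (simp add: algebra_simps flip: power_add)
  then have "A\<^sup>2 = of_rat (- a)" using A_nonzero by (simp add: add_eq_0_iff of_rat_minus)
  then show False using A_sq_irrational by blast
qed

lemma \<beta>_nonzero: "\<beta> \<noteq> 0" using \<alpha>_nonzero \<gamma>_nonzero by (simp add: \<beta>_def)

lemma A_trace: "A\<^sup>2 + (\<gamma>\<^sup>2 / A)\<^sup>2 = - of_rat a"
proof -
  have "A\<^sup>2 * (A\<^sup>2 + (\<gamma>\<^sup>2 / A)\<^sup>2) = A ^ 4 + \<gamma> ^ 4"
    using A_nonzero by (simp add: power_divide distrib_left flip: power_add power_mult)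
  also have "\<dots> = A\<^sup>2 * (- of_rat a)"
    using A_quartic by (simp add: eq_neg_iff_add_eq_0 algebra_simps)
  finally show ?thesis by (metis A_nonzero mult_left_cancel power_not_zero)
qed

lemma p_sq: "p\<^sup>2 = of_rat (2 * c - a)" and q_sq: "q\<^sup>2 = of_rat (- 2 * c - a)"
proof -
  have pq: "p\<^sup>2 = (A\<^sup>2 + (\<gamma>\<^sup>2 / A)\<^sup>2) + 2 * \<gamma>\<^sup>2" "q\<^sup>2 = (A\<^sup>2 + (\<gamma>\<^sup>2 / A)\<^sup>2) - 2 * \<gamma>\<^sup>2"
    using A_nonzero by (simp_all add: p_def q_def power2_sum power2_diff)
  show "p\<^sup>2 = of_rat (2 * c - a)" "q\<^sup>2 = of_rat (- 2 * c - a)"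
    unfolding pq A_trace by (simp_all add: \<gamma>_sq of_rat_diff of_rat_mult of_rat_minus)
qed

lemma p_nonzero: "p \<noteq> 0" and q_nonzero: "q \<noteq> 0"
proof -
  have "A * p = A\<^sup>2 + \<gamma>\<^sup>2" "A * q = A\<^sup>2 - \<gamma>\<^sup>2"
    using A_nonzero by (simp_all add: p_def q_def algebra_simps power2_eq_square)
  moreover have "A\<^sup>2 \<noteq> - \<gamma>\<^sup>2" "A\<^sup>2 \<noteq> \<gamma>\<^sup>2"
    using A_sq_irrational[of "- c"] A_sq_irrational[of c] by (simp_all add: \<gamma>_sq of_rat_minus)
  ultimately show "p \<noteq> 0" "q \<noteq> 0" by (auto simp: add_eq_0_iff)
qed

lemma A_eq: "A = (p + q) / 2" and \<beta>_sq: "\<beta>\<^sup>2 = \<gamma>\<^sup>2 / A"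
  by (simp_all add: p_def q_def \<beta>_def A_def power_divide)

lemma \<beta>_pow_four: "\<beta> ^ 4 * \<alpha> ^ 4 = \<gamma> ^ 4"
  using \<alpha>_nonzero by (simp add: \<beta>_def power_divide)

lemma \<alpha>_\<beta>_pow_four: "\<alpha> ^ 4 \<noteq> \<beta> ^ 4"
proof
  assume eq: "\<alpha> ^ 4 = \<beta> ^ 4"
  have "A ^ 4 = \<gamma> ^ 4" using \<beta>_pow_four by (simp add: A_def eq[symmetric] flip: power_mult power_add)
  then have "(A\<^sup>2)\<^sup>2 = (\<gamma>\<^sup>2)\<^sup>2" by (simp only: power_mult[symmetric]) simp
  then have "A\<^sup>2 = \<gamma>\<^sup>2 \<or> A\<^sup>2 = - \<gamma>\<^sup>2" by (simp only: power2_eq_iff)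
  then show False
    using A_sq_irrational[of "- c"] A_sq_irrational[of c] by (auto simp: \<gamma>_sq of_rat_minus)
qed

text \<open>As a quadratic polynomial in \<open>z\<^sup>4\<close>, the octic has the roots \<open>\<alpha>\<^sup>4\<close> and \<open>\<beta>\<^sup>4\<close>: their sum is
  \<open>- a\<close> and their product \<open>c\<^sup>2\<close>.\<close>
lemma root_iff: "cpoly f z = 0 \<longleftrightarrow> z ^ 4 = \<alpha> ^ 4 \<or> z ^ 4 = \<beta> ^ 4"
proof -
  have sum: "\<alpha> ^ 4 + \<beta> ^ 4 = - of_rat a"
  proof -
    have "\<alpha> ^ 4 = A\<^sup>2" "\<beta> ^ 4 = (\<beta>\<^sup>2)\<^sup>2" by (simp_all add: A_def flip: power_mult)
    then show ?thesis using A_trace by (simp only: \<beta>_sq)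
  qed
  have "(z ^ 4 - \<alpha> ^ 4) * (z ^ 4 - \<beta> ^ 4) = z ^ 8 - (\<alpha> ^ 4 + \<beta> ^ 4) * z ^ 4 + \<beta> ^ 4 * \<alpha> ^ 4"
    by (simp add: algebra_simps flip: power_add)
  also have "\<dots> = cpoly f z"
  proof -
    have "\<gamma> ^ 4 = (\<gamma>\<^sup>2)\<^sup>2" by (simp flip: power_mult)
    then show ?thesis unfolding sum \<beta>_pow_four by (simp add: cpoly_octic \<gamma>_sq of_rat_power)
  qed
  finally show ?thesis by (metis mult_eq_0_iff right_minus_eq)
qed

lemma root_cases:
  assumes "z \<in> complex_roots f"
  obtains u where "u = 1 \<or> u = \<i> \<or> u = - 1 \<or> u = - \<i>" "z = u * \<alpha> \<or> z = u * \<beta>"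
proof -
  have "z ^ 4 = \<alpha> ^ 4 \<or> z ^ 4 = \<beta> ^ 4" using assms by (simp add: complex_roots_iff root_iff)
  then show thesis
  proof
    assume "z ^ 4 = \<alpha> ^ 4"
    then have 1: "(z / \<alpha>) ^ 4 = 1" using \<alpha>_nonzero by (simp add: power_divide)
    have "z = z / \<alpha> * \<alpha>" using \<alpha>_nonzero by simp
    then show thesis by (rule that[OF fourth_root_of_unity[OF 1] disjI1])
  next
    assume "z ^ 4 = \<beta> ^ 4"
    then have 1: "(z / \<beta>) ^ 4 = 1" using \<beta>_nonzero by (simp add: power_divide)
    have "z = z / \<beta> * \<beta>" using \<beta>_nonzero by simp
    then show thesis by (rule that[OF fourth_root_of_unity[OF 1] disjI2])
  qed
qed

lemma unit_root: "u ^ 4 = 1 \<Longrightarrow> u * \<alpha> \<in> complex_roots f \<and> u * \<beta> \<in> complex_roots f"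
  by (simp add: complex_roots_iff root_iff power_mult_distrib)

definition r :: "nat \<Rightarrow> complex" where
  "r n = (if n \<le> 4 then \<i> ^ n * \<alpha> else \<i> ^ n * \<beta>)"

lemma i_pow: "\<i> ^ 2 = - 1" "\<i> ^ 3 = - \<i>" "\<i> ^ 4 = 1" "\<i> ^ 5 = \<i>" "\<i> ^ 6 = - 1" "\<i> ^ 7 = - \<i>" "\<i> ^ 8 = 1"
  by (simp_all add: eval_nat_numeral)

lemma one_to_eight: "{1..8::nat} = {1, 2, 3, 4, 5, 6, 7, 8}"
  by auto

lemma r_bij: "bij_betw r {1..8} (complex_roots f)"
  unfolding bij_betw_def
proof
  have i4: "(\<i> ^ n) ^ 4 = (1::complex)" for n
    by (metis i_pow(3) power_mult power_one mult.commute)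
  have r4: "r n ^ 4 = (if n \<le> 4 then \<alpha> ^ 4 else \<beta> ^ 4)" for n
    by (simp add: r_def power_mult_distrib i4)
  have ne: "\<i> \<noteq> 1" "\<i> \<noteq> - 1" "- \<i> \<noteq> 1" "1 \<noteq> \<i>" "- 1 \<noteq> \<i>" "1 \<noteq> - \<i>" "- \<i> \<noteq> - 1"
    by (auto simp: complex_eq_iff)
  show "inj_on r {1..8}"
  proof (rule inj_onI)
    fix m n :: nat assume mn: "m \<in> {1..8}" "n \<in> {1..8}" and eq: "r m = r n"
    have half: "m \<le> 4 \<longleftrightarrow> n \<le> 4" using arg_cong[OF eq, of "\<lambda>x. x ^ 4"] \<alpha>_\<beta>_pow_four by (auto simp: r4 split: if_splits)
    then have pow: "\<i> ^ m = (\<i> ^ n :: complex)" using eq \<alpha>_nonzero \<beta>_nonzero by (auto simp: r_def split: if_splits)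
    show "m = n"
    proof (cases "m \<le> 4")
      case True
      then have "m \<in> {1, 2, 3, 4}" "n \<in> {1, 2, 3, 4}" using mn half by auto
      then show ?thesis using pow ne by (elim insertE emptyE) (simp_all add: i_pow)
    next
      case False
      then have "m \<in> {5, 6, 7, 8}" "n \<in> {5, 6, 7, 8}" using mn half by auto
      then show ?thesis using pow ne by (elim insertE emptyE) (simp_all add: i_pow)
    qed
  qed
  have "r ` {1..8} = {\<i> * \<alpha>, - \<alpha>, - \<i> * \<alpha>, \<alpha>, \<i> * \<beta>, - \<beta>, - \<i> * \<beta>, \<beta>}"
    unfolding one_to_eight by (simp add: r_def i_pow insert_commute)
  moreover have "complex_roots f \<subseteq> {\<i> * \<alpha>, - \<alpha>, - \<i> * \<alpha>, \<alpha>, \<i> * \<beta>, - \<beta>, - \<i> * \<beta>, \<beta>}"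
  proof
    fix z assume "z \<in> complex_roots f"
    then show "z \<in> {\<i> * \<alpha>, - \<alpha>, - \<i> * \<alpha>, \<alpha>, \<i> * \<beta>, - \<beta>, - \<i> * \<beta>, \<beta>}"
      by (rule root_cases) auto
  qed
  moreover have "r n \<in> complex_roots f" for n
    using unit_root[of "\<i> ^ n"] i4[of n] by (simp add: r_def)
  ultimately show "r ` {1..8} = complex_roots f" by (intro equalityI image_subsetI) (simp_all only:)
qed

sublocale numbered_roots f r
  by unfold_locales (simp_all add: octic_nonzero degree_octic r_bij del: One_nat_def)

abbreviation S where "S \<equiv> splitting_field f"

lemma S_field: "complex_subfield S" by (rule splitting_field_subfield)
lemmas S = complex_subfieldD[OF S_field]

lemma \<alpha>_in: "\<alpha> \<in> S" and \<beta>_in: "\<beta> \<in> S" and i_in: "\<i> \<in> S" and \<gamma>_in: "\<gamma> \<in> S"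
  and A_in: "A \<in> S" and p_in: "p \<in> S" and q_in: "q \<in> S"
proof -
  note sub = subsetD[OF complex_roots_in_splitting_field[of f]]
  show 1: "\<alpha> \<in> S" and 2: "\<beta> \<in> S" using sub unit_root[of 1] by simp_all
  have "\<i> * \<alpha> \<in> S" using sub unit_root[of \<i>] by (simp add: i_pow)
  then have "\<i> * \<alpha> / \<alpha> \<in> S" using S(8) 1 by blast
  then show "\<i> \<in> S" using \<alpha>_nonzero by simp
  have "\<alpha> * \<beta> \<in> S" using S(6) 1 2 by blast
  then show 3: "\<gamma> \<in> S" using \<alpha>_nonzero by (simp add: \<beta>_def)
  show 4: "A \<in> S" unfolding A_def using S(9) 1 .
  show "p \<in> S" "q \<in> S" unfolding p_def q_def by (intro S(5,7,8,9) 3 4)+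
qed

text \<open>The whole splitting field is reached from any subfield by adjoining square roots of elements already present,
  namely \<open>\<i>\<close>, \<open>\<gamma>\<close>, \<open>p\<close>, \<open>q\<close> and finally \<open>\<alpha>\<close>, since \<open>\<alpha>\<^sup>2 = (p + q) / 2\<close>. At each of these steps an embedding
  extends by \<open>adjoin_sqrt\<close>.\<close>
lemma embedding_extends:
  assumes emb: "subfield_embedding K \<sigma>"
  obtains \<tau> where "\<tau> \<in> galois_group f" "\<And>x. x \<in> K \<Longrightarrow> x \<in> S \<Longrightarrow> \<tau> x = \<sigma> x"
proof -
  have rat: "of_rat k \<in> L" if "subfield_embedding L \<tau>" for L \<tau> k
    by (rule of_rat_in_complex_subfield[OF subfield_embeddingD(1)[OF that]])
  have "\<i>\<^sup>2 \<in> K" using rat[OF emb, of "- 1"] by (simp add: of_rat_minus)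
  from adjoin_sqrt[OF emb this] obtain K1 \<sigma>1 where 1: "subfield_embedding K1 \<sigma>1" "K \<subseteq> K1" "\<i> \<in> K1"
    "\<And>x. x \<in> K \<Longrightarrow> \<sigma>1 x = \<sigma> x" by blast
  have "\<gamma>\<^sup>2 \<in> K1" using rat[OF 1(1)] by (simp only: \<gamma>_sq)
  from adjoin_sqrt[OF 1(1) this] obtain K2 \<sigma>2 where 2: "subfield_embedding K2 \<sigma>2" "K1 \<subseteq> K2" "\<gamma> \<in> K2"
    "\<And>x. x \<in> K1 \<Longrightarrow> \<sigma>2 x = \<sigma>1 x" by blast
  have "p\<^sup>2 \<in> K2" using rat[OF 2(1)] by (simp only: p_sq)
  from adjoin_sqrt[OF 2(1) this] obtain K3 \<sigma>3 where 3: "subfield_embedding K3 \<sigma>3" "K2 \<subseteq> K3" "p \<in> K3"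
    "\<And>x. x \<in> K2 \<Longrightarrow> \<sigma>3 x = \<sigma>2 x" by blast
  have "q\<^sup>2 \<in> K3" using rat[OF 3(1)] by (simp only: q_sq)
  from adjoin_sqrt[OF 3(1) this] obtain K4 \<sigma>4 where 4: "subfield_embedding K4 \<sigma>4" "K3 \<subseteq> K4" "q \<in> K4"
    "\<And>x. x \<in> K3 \<Longrightarrow> \<sigma>4 x = \<sigma>3 x" by blast
  note D4 = complex_subfieldD[OF subfield_embeddingD(1)[OF 4(1)]]
  have "p + q \<in> K4" using 3(3) 4(2,3) D4(5) by blast
  moreover have "2 \<in> K4" using D4(5)[OF D4(1,1)] by simp
  ultimately have "\<alpha>\<^sup>2 \<in> K4" using D4(8)[of "p + q" 2] by (simp add: A_eq flip: A_def)
  from adjoin_sqrt[OF 4(1) this] obtain K5 \<sigma>5 where 5: "subfield_embedding K5 \<sigma>5" "K4 \<subseteq> K5" "\<alpha> \<in> K5"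
    "\<And>x. x \<in> K4 \<Longrightarrow> \<sigma>5 x = \<sigma>4 x" by blast
  note D5 = complex_subfieldD[OF subfield_embeddingD(1)[OF 5(1)]]
  have i: "\<i> \<in> K5" and \<gamma>: "\<gamma> \<in> K5" using 1(3) 2(2,3) 3(2) 4(2) 5(2) by blast+
  have \<beta>: "\<beta> \<in> K5" unfolding \<beta>_def using D5(8) \<gamma> 5(3) by blast
  have "complex_roots f \<subseteq> K5"
  proof
    fix z assume "z \<in> complex_roots f"
    then obtain u where u: "u = 1 \<or> u = \<i> \<or> u = - 1 \<or> u = - \<i>" "z = u * \<alpha> \<or> z = u * \<beta>"
      by (rule root_cases)
    have "u \<in> K5" using u(1) D5(1) D5(3)[OF D5(1)] i D5(3)[OF i] by (elim disjE) simp_all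
    then show "z \<in> K5" using u(2) D5(6) 5(3) \<beta> by blast
  qed
  then have "restrict \<sigma>5 S \<in> galois_group f"
    by (rule restrict_embedding_in_galois_group[OF 5(1) _ octic_nonzero])
  moreover have "restrict \<sigma>5 S x = \<sigma> x" if "x \<in> K" "x \<in> S" for x
  proof -
    have "x \<in> K1" "x \<in> K2" "x \<in> K3" "x \<in> K4" using that 1(2) 2(2) 3(2) 4(2) by blast+
    then show ?thesis using that 1(4) 2(4) 3(4) 4(4) 5(4) by simp
  qed
  ultimately show thesis by (rule that)
qed

lemma automorphism_to:
  assumes "z \<in> complex_roots f"
  obtains \<sigma> where "\<sigma> \<in> galois_group f" "\<sigma> \<alpha> = z"
proof -
  obtain K \<sigma> where K: "subfield_embedding K \<sigma>" "\<alpha> \<in> K" "\<sigma> \<alpha> = z"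
    using simple_extension_embedding[OF irr root] assms unfolding complex_roots_iff by blast
  obtain \<tau> where "\<tau> \<in> galois_group f" "\<And>x. x \<in> K \<Longrightarrow> x \<in> S \<Longrightarrow> \<tau> x = \<sigma> x"
    using embedding_extends[OF K(1)] by blast
  then show thesis using that[of \<tau>] K(2,3) \<alpha>_in by simp
qed

section \<open>Signs of automorphisms and Kummer theory\<close>

lemma compose_apply: "\<tau> \<in> galois_group f \<Longrightarrow> x \<in> S \<Longrightarrow> compose S \<sigma> \<tau> x = \<sigma> (\<tau> x)"
  by (simp add: compose_def)

lemma S_image: "\<sigma> \<in> galois_group f \<Longrightarrow> x \<in> S \<Longrightarrow> \<sigma> x \<in> S"
  using galois_groupD(2) by (rule bij_betw_apply)

lemma square_root_sign:
  assumes \<sigma>: "\<sigma> \<in> galois_group f" and x: "x \<in> S" "x\<^sup>2 = of_rat k"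
  shows "\<sigma> x = x \<or> \<sigma> x = - x"
proof -
  note D = subfield_embeddingD[OF galois_groupD(1)[OF \<sigma>]]
  have "(\<sigma> x)\<^sup>2 = x\<^sup>2"
    using D(11)[OF x(1), of 2] subfield_embedding_of_rat[OF galois_groupD(1)[OF \<sigma>]] x(2) by metis
  then show ?thesis by (simp only: power2_eq_iff)
qed

lemma i_sq: "\<i>\<^sup>2 = of_rat (- 1)" by (simp add: of_rat_minus)

lemma galois_eqI:
  assumes \<sigma>: "\<sigma> \<in> galois_group f" and \<tau>: "\<tau> \<in> galois_group f"
    and eq: "\<sigma> \<alpha> = \<tau> \<alpha>" "\<sigma> \<i> = \<tau> \<i>" "\<sigma> \<gamma> = \<tau> \<gamma>"
  shows "\<sigma> = \<tau>"
proof (rule galois_group_eqI[OF \<sigma> \<tau>])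
  fix z assume "z \<in> complex_roots f"
  then obtain u where u: "u = 1 \<or> u = \<i> \<or> u = - 1 \<or> u = - \<i>" "z = u * \<alpha> \<or> z = u * \<beta>"
    by (rule root_cases)
  note D\<sigma> = subfield_embeddingD[OF galois_groupD(1)[OF \<sigma>]] and D\<tau> = subfield_embeddingD[OF galois_groupD(1)[OF \<tau>]]
  have uS: "u \<in> S" using u(1) S(1) S(3)[OF S(1)] i_in S(3)[OF i_in] by (elim disjE) simp_all
  have "\<sigma> u = \<tau> u"
    using u(1) eq(2) D\<sigma>(2) D\<tau>(2) D\<sigma>(6)[OF S(1)] D\<tau>(6)[OF S(1)] D\<sigma>(6)[OF i_in] D\<tau>(6)[OF i_in]
    by (elim disjE) simp_all
  moreover have "\<sigma> \<beta> = \<tau> \<beta>"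
    unfolding \<beta>_def using D\<sigma>(10)[OF \<gamma>_in \<alpha>_in] D\<tau>(10)[OF \<gamma>_in \<alpha>_in] eq by simp
  ultimately show "\<sigma> z = \<tau> z"
    using u(2) D\<sigma>(5)[OF uS \<alpha>_in] D\<tau>(5)[OF uS \<alpha>_in] D\<sigma>(5)[OF uS \<beta>_in] D\<tau>(5)[OF uS \<beta>_in] eq(1)
    by auto
qed

definition moves :: "(complex \<Rightarrow> complex) \<Rightarrow> complex \<Rightarrow> bool" where
  "moves \<sigma> x \<longleftrightarrow> \<sigma> x \<noteq> x"

lemma moves_mult:
  assumes \<sigma>: "\<sigma> \<in> galois_group f" and x: "x \<in> S" "x \<noteq> 0" "\<sigma> x = x \<or> \<sigma> x = - x"
    and y: "y \<in> S" "y \<noteq> 0" "\<sigma> y = y \<or> \<sigma> y = - y"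
  shows "moves \<sigma> (x * y) \<longleftrightarrow> moves \<sigma> x \<noteq> moves \<sigma> y"
    "x * y \<in> S" "x * y \<noteq> 0" "\<sigma> (x * y) = x * y \<or> \<sigma> (x * y) = - (x * y)"
  using x y subfield_embeddingD(5)[OF galois_groupD(1)[OF \<sigma>] x(1) y(1)] S(6)[OF x(1) y(1)]
  by (auto simp: moves_def)

lemma moves_compose:
  assumes \<sigma>: "\<sigma> \<in> galois_group f" and \<tau>: "\<tau> \<in> galois_group f"
    and x: "x \<in> S" "x \<noteq> 0" "x\<^sup>2 = of_rat k"
  shows "moves (compose S \<sigma> \<tau>) x \<longleftrightarrow> moves \<sigma> x \<noteq> moves \<tau> x"
proof -
  have "\<sigma> (- x) = - \<sigma> x" by (rule subfield_embeddingD(6)[OF galois_groupD(1)[OF \<sigma>] x(1)])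
  then show ?thesis
    unfolding moves_def compose_apply[OF \<tau> x(1)]
    using square_root_sign[OF \<sigma> x(1,3)] square_root_sign[OF \<tau> x(1,3)] x(2) by (elim disjE) simp_all
qed

definition signs :: "(complex \<Rightarrow> complex) \<Rightarrow> vec4" where
  "signs \<sigma> = (moves \<sigma> p, moves \<sigma> (\<i> * \<gamma> * q), moves \<sigma> q, moves \<sigma> \<gamma>)"

text \<open>An automorphism with sign vector \<open>v\<close> multiplies \<open>radical l\<close> by the value at \<open>v\<close> of the character of
  \<open>\<bbbF>\<^sub>2\<^sup>4\<close> that belongs to \<open>l\<close>.\<close>
fun radical :: "vec4 \<Rightarrow> complex" where
  "radical (l1, l2, l3, l4) = ((if l1 then p else 1) * (if l2 then \<i> * \<gamma> * q else 1))
     * ((if l3 then q else 1) * (if l4 then \<gamma> else 1))"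

fun radicand :: "vec4 \<Rightarrow> rat" where
  "radicand (l1, l2, l3, l4) = ((if l1 then 2 * c - a else 1) * (if l2 then c * (2 * c + a) else 1))
     * ((if l3 then - 2 * c - a else 1) * (if l4 then c else 1))"

lemma i\<gamma>q_in: "\<i> * \<gamma> * q \<in> S" by (intro S(6) i_in \<gamma>_in q_in)
lemma i\<gamma>q_nonzero: "\<i> * \<gamma> * q \<noteq> 0" using \<gamma>_nonzero q_nonzero by simp

lemma i\<gamma>q_sq: "(\<i> * \<gamma> * q)\<^sup>2 = of_rat (c * (2 * c + a))"
proof -
  have "(\<i> * \<gamma> * q)\<^sup>2 = \<i>\<^sup>2 * \<gamma>\<^sup>2 * q\<^sup>2" by (simp only: power_mult_distrib)
  also have "\<dots> = of_rat ((- 1) * c * (- 2 * c - a))" by (simp only: i_sq \<gamma>_sq q_sq of_rat_mult)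
  also have "(- 1) * c * (- 2 * c - a) = c * (2 * c + a)" by (simp add: algebra_simps)
  finally show ?thesis .
qed

lemmas basis_sq = p_sq i\<gamma>q_sq q_sq \<gamma>_sq

lemma signs_compose:
  assumes "\<sigma> \<in> galois_group f" "\<tau> \<in> galois_group f"
  shows "signs (compose S \<sigma> \<tau>) = vadd (signs \<sigma>) (signs \<tau>)"
  unfolding signs_def moves_compose[OF assms p_in p_nonzero p_sq]
    moves_compose[OF assms i\<gamma>q_in i\<gamma>q_nonzero i\<gamma>q_sq]
    moves_compose[OF assms q_in q_nonzero q_sq] moves_compose[OF assms \<gamma>_in \<gamma>_nonzero \<gamma>_sq]
  by (rule vadd.simps[symmetric])

lemma radical_square: "(radical l)\<^sup>2 = of_rat (radicand l)"
proof -
  obtain l1 l2 l3 l4 where l: "l = (l1, l2, l3, l4)" by (cases l)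
  have sq: "(if b then x else 1)\<^sup>2 = of_rat (if b then k else 1)" if "x\<^sup>2 = of_rat k" for b x k
    using that by simp
  show ?thesis
    unfolding l radical.simps radicand.simps power_mult_distrib[of "_ * _" "_ * _"]
      power_mult_distrib[of "if _ then _ else _" "if _ then _ else _"] basis_sq[THEN sq]
    by (simp only: of_rat_mult[of "_ * _" "_ * _"] of_rat_mult[of "if _ then _ else _" "if _ then _ else _"])
qed

lemma radical_moves:
  assumes \<sigma>: "\<sigma> \<in> galois_group f"
  shows "moves \<sigma> (radical l) \<longleftrightarrow> dot l (signs \<sigma>)" "radical l \<in> S" "radical l \<noteq> 0"
proof -
  obtain l1 l2 l3 l4 where l: "l = (l1, l2, l3, l4)" by (cases l)
  note D = subfield_embeddingD[OF galois_groupD(1)[OF \<sigma>]]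
  have *: "(if b then x else 1) \<in> S" "(if b then x else 1) \<noteq> 0"
    "\<sigma> (if b then x else 1) = (if b then x else 1) \<or> \<sigma> (if b then x else 1) = - (if b then x else 1)"
    "moves \<sigma> (if b then x else 1) \<longleftrightarrow> b \<and> moves \<sigma> x"
    if "x \<in> S" "x \<noteq> 0" "x\<^sup>2 = of_rat k" for b x k
    using that square_root_sign[OF \<sigma> that(1,3)] S(1) D(2) by (auto simp: moves_def)
  note e1 = *[OF p_in p_nonzero p_sq] and e2 = *[OF i\<gamma>q_in i\<gamma>q_nonzero i\<gamma>q_sq]
    and e3 = *[OF q_in q_nonzero q_sq] and e4 = *[OF \<gamma>_in \<gamma>_nonzero \<gamma>_sq]
  note f1 = moves_mult[OF \<sigma> e1(1-3) e2(1-3)] and f2 = moves_mult[OF \<sigma> e3(1-3) e4(1-3)]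
  note g = moves_mult[OF \<sigma> f1(2-4) f2(2-4)]
  show "moves \<sigma> (radical l) \<longleftrightarrow> dot l (signs \<sigma>)"
    unfolding l radical.simps g(1) f1(1) f2(1) e1(4) e2(4) e3(4) e4(4) by (simp add: signs_def)
  show "radical l \<in> S" "radical l \<noteq> 0" unfolding l radical.simps by (rule g(2), rule g(3))
qed

text \<open>If the radical is irrational, the embedding of \<open>\<rat>(radical l)\<close> that negates it extends to an automorphism of
  the splitting field.\<close>
lemma kummer_criterion:
  "(\<exists>k. k\<^sup>2 = radicand l) \<longleftrightarrow> (\<forall>\<sigma>\<in>galois_group f. \<not> dot l (signs \<sigma>))"
proof
  assume "\<exists>k. k\<^sup>2 = radicand l"
  then obtain k where "(radical l)\<^sup>2 = (of_rat k)\<^sup>2" by (metis radical_square of_rat_power)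
  then have "radical l = of_rat k \<or> radical l = of_rat (- k)" by (simp only: power2_eq_iff of_rat_minus)
  then obtain k' where k': "radical l = of_rat k'" by blast
  show "\<forall>\<sigma>\<in>galois_group f. \<not> dot l (signs \<sigma>)"
  proof
    fix \<sigma> assume \<sigma>: "\<sigma> \<in> galois_group f"
    have "\<not> moves \<sigma> (radical l)"
      unfolding k' moves_def using subfield_embedding_of_rat[OF galois_groupD(1)[OF \<sigma>]] by simp
    then show "\<not> dot l (signs \<sigma>)" using radical_moves(1)[OF \<sigma>, of l] by blast
  qed
next
  assume fixed: "\<forall>\<sigma>\<in>galois_group f. \<not> dot l (signs \<sigma>)"
  let ?x = "radical l" and ?Q = "range of_rat :: complex set"
  have id: "subfield_embedding ?Q id" by (simp add: subfield_embedding_def rationals_subfield)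
  have x2: "?x\<^sup>2 \<in> ?Q" by (simp add: radical_square)
  have "?x \<in> ?Q"
  proof (rule ccontr)
    assume "?x \<notin> ?Q"
    then obtain L \<sigma> where L: "subfield_embedding L \<sigma>" "?x \<in> L" "\<sigma> ?x = - ?x"
      using quadratic_extension[OF id x2, of "- ?x"] by (metis id_apply power2_minus)
    obtain \<tau> where \<tau>: "\<tau> \<in> galois_group f" "\<And>x. x \<in> L \<Longrightarrow> x \<in> S \<Longrightarrow> \<tau> x = \<sigma> x"
      using embedding_extends[OF L(1)] by blast
    note k = radical_moves[OF \<tau>(1), of l]
    have "\<tau> ?x = - ?x" using \<tau>(2)[OF L(2) k(2)] L(3) by simp
    then have "moves \<tau> ?x" using k(3) by (simp add: moves_def)
    then show False using fixed \<tau>(1) k(1) by blast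
  qed
  then obtain k where "?x = of_rat k" by blast
  then have "of_rat (k\<^sup>2) = (of_rat (radicand l) :: complex)"
    using radical_square[of l] by (simp only: of_rat_power)
  then show "\<exists>k. k\<^sup>2 = radicand l" by (auto simp only: of_rat_eq_iff)
qed

lemma signs_of_action:
  assumes \<sigma>: "\<sigma> \<in> galois_group f" and "\<sigma> p = s * p" "\<sigma> q = t * q" "\<sigma> \<i> = \<epsilon> * \<i>" "\<sigma> \<gamma> = \<delta> * \<gamma>"
  shows "signs \<sigma> = (s \<noteq> 1, \<epsilon> * \<delta> * t \<noteq> 1, t \<noteq> 1, \<delta> \<noteq> 1)"
proof -
  note D = subfield_embeddingD[OF galois_groupD(1)[OF \<sigma>]]
  have "\<sigma> (\<i> * \<gamma> * q) = (\<epsilon> * \<delta> * t) * (\<i> * \<gamma> * q)"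
    using D(5)[OF S(6)[OF i_in \<gamma>_in] q_in] D(5)[OF i_in \<gamma>_in] assms by (simp add: algebra_simps)
  then have "moves \<sigma> (\<i> * \<gamma> * q) \<longleftrightarrow> \<epsilon> * \<delta> * t \<noteq> 1" using i\<gamma>q_nonzero by (simp add: moves_def)
  then show ?thesis using assms p_nonzero q_nonzero \<gamma>_nonzero by (simp add: signs_def moves_def)
qed

lemma image_of_A:
  assumes \<sigma>: "\<sigma> \<in> galois_group f"
  shows "\<sigma> A = (\<sigma> \<alpha>)\<^sup>2" "\<sigma> p = \<sigma> A + \<gamma>\<^sup>2 / \<sigma> A" "\<sigma> q = \<sigma> A - \<gamma>\<^sup>2 / \<sigma> A"
proof -
  note D = subfield_embeddingD[OF galois_groupD(1)[OF \<sigma>]]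
  show "\<sigma> A = (\<sigma> \<alpha>)\<^sup>2" unfolding A_def by (rule D(11)[OF \<alpha>_in])
  have "\<sigma> (\<gamma>\<^sup>2) = \<gamma>\<^sup>2" using subfield_embedding_of_rat[OF galois_groupD(1)[OF \<sigma>]] by (simp add: \<gamma>_sq)
  then have \<sigma>\<gamma>A: "\<sigma> (\<gamma>\<^sup>2 / A) = \<gamma>\<^sup>2 / \<sigma> A" using D(10)[OF S(9)[OF \<gamma>_in] A_in, of 2] by simp
  have \<gamma>A: "\<gamma>\<^sup>2 / A \<in> S" by (intro S(8,9) \<gamma>_in A_in)
  show "\<sigma> p = \<sigma> A + \<gamma>\<^sup>2 / \<sigma> A" "\<sigma> q = \<sigma> A - \<gamma>\<^sup>2 / \<sigma> A"
    unfolding p_def q_def D(4)[OF A_in \<gamma>A] D(7)[OF A_in \<gamma>A] \<sigma>\<gamma>A by simp_all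
qed

text \<open>This is the computation for which the coordinates were chosen. Write \<open>\<sigma> \<alpha> = u \<alpha>\<close> or \<open>\<sigma> \<alpha> = u \<beta>\<close> with
  \<open>u\<^sup>4 = 1\<close>, and let \<open>\<epsilon>\<close>, \<open>\<delta>\<close> be the signs of \<open>\<sigma>\<close> at \<open>\<i>\<close>, \<open>\<gamma>\<close>. In the first case \<open>p\<close> and \<open>q\<close> are multiplied by
  \<open>u\<^sup>2\<close>, in the second case by \<open>u\<^sup>2\<close> and \<open>- u\<^sup>2\<close>; in both cases \<open>\<sigma>(\<sigma> \<alpha>) / \<alpha>\<close> is the sign
  that the quadratic form predicts.\<close>
lemma square_action:
  assumes \<sigma>: "\<sigma> \<in> galois_group f"
  shows "\<sigma> (\<sigma> \<alpha>) = (if quad (signs \<sigma>) then - \<alpha> else \<alpha>)"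
proof -
  note D = subfield_embeddingD[OF galois_groupD(1)[OF \<sigma>]]
  obtain \<epsilon> where \<epsilon>: "\<epsilon> = 1 \<or> \<epsilon> = - 1" "\<sigma> \<i> = \<epsilon> * \<i>" using square_root_sign[OF \<sigma> i_in i_sq] by (metis mult_1 mult_minus1)
  obtain \<delta> where \<delta>: "\<delta> = 1 \<or> \<delta> = - 1" "\<sigma> \<gamma> = \<delta> * \<gamma>" using square_root_sign[OF \<sigma> \<gamma>_in \<gamma>_sq] by (metis mult_1 mult_minus1)
  have "\<sigma> \<alpha> \<in> complex_roots f"
    using embedding_permutes_roots[OF galois_groupD(1)[OF \<sigma>] complex_roots_in_splitting_field octic_nonzero]
      unit_root[of 1] by auto
  then obtain u where u: "u = 1 \<or> u = \<i> \<or> u = - 1 \<or> u = - \<i>" "\<sigma> \<alpha> = u * \<alpha> \<or> \<sigma> \<alpha> = u * \<beta>"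
    by (rule root_cases)
  define s where "s = u\<^sup>2"
  have s: "s * s = 1" "s \<noteq> 0" using u(1) by (auto simp: s_def power2_eq_square)
  have uS: "u \<in> S" using u(1) S(1) S(3)[OF S(1)] i_in S(3)[OF i_in] by (elim disjE) simp_all
  have \<sigma>u: "\<sigma> u = (if s = 1 then u else \<epsilon> * u)"
    using u(1) \<epsilon>(2) D(2) D(6)[OF S(1)] D(6)[OF i_in] by (elim disjE) (simp_all add: s_def)
  note \<sigma>A = image_of_A(1)[OF \<sigma>, unfolded power2_eq_square] and \<sigma>p = image_of_A(2)[OF \<sigma>]
    and \<sigma>q = image_of_A(3)[OF \<sigma>]
  have "1 / s = s" using s by (simp add: divide_eq_eq)
  then have inv_s: "x / (s * y) = s * (x / y)" for x y :: complex
    by (metis mult.left_neutral times_divide_times_eq)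
  have u_sq: "u * u = s" by (simp add: s_def power2_eq_square)
  from u(2) show ?thesis
  proof
    assume \<sigma>\<alpha>: "\<sigma> \<alpha> = u * \<alpha>"
    have A: "\<sigma> A = s * A" unfolding \<sigma>A \<sigma>\<alpha> s_def by (simp add: A_def power2_eq_square)
    have "\<sigma> p = s * p" "\<sigma> q = s * q" unfolding \<sigma>p \<sigma>q A inv_s by (simp_all add: p_def q_def algebra_simps)
    then have signs: "signs \<sigma> = (s \<noteq> 1, \<epsilon> * \<delta> * s \<noteq> 1, s \<noteq> 1, \<delta> \<noteq> 1)"
      by (rule signs_of_action[OF \<sigma> _ _ \<epsilon>(2) \<delta>(2)])
    have "\<sigma> (\<sigma> \<alpha>) = \<sigma> u * (u * \<alpha>)" using D(5)[OF uS \<alpha>_in] by (simp add: \<sigma>\<alpha>)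
    also have "\<dots> = (if s = 1 then 1 else \<epsilon> * s) * \<alpha>"
      using u_sq by (simp add: \<sigma>u flip: mult.assoc)
    also have "\<dots> = (if quad (signs \<sigma>) then - \<alpha> else \<alpha>)"
      using \<epsilon>(1) \<delta>(1) u(1) unfolding signs by (auto simp: s_def)
    finally show ?thesis .
  next
    assume \<sigma>\<alpha>: "\<sigma> \<alpha> = u * \<beta>"
    have A: "\<sigma> A = s * (\<gamma>\<^sup>2 / A)" unfolding \<sigma>A \<sigma>\<alpha> s_def \<beta>_sq[symmetric] by (simp add: power2_eq_square)
    have "\<sigma> p = s * p" "\<sigma> q = (- s) * q"
      unfolding \<sigma>p \<sigma>q A inv_s using \<gamma>_nonzero A_nonzero by (simp_all add: p_def q_def algebra_simps)
    then have signs: "signs \<sigma> = (s \<noteq> 1, \<epsilon> * \<delta> * (- s) \<noteq> 1, - s \<noteq> 1, \<delta> \<noteq> 1)"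
      by (rule signs_of_action[OF \<sigma> _ _ \<epsilon>(2) \<delta>(2)])
    have "\<sigma> \<beta> = \<delta> * \<gamma> / (u * \<beta>)"
      using D(10)[OF \<gamma>_in \<alpha>_in] unfolding \<beta>_def[symmetric] \<delta>(2) \<sigma>\<alpha> .
    also have "\<dots> = \<delta> * \<alpha> / u" using \<alpha>_nonzero \<gamma>_nonzero by (simp add: \<beta>_def field_simps)
    finally have "\<sigma> (\<sigma> \<alpha>) = \<sigma> u * (\<delta> * \<alpha> / u)" using D(5)[OF uS \<beta>_in] by (simp add: \<sigma>\<alpha>)
    also have "\<dots> = (if s = 1 then \<delta> else \<epsilon> * \<delta>) * \<alpha>" using u(1) by (auto simp: \<sigma>u)
    also have "\<dots> = (if quad (signs \<sigma>) then - \<alpha> else \<alpha>)"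
      using \<epsilon>(1) \<delta>(1) u(1) unfolding signs by (auto simp: s_def)
    finally show ?thesis .
  qed
qed

section \<open>The Galois group as a subgroup of the extraspecial group\<close>

lemma signs_zeroD:
  assumes \<sigma>: "\<sigma> \<in> galois_group f" and "signs \<sigma> = vzero"
  shows "\<sigma> \<i> = \<i>" "\<sigma> \<gamma> = \<gamma>" "\<sigma> \<alpha> = \<alpha> \<or> \<sigma> \<alpha> = - \<alpha>"
proof -
  note D = subfield_embeddingD[OF galois_groupD(1)[OF \<sigma>]]
  have fixed: "\<sigma> p = p" "\<sigma> q = q" "\<sigma> \<gamma> = \<gamma>" "\<sigma> (\<i> * \<gamma> * q) = \<i> * \<gamma> * q"
    using assms(2) by (simp_all add: signs_def vzero_def moves_def)
  show "\<sigma> \<gamma> = \<gamma>" by (rule fixed)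
  have "\<sigma> \<i> * (\<gamma> * q) = \<i> * (\<gamma> * q)"
    using D(5)[OF S(6)[OF i_in \<gamma>_in] q_in] D(5)[OF i_in \<gamma>_in] fixed by (simp add: mult.assoc)
  then show "\<sigma> \<i> = \<i>" using \<gamma>_nonzero q_nonzero by simp
  have "\<sigma> p + \<sigma> q = 2 * \<sigma> A" by (simp add: image_of_A[OF \<sigma>])
  then have "2 * (\<sigma> \<alpha>)\<^sup>2 = 2 * \<alpha>\<^sup>2" unfolding fixed image_of_A(1)[OF \<sigma>] by (simp add: p_def q_def A_def)
  then have "(\<sigma> \<alpha>)\<^sup>2 = \<alpha>\<^sup>2" by simp
  then show "\<sigma> \<alpha> = \<alpha> \<or> \<sigma> \<alpha> = - \<alpha>" by (simp only: power2_eq_iff)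
qed

text \<open>Transitivity gives automorphisms \<open>\<kappa>\<close>, \<open>g\<close>, \<open>h\<close> that send \<open>\<alpha>\<close> to \<open>- \<alpha>\<close>, \<open>\<i> \<alpha>\<close> and \<open>\<beta>\<close>. Whenever the quadratic form
  does not vanish at an automorphism, its square is the required element. If it vanishes at \<open>g\<close>, \<open>h\<close>,
  \<open>\<kappa> g\<close> and \<open>\<kappa> h\<close>, the sign vector of \<open>\<kappa>\<close> is zero and \<open>\<kappa>\<close> itself will do.\<close>
lemma central_involution:
  obtains \<zeta> where "\<zeta> \<in> galois_group f" "\<zeta> \<alpha> = - \<alpha>" "\<zeta> \<i> = \<i>" "\<zeta> \<gamma> = \<gamma>"
proof -
  note result = that
  have from_quad: thesis if \<sigma>: "\<sigma> \<in> galois_group f" and quad: "quad (signs \<sigma>)" for \<sigma>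
  proof (rule result)
    show \<sigma>\<sigma>: "compose S \<sigma> \<sigma> \<in> galois_group f" by (rule galois_group_compose[OF \<sigma> \<sigma> octic_nonzero])
    show "compose S \<sigma> \<sigma> \<alpha> = - \<alpha>" using square_action[OF \<sigma>] quad by (simp add: compose_def \<alpha>_in)
    have twice: "compose S \<sigma> \<sigma> x = x" if "x \<in> S" "x\<^sup>2 = of_rat k" for x k
      using square_root_sign[OF \<sigma> that] subfield_embeddingD(6)[OF galois_groupD(1)[OF \<sigma>] that(1)]
      by (elim disjE) (simp_all add: compose_def that(1))
    show "compose S \<sigma> \<sigma> \<i> = \<i>" "compose S \<sigma> \<sigma> \<gamma> = \<gamma>"
      by (rule twice[OF i_in i_sq], rule twice[OF \<gamma>_in \<gamma>_sq])
  qed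
  have rt: "u * \<alpha> \<in> complex_roots f" "u * \<beta> \<in> complex_roots f" if "u ^ 4 = 1" for u
    using unit_root[OF that] by auto
  obtain \<kappa> where \<kappa>: "\<kappa> \<in> galois_group f" "\<kappa> \<alpha> = - \<alpha>"
    using automorphism_to[OF rt(1)[of "- 1"]] by auto
  obtain g where g: "g \<in> galois_group f" "g \<alpha> = \<i> * \<alpha>"
    using automorphism_to[OF rt(1)[of \<i>]] by (auto simp: i_pow)
  obtain h where h: "h \<in> galois_group f" "h \<alpha> = \<beta>"
    using automorphism_to[OF rt(2)[of 1]] by auto
  have A: "\<kappa> A = A" "g A = - A" "h A = \<gamma>\<^sup>2 / A"
    unfolding image_of_A(1)[OF \<kappa>(1)] image_of_A(1)[OF g(1)] image_of_A(1)[OF h(1)] \<kappa>(2) g(2) h(2)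
    by (simp_all add: power_mult_distrib \<beta>_sq) (simp_all add: A_def)
  have "\<kappa> p = p" "\<kappa> q = q" "g p = - p" "g q = - q" "h p = p" "h q = - q"
    unfolding image_of_A(2,3)[OF \<kappa>(1)] image_of_A(2,3)[OF g(1)] image_of_A(2,3)[OF h(1)] A
    using \<gamma>_nonzero A_nonzero by (simp_all add: p_def q_def)
  then obtain x y x' y' x'' y'' where vecs: "signs \<kappa> = (False, x, False, y)"
    "signs g = (True, x', True, y')" "signs h = (False, x'', True, y'')"
    using p_nonzero q_nonzero by (simp only: signs_def moves_def) simp
  have comp: "compose S \<kappa> \<tau> \<in> galois_group f" "signs (compose S \<kappa> \<tau>) = vadd (signs \<kappa>) (signs \<tau>)"
    if "\<tau> \<in> galois_group f" for \<tau>
    using galois_group_compose[OF \<kappa>(1) that octic_nonzero] signs_compose[OF \<kappa>(1) that] by auto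
  show thesis
  proof (cases "quad (signs g) \<or> quad (signs h) \<or> quad (signs (compose S \<kappa> g)) \<or> quad (signs (compose S \<kappa> h))")
    case True
    then show thesis using from_quad g(1) h(1) comp(1) by blast
  next
    case False
    then have "signs \<kappa> = vzero" using vecs by (auto simp: comp(2)[OF g(1)] comp(2)[OF h(1)] vzero_def)
    then show thesis using result[OF \<kappa>] signs_zeroD[OF \<kappa>(1)] by blast
  qed
qed

abbreviation H where "H \<equiv> galois_perms f r"
abbreviation G where "G \<equiv> (sym_group 8)\<lparr>carrier := H\<rparr>"

lemmas lift_root = lift(2)[unfolded degree_octic]

lemma r_four: "r 4 = \<alpha>" by (simp add: r_def i_pow)

lemma H_subgroup: "subgroup H (sym_group 8)"
  using galois_perms_subgroup unfolding degree_octic .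

lemma H_permutes: "g \<in> H \<Longrightarrow> g permutes {1..8}"
  using galois_perms_permutes unfolding degree_octic .

lemma H_comp: "g \<in> H \<Longrightarrow> h \<in> H \<Longrightarrow> g \<circ> h \<in> H"
  by (rule galois_perms_comp)

lemma H_inv: "g \<in> H \<Longrightarrow> inv' g \<in> H"
  using subgroup.m_inv_closed[OF H_subgroup, of g] H_permutes[of g] by (simp add: sym_group_carrier)

lemma finite_H: "finite H"
  by (rule finite_subset[OF _ finite_permutations[of "{1..8}"]]) (use H_permutes in auto)

lemma lift_surj:
  assumes "\<sigma> \<in> galois_group f" obtains g where "g \<in> H" "lift g = \<sigma>"
  using induced_permutation[OF assms] lift_eqI[OF assms] by metis

lemma signs_image: "(\<lambda>g. signs (lift g)) ` H = signs ` galois_group f"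
proof
  show "signs ` galois_group f \<subseteq> (\<lambda>g. signs (lift g)) ` H"
  proof
    fix u assume "u \<in> signs ` galois_group f"
    then obtain \<sigma> where \<sigma>: "\<sigma> \<in> galois_group f" "u = signs \<sigma>" by (elim imageE)
    obtain g where "g \<in> H" "lift g = \<sigma>" using lift_surj[OF \<sigma>(1)] by blast
    then show "u \<in> (\<lambda>g. signs (lift g)) ` H" using \<sigma>(2) by blast
  qed
qed (use lift(1) in blast)

lemma move_base:
  assumes "j \<in> {1..8}" obtains g where "g \<in> H" "g 4 = j"
proof -
  have "r j \<in> complex_roots f" using r_root[of j] assms unfolding degree_octic .
  then obtain \<sigma> where \<sigma>: "\<sigma> \<in> galois_group f" "\<sigma> \<alpha> = r j" by (rule automorphism_to)
  obtain g where g: "g \<in> H" "lift g = \<sigma>" using lift_surj[OF \<sigma>(1)] by blast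
  have "r (g 4) = r j" using lift_root[OF g(1), of 4] \<sigma>(2) g(2) by (simp add: r_four)
  moreover have "g 4 \<in> {1..8}" using permutes_in_image[OF H_permutes[OF g(1)], of 4] by simp
  ultimately have "g 4 = j" using r_inj[of "g 4" j] assms unfolding degree_octic by simp
  then show thesis using that g(1) by blast
qed

lemma H_transitive: "transitive_subgroup 8 H"
  unfolding transitive_subgroup_def
proof (intro conjI H_subgroup ballI)
  fix i j :: nat assume ij: "i \<in> {1..8}" "j \<in> {1..8}"
  obtain g where g: "g \<in> H" "g 4 = i" using move_base[OF ij(1)] .
  obtain h where h: "h \<in> H" "h 4 = j" using move_base[OF ij(2)] .
  have "(h \<circ> inv' g) i = j" using g h permutes_inverses(2)[OF H_permutes[OF g(1)], of 4] by simp
  then show "\<exists>g\<in>H. g i = j" using H_comp[OF h(1) H_inv[OF g(1)]] by blast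
qed

text \<open>Orbit counting: the permutations that send 4 to \<open>j\<close> form a coset of the stabilizer of 4. The root with number
  4 is \<open>\<alpha>\<close>.\<close>
lemma card_H: "card H = 8 * card {g \<in> H. g 4 = 4}"
proof -
  have fibre: "card {g \<in> H. g 4 = j} = card {g \<in> H. g 4 = 4}" if j: "j \<in> {1..8}" for j
  proof -
    obtain h where h: "h \<in> H" "h 4 = j" using move_base[OF j] .
    note hp = H_permutes[OF h(1)]
    have "{g \<in> H. g 4 = j} = (\<lambda>g. h \<circ> g) ` {g \<in> H. g 4 = 4}"
    proof (intro equalityI subsetI)
      fix g assume g: "g \<in> {g \<in> H. g 4 = j}"
      have "g = h \<circ> (inv' h \<circ> g)" using permutes_inv_o(1)[OF hp] by (simp only: comp_assoc[symmetric] id_comp)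
      moreover have "inv' h \<circ> g \<in> H" using g H_comp[OF H_inv[OF h(1)]] by simp
      moreover have "(inv' h \<circ> g) 4 = 4" using g h(2) permutes_inverses(2)[OF hp, of 4] by simp
      ultimately show "g \<in> (\<lambda>g. h \<circ> g) ` {g \<in> H. g 4 = 4}"
        by (intro image_eqI[of _ _ "inv' h \<circ> g"] CollectI conjI)
    next
      fix g assume "g \<in> (\<lambda>g. h \<circ> g) ` {g \<in> H. g 4 = 4}"
      then obtain k where "k \<in> H" "k 4 = 4" "g = h \<circ> k" by blast
      then show "g \<in> {g \<in> H. g 4 = j}" using H_comp[OF h(1)] h(2) by simp
    qed
    moreover have "inj_on (\<lambda>g. h \<circ> g) {g \<in> H. g 4 = 4}"
    proof (intro inj_onI ext)
      fix g k x assume "h \<circ> g = h \<circ> k"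
      then have "h (g x) = h (k x)" by (simp only: fun_eq_iff comp_apply)
      then show "g x = k x" by (rule injD[OF permutes_inj[OF hp]])
    qed
    ultimately show ?thesis by (simp add: card_image)
  qed
  have img: "(\<lambda>g. g 4) ` H \<subseteq> {1..8}"
  proof (rule image_subsetI)
    fix g assume "g \<in> H"
    then show "g 4 \<in> {1..8}" using permutes_in_image[OF H_permutes, of g 4] by simp
  qed
  have "card H = (\<Sum>g\<in>H. 1)" by simp
  also have "\<dots> = (\<Sum>j\<in>{1..8}. \<Sum>g\<in>{g \<in> H. g 4 = j}. 1)"
    by (rule sum.group[OF finite_H _ img, symmetric]) simp
  also have "\<dots> = (\<Sum>j\<in>{1..8::nat}. card {g \<in> H. g 4 = j})" by simp
  also have "\<dots> = (\<Sum>j\<in>{1..8::nat}. card {g \<in> H. g 4 = 4})" by (rule sum.cong[OF refl fibre])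
  finally show ?thesis by simp
qed

lemma lift_comp: "g \<in> H \<Longrightarrow> h \<in> H \<Longrightarrow> x \<in> S \<Longrightarrow> lift (g \<circ> h) x = lift g (lift h x)"
  using galois_perms_comp(2)[of g h] compose_apply[OF lift(1)] by simp

lemma id_in_H: "id \<in> H" using subgroup.one_closed[OF H_subgroup] by (simp add: sym_group_one)

lemma lift_id: "x \<in> S \<Longrightarrow> lift id x = x"
proof -
  assume x: "x \<in> S"
  have "restrict id S \<in> galois_group f"
    by (rule restrict_embedding_in_galois_group[OF _ complex_roots_in_splitting_field octic_nonzero])
      (simp add: subfield_embedding_def splitting_field_subfield)
  then have "lift id = restrict id S" by (rule lift_eqI) (simp add: r_in)
  then show ?thesis using x by simp
qed

lemma H_eqI:
  assumes "g \<in> H" "h \<in> H" "lift g \<alpha> = lift h \<alpha>" "lift g \<i> = lift h \<i>" "lift g \<gamma> = lift h \<gamma>"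
  shows "g = h"
  using assms by (intro lift_inj galois_eqI lift(1))

text \<open>An element of the kernel of the sign vector fixes \<open>\<i>\<close>, \<open>\<gamma>\<close> and \<open>A\<close>, so it fixes or negates \<open>\<alpha>\<close>.\<close>
theorem galois_plus_type: "\<exists>z. plus_type_group G z (\<lambda>g. signs (lift g))"
proof -
  obtain \<zeta> where \<zeta>: "\<zeta> \<in> galois_group f" "\<zeta> \<alpha> = - \<alpha>" "\<zeta> \<i> = \<i>" "\<zeta> \<gamma> = \<gamma>"
    by (rule central_involution)
  obtain z where z: "z \<in> H" "lift z = \<zeta>" using lift_surj[OF \<zeta>(1)] by blast
  have vec_id: "signs (lift id) = vzero"
    by (simp add: signs_def moves_def vzero_def lift_id p_in q_in \<gamma>_in i\<gamma>q_in)
  have "\<zeta> A = A" unfolding image_of_A(1)[OF \<zeta>(1)] \<zeta>(2) by (simp add: A_def)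
  then have "\<zeta> p = p" "\<zeta> q = q" unfolding image_of_A(2,3)[OF \<zeta>(1)] by (simp_all add: p_def q_def)
  then have vec_z: "signs (lift z) = vzero"
    using signs_of_action[OF \<zeta>(1), of 1 1 1 1] \<zeta>(3,4) by (simp add: z(2) vzero_def)
  interpret group G by (rule subgroup.subgroup_is_group[OF H_subgroup sym_group_is_group])
  have "plus_type_group_axioms G z (\<lambda>g. signs (lift g))"
  proof
    show "finite (carrier G)" using finite_H by simp
    show "z \<in> carrier G" using z(1) by simp
    show "z \<noteq> \<one>\<^bsub>G\<^esub>"
    proof
      assume "z = \<one>\<^bsub>G\<^esub>"
      then have "\<zeta> \<alpha> = \<alpha>" using z(2) lift_id[OF \<alpha>_in] by (simp add: sym_group_one)
      then show False using \<zeta>(2) \<alpha>_nonzero by simp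
    qed
  next
    fix g h assume "g \<in> carrier G" "h \<in> carrier G"
    then show "signs (lift (g \<otimes>\<^bsub>G\<^esub> h)) = vadd (signs (lift g)) (signs (lift h))"
      using galois_perms_comp(2)[of g h] signs_compose[OF lift(1) lift(1)] by (simp add: sym_group_mult)
  next
    fix g assume "g \<in> carrier G"
    then have g: "g \<in> H" by simp
    show "signs (lift g) = vzero \<longleftrightarrow> g = \<one>\<^bsub>G\<^esub> \<or> g = z"
    proof
      assume "signs (lift g) = vzero"
      note D = signs_zeroD[OF lift(1)[OF g] this]
      from D(3) show "g = \<one>\<^bsub>G\<^esub> \<or> g = z"
      proof
        assume "lift g \<alpha> = \<alpha>"
        then have "g = id"
          by (intro H_eqI[OF g id_in_H]) (simp_all add: lift_id \<alpha>_in i_in \<gamma>_in D(1,2))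
        then show ?thesis by (simp add: sym_group_one)
      next
        assume "lift g \<alpha> = - \<alpha>"
        then have "g = z"
          by (intro H_eqI[OF g z(1)]) (simp_all add: z(2) \<zeta>(2-4) D(1,2))
        then show ?thesis ..
      qed
    qed (use vec_id vec_z in \<open>auto simp: sym_group_one\<close>)
    have twice: "lift g (lift g x) = x" if "x \<in> S" "x\<^sup>2 = of_rat k" for x k
      using square_root_sign[OF lift(1)[OF g] that] subfield_embeddingD(6)[OF galois_groupD(1)[OF lift(1)[OF g]] that(1)]
      by (elim disjE) simp_all
    note sq = lift_comp[OF g g \<alpha>_in] lift_comp[OF g g i_in] lift_comp[OF g g \<gamma>_in]
      square_action[OF lift(1)[OF g]] twice[OF i_in i_sq] twice[OF \<gamma>_in \<gamma>_sq]
    have "g \<circ> g = (if quad (signs (lift g)) then z else id)"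
    proof (cases "quad (signs (lift g))")
      case True
      have "g \<circ> g = z"
        by (rule H_eqI[OF H_comp[OF g g] z(1)]) (simp_all add: sq True z(2) \<zeta>(2-4))
      then show ?thesis using True by simp
    next
      case False
      have "g \<circ> g = id"
        by (rule H_eqI[OF H_comp[OF g g] id_in_H]) (simp_all add: sq False lift_id \<alpha>_in i_in \<gamma>_in)
      then show ?thesis using False by simp
    qed
    then show "g \<otimes>\<^bsub>G\<^esub> g = (if quad (signs (lift g)) then z else \<one>\<^bsub>G\<^esub>)"
      by (simp add: sym_group_mult sym_group_one)
  qed
  then have "plus_type_group G z (\<lambda>g. signs (lift g))" by (intro plus_type_group.intro is_group)
  then show ?thesis by (intro exI)
qed

section \<open>The Galois group and multiplicative relations between radicands\<close>

lemma galois_type: "G \<cong> Q \<Longrightarrow> galois_type_in f (transitive_octic Q)"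
  unfolding galois_type_in_def transitive_octic_def degree_octic
  using r_bij H_transitive by blast

text \<open>Complex conjugation is an involution, so the quadratic form vanishes at it, and it moves \<open>\<i>\<close>, so it is not \<open>z\<close>.
  If \<open>\<alpha>\<close> is real, it lies in the stabilizer of \<open>\<alpha>\<close>.\<close>
lemma complex_conjugation:
  obtains t where "t \<in> H" "signs (lift t) \<noteq> vzero" "\<not> quad (signs (lift t))" "t \<noteq> id"
    "cnj \<alpha> = \<alpha> \<Longrightarrow> t 4 = 4"
proof -
  have cnj: "subfield_embedding UNIV cnj" by (simp add: subfield_embedding_def complex_subfield_def)
  have in_galois: "restrict cnj S \<in> galois_group f"
    by (rule restrict_embedding_in_galois_group[OF cnj subset_UNIV octic_nonzero])
  obtain t where t: "t \<in> H" "lift t = restrict cnj S" using lift_surj[OF in_galois] by blast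
  have lift_t: "lift t x = cnj x" if "x \<in> S" for x using that by (simp add: t(2))
  have "signs (lift t) \<noteq> vzero"
    using signs_zeroD(1)[OF lift(1)[OF t(1)]] lift_t[OF i_in] by auto
  moreover have "\<not> quad (signs (lift t))"
    using square_action[OF lift(1)[OF t(1)]] lift_t[OF \<alpha>_in] lift_t[of "cnj \<alpha>"] \<alpha>_nonzero
      S_image[OF lift(1)[OF t(1)] \<alpha>_in] by auto
  moreover have "t \<noteq> id" using lift_id[OF i_in] lift_t[OF i_in] by auto
  moreover have "t 4 = 4" if "cnj \<alpha> = \<alpha>"
  proof -
    have "r (t 4) = r 4" using lift_root[OF t(1), of 4] lift_t[OF \<alpha>_in] that by (simp add: r_four)
    moreover have "t 4 \<in> {1..8}" using permutes_in_image[OF H_permutes[OF t(1)], of 4] by simp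
    ultimately show ?thesis using r_inj[of "t 4" 4] unfolding degree_octic by simp
  qed
  ultimately show thesis using that t(1) by blast
qed

end

locale octic_galois_action = octic +
  fixes z
  assumes plus_type: "plus_type_group G z (\<lambda>g. signs (lift g))"
begin

sublocale plus_type_group G z "\<lambda>g. signs (lift g)" by (rule plus_type)

abbreviation W where "W \<equiv> signs ` galois_group f"

lemma card_W: "card H = 2 * card W"
  using card_carrier signs_image by simp

lemma W_closed: "u \<in> W \<Longrightarrow> w \<in> W \<Longrightarrow> vadd u w \<in> W"
  using v_image_closed[of u w] unfolding signs_image[symmetric] by simp

lemma stabilizer_pos: "card {g \<in> H. g 4 = 4} \<ge> 1"
proof -
  have "card {id :: nat \<Rightarrow> nat} \<le> card {g \<in> H. g 4 = 4}"
    using id_in_H finite_H by (intro card_mono) auto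
  then show ?thesis by simp
qed

text \<open>The order is divisible by 8 and twice that of \<open>W\<close>, a subspace which has at most 8 elements unless it is everything.\<close>
lemma card_cases: "card H \<in> {8, 16, 32}"
proof -
  have W16: "card W = 16" if "card W > 8"
    using large_subspace_eq_UNIV[of W, OF W_closed that] card_vec4 by simp
  have "card W \<le> 16" using card_mono[of UNIV W] card_vec4 by simp
  then show ?thesis using W16 card_W card_H stabilizer_pos by (cases "card W > 8") auto
qed

lemma lift_W: "u \<in> W \<Longrightarrow> \<exists>g\<in>carrier G. signs (lift g) = u"
  unfolding signs_image[symmetric] by auto

theorem galois_type_among_six: "\<exists>\<C>\<in>{T8_2, T8_3, T8_4, T8_9, T8_11, T8_22}. galois_type_in f \<C>"
proof -
  obtain t where t: "t \<in> H" "signs (lift t) \<noteq> vzero" "\<not> quad (signs (lift t))"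
    by (rule complex_conjugation)
  have "card (carrier G) \<in> {8, 16, 32}" "t \<in> carrier G" using card_cases t(1) by simp_all
  from classification[OF this t(2,3)]
  have "galois_type_in f T8_2 \<or> galois_type_in f T8_3 \<or> galois_type_in f T8_4
      \<or> galois_type_in f T8_9 \<or> galois_type_in f T8_11 \<or> galois_type_in f T8_22"
    unfolding T8_2_def T8_3_def T8_4_def T8_9_def T8_11_def T8_22_def
    by (elim disjE) (simp_all only: galois_type simp_thms)
  then show ?thesis by simp
qed

text \<open>For a group cut out by two independent relations the order is the smallest possible, and \<open>W\<close> is known exactly.\<close>
lemma order_eight:
  assumes sub: "W \<subseteq> M" and card: "card M = 4"
  shows "card (carrier G) = 8" "W = M"
proof -
  have M: "finite M" using card by (intro card_ge_0_finite) simp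
  have "card W \<le> 4" using card_mono[OF M sub] card by simp
  then have "card H \<le> 8" using card_W by simp
  then have 8: "card H = 8" using card_cases by auto
  then show "card (carrier G) = 8" by simp
  have "card W = card M" using 8 card_W card by simp
  then show "W = M" by (rule card_subset_eq[OF M sub])
qed

lemma radicand_relation: "k\<^sup>2 = radicand l \<Longrightarrow> u \<in> W \<Longrightarrow> \<not> dot l u"
  using kummer_criterion[of l] by blast

text \<open>The relations force \<open>v\<^sub>1 = v\<^sub>2\<close> and \<open>v\<^sub>4 = 0\<close>. On this plane the polar form vanishes and the
  quadratic form does not.\<close>
lemma T8_2_of_radicands:
  assumes "k\<^sup>2 = radicand (True, True, False, False)" "m\<^sup>2 = radicand (False, False, False, True)"
  shows "galois_type_in f T8_2"
proof -
  let ?M = "{(x, x, y, False) | x y. True} :: vec4 set"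
  have "W \<subseteq> ?M"
  proof
    fix u assume "u \<in> W"
    from radicand_relation[OF assms(1) this] radicand_relation[OF assms(2) this]
    show "u \<in> ?M" by (cases u) auto
  qed
  moreover have "?M = {(False, False, False, False), (True, True, False, False),
      (False, False, True, False), (True, True, True, False)}" by auto
  ultimately have W: "card (carrier G) = 8" "W = ?M" using order_eight[of ?M] by simp_all
  have "(True, True, False, False) \<in> W" "(False, False, True, False) \<in> W" unfolding W(2) by auto
  then obtain x t where "x \<in> carrier G" "signs (lift x) = (True, True, False, False)"
    "t \<in> carrier G" "signs (lift t) = (False, False, True, False)" using lift_W by metis
  then have "G \<cong> integer_mod_group 4 \<times>\<times> integer_mod_group 2"
    by (intro iso_C4_C2[OF W(1), of x t]) (simp_all add: vzero_def)
  then show ?thesis unfolding T8_2_def by (rule galois_type)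
qed

text \<open>The plane \<open>v\<^sub>2 = v\<^sub>4 = 0\<close> is totally singular.\<close>
lemma T8_3_of_radicands:
  assumes "k\<^sup>2 = radicand (False, True, False, False)" "m\<^sup>2 = radicand (False, False, False, True)"
  shows "galois_type_in f T8_3"
proof -
  let ?M = "{(x, False, y, False) | x y. True} :: vec4 set"
  have sub: "W \<subseteq> ?M"
  proof
    fix u assume "u \<in> W"
    from radicand_relation[OF assms(1) this] radicand_relation[OF assms(2) this]
    show "u \<in> ?M" by (cases u) auto
  qed
  moreover have "?M = {(False, False, False, False), (True, False, False, False),
      (False, False, True, False), (True, False, True, False)}" by auto
  ultimately have card: "card (carrier G) = 8" using order_eight[of ?M] by simp
  have "\<not> quad (signs (lift x))" if "x \<in> carrier G" for x
  proof -
    have "signs (lift x) \<in> ?M" using sub lift(1)[of x] that by auto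
    then show ?thesis by auto
  qed
  then have "G \<cong> integer_mod_group 2 \<times>\<times> integer_mod_group 2 \<times>\<times> integer_mod_group 2"
    by (rule iso_C2_C2_C2[OF card])
  then show ?thesis unfolding T8_3_def by (rule galois_type)
qed

text \<open>The relations force \<open>v\<^sub>1 + v\<^sub>2 + v\<^sub>3 = 0\<close> and \<open>v\<^sub>4 = 0\<close>, a plane on which the polar form is
  nondegenerate.\<close>
lemma T8_4_of_radicands:
  assumes "k\<^sup>2 = radicand (True, True, True, False)" "m\<^sup>2 = radicand (False, False, False, True)"
  shows "galois_type_in f T8_4"
proof -
  let ?M = "{(x, x \<noteq> y, y, False) | x y. True} :: vec4 set"
  have "W \<subseteq> ?M"
  proof
    fix u assume "u \<in> W"
    from radicand_relation[OF assms(1) this] radicand_relation[OF assms(2) this]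
    show "u \<in> ?M" by (cases u) auto
  qed
  moreover have "?M = {(False, False, False, False), (True, True, False, False),
      (False, True, True, False), (True, False, True, False)}" by auto
  ultimately have W: "card (carrier G) = 8" "W = ?M" using order_eight[of ?M] by simp_all
  have "(True, True, False, False) \<in> W" "(False, True, True, False) \<in> W" unfolding W(2) by auto
  then obtain x t where "x \<in> carrier G" "signs (lift x) = (True, True, False, False)"
    "t \<in> carrier G" "signs (lift t) = (False, True, True, False)" using lift_W by metis
  then have "G \<cong> dihedral_group 4" by (intro iso_D4[OF W(1), of x t]) simp_all
  then show ?thesis unfolding T8_4_def by (rule galois_type)
qed

text \<open>The stabilizer of a real root contains complex conjugation.\<close>
lemma order_of_real:
  assumes "cnj \<alpha> = \<alpha>" shows "card H \<in> {16, 32}"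
proof -
  obtain t where t: "t \<in> H" "t \<noteq> id" "t 4 = 4" using complex_conjugation assms by metis
  have "card {id, t} \<le> card {g \<in> H. g 4 = 4}"
    using t id_in_H finite_H by (intro card_mono) auto
  then have "card {g \<in> H. g 4 = 4} \<ge> 2" using t(2) by simp
  then show ?thesis using card_cases card_H by auto
qed

text \<open>One relation excludes order 32, and a real root excludes order 8.\<close>
lemma order_sixteen:
  assumes real: "cnj \<alpha> = \<alpha>" and l: "l \<noteq> vzero" "k\<^sup>2 = radicand l"
  shows "card (carrier G) = 16" "W = {u. \<not> dot l u}"
proof -
  have "dot l (True, False, False, False) \<or> dot l (False, True, False, False)
      \<or> dot l (False, False, True, False) \<or> dot l (False, False, False, True)"
    using l(1) by (cases l) (simp add: vzero_def)
  then obtain w where w: "dot l w" by blast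
  have sub: "W \<subseteq> {u. \<not> dot l u}" using radicand_relation[OF l(2)] by (intro subsetI CollectI)
  have "card W \<le> 8"
  proof (rule ccontr)
    assume "\<not> card W \<le> 8"
    then have "W = UNIV" by (intro large_subspace_eq_UNIV W_closed) simp_all
    then show False using sub w by blast
  qed
  then have 16: "card H = 16" using order_of_real[OF real] card_W by auto
  then show "card (carrier G) = 16" by simp
  have card_W8: "card W = 8" using 16 card_W by simp
  obtain l' where l': "l' \<noteq> vzero" "\<And>u. u \<in> W \<longleftrightarrow> \<not> dot l' u"
    using hyperplane_of_index_two[OF W_closed card_W8] by blast
  have "card {u. \<not> dot l u} \<le> 8"
  proof (rule ccontr)
    assume "\<not> card {u. \<not> dot l u} \<le> 8"
    moreover have "vadd u x \<in> {u. \<not> dot l u}" if "u \<in> {u. \<not> dot l u}" "x \<in> {u. \<not> dot l u}" for u x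
      using that dot_add[of l u x] by simp
    ultimately have "{u. \<not> dot l u} = UNIV" by (intro large_subspace_eq_UNIV) simp_all
    then show False using w by blast
  qed
  then show "W = {u. \<not> dot l u}" using card_W8 sub by (intro card_seteq) auto
qed

text \<open>The hyperplane \<open>v\<^sub>4 = 0\<close> is the orthogonal complement of the third basis vector, which is singular.\<close>
lemma T8_9_of_radicands:
  assumes "cnj \<alpha> = \<alpha>" "k\<^sup>2 = radicand (False, False, False, True)"
  shows "galois_type_in f T8_9"
proof -
  note W = order_sixteen[OF assms(1) _ assms(2)]
  have "(False, False, True, False) \<in> W" "(True, True, False, False) \<in> W" "(True, False, False, False) \<in> W"
    using W(2) by (simp_all add: vzero_def)
  then obtain w r s where "w \<in> carrier G" "signs (lift w) = (False, False, True, False)"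
    "r \<in> carrier G" "signs (lift r) = (True, True, False, False)"
    "s \<in> carrier G" "signs (lift s) = (True, False, False, False)" using lift_W by metis
  moreover have "card (carrier G) = 16" using W(1) by (simp add: vzero_def)
  ultimately have "G \<cong> integer_mod_group 2 \<times>\<times> dihedral_group 4"
    by (intro iso_C2_D4[of r s w]) (simp_all add: vzero_def)
  then show ?thesis unfolding T8_9_def by (rule galois_type)
qed

text \<open>The hyperplane \<open>v\<^sub>3 = v\<^sub>4\<close> is the orthogonal complement of \<open>(0, 0, 1, 1)\<close>, which is not singular.\<close>
lemma T8_11_of_radicands:
  assumes "cnj \<alpha> = \<alpha>" "k\<^sup>2 = radicand (False, False, True, True)"
  shows "galois_type_in f T8_11"
proof -
  note W = order_sixteen[OF assms(1) _ assms(2)]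
  have "(False, False, True, True) \<in> W" "(True, True, False, False) \<in> W" "(True, False, False, False) \<in> W"
    using W(2) by (simp_all add: vzero_def)
  then obtain w r s where "w \<in> carrier G" "signs (lift w) = (False, False, True, True)"
    "r \<in> carrier G" "signs (lift r) = (True, True, False, False)"
    "s \<in> carrier G" "signs (lift s) = (True, False, False, False)" using lift_W by metis
  moreover have "card (carrier G) = 16" using W(1) by (simp add: vzero_def)
  ultimately have "G \<cong> C4_circ_D4"
    by (intro iso_C4_circ_D4[of r s w]) simp_all
  then show ?thesis unfolding T8_11_def by (rule galois_type)
qed

text \<open>In order 16, \<open>W\<close> would be a hyperplane, and its equation would be a relation by Kummer theory.\<close>
lemma T8_22_of_radicands:
  assumes "cnj \<alpha> = \<alpha>" and indep: "\<And>l k. l \<noteq> vzero \<Longrightarrow> k\<^sup>2 \<noteq> radicand l"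
  shows "galois_type_in f T8_22"
proof -
  have "card H \<noteq> 16"
  proof
    assume "card H = 16"
    then have card_W8: "card W = 8" using card_W by simp
    obtain l where l: "l \<noteq> vzero" "\<And>u. u \<in> W \<longleftrightarrow> \<not> dot l u"
      using hyperplane_of_index_two[OF W_closed card_W8] by blast
    then have "\<exists>k. k\<^sup>2 = radicand l" unfolding kummer_criterion by blast
    then show False using indep[OF l(1)] by blast
  qed
  then have "card (carrier G) = 32" using order_of_real[OF assms(1)] by simp
  then have "G \<cong> D4_circ_D4" by (rule iso_D4_circ_D4)
  then show ?thesis unfolding T8_22_def by (rule galois_type)
qed

end

lemma octic_galois_action_of_root:
  assumes "Factorial_Ring.irreducible (octic_poly a (c\<^sup>2))" "cpoly (octic_poly a (c\<^sup>2)) \<alpha> = 0"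
  obtains \<gamma> z where "octic_galois_action a c \<alpha> \<gamma> z"
proof -
  have o: "octic a c \<alpha> (csqrt (of_rat c))" using assms by (simp add: octic_def)
  then interpret octic a c \<alpha> "csqrt (of_rat c)" .
  obtain z where "plus_type_group G z (\<lambda>g. signs (lift g))" using galois_plus_type by blast
  then have "octic_galois_action a c \<alpha> (csqrt (of_rat c)) z"
    by (intro octic_galois_action.intro octic_galois_action_axioms.intro octic_axioms)
  then show thesis by (rule that)
qed

text \<open>Under these assumptions \<open>y\<^sup>2 + a y + b\<close> has a nonnegative real root, and its fourth root is a root of the octic.\<close>
lemma octic_real_root:
  assumes "a \<le> 0" "4 * b \<le> a\<^sup>2"
  obtains \<alpha> where "cpoly (octic_poly a b) \<alpha> = 0" "cnj \<alpha> = \<alpha>"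
proof -
  define d where "d = (of_rat a)\<^sup>2 - 4 * (of_rat b :: real)"
  define y where "y = (- of_rat a + sqrt d) / 2"
  have "of_rat (4 * b) \<le> (of_rat (a\<^sup>2) :: real)" using assms(2) by (simp only: of_rat_less_eq)
  then have d: "d \<ge> 0" by (simp add: d_def of_rat_mult of_rat_power)
  have y: "y \<ge> 0"
    unfolding y_def using assms(1) d by (intro divide_nonneg_nonneg add_nonneg_nonneg) simp_all
  have "(2 * y + of_rat a)\<^sup>2 = d" using d by (simp add: y_def)
  then have "4 * (y\<^sup>2 + of_rat a * y + of_rat b) = 0"
    by (simp add: d_def power2_eq_square algebra_simps)
  then have y_eq: "y\<^sup>2 + of_rat a * y + of_rat b = 0" by simp
  have "(root 4 y) ^ 4 = y" using y by simp
  moreover from this have "(root 4 y) ^ 8 = y\<^sup>2"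
    by (metis numeral_Bit0 power_add mult_2 power2_eq_square)
  ultimately have "(root 4 y) ^ 8 + of_rat a * (root 4 y) ^ 4 + of_rat b = (0::real)" using y_eq by simp
  then have "complex_of_real ((root 4 y) ^ 8 + of_rat a * (root 4 y) ^ 4 + of_rat b) = 0" by simp
  moreover have "complex_of_real (of_rat k) = of_rat k" for k
    by (cases k) (simp add: of_rat_rat)
  ultimately have "cpoly (octic_poly a b) (complex_of_real (root 4 y)) = 0"
    by (simp add: cpoly_octic)
  then show thesis by (rule that) simp
qed

section \<open>The six examples\<close>

lemma galois_type_cases:
  assumes irr: "Factorial_Ring.irreducible (octic_poly a (c\<^sup>2))"
  shows "\<exists>\<C>\<in>{T8_2, T8_3, T8_4, T8_9, T8_11, T8_22}. galois_type_in (octic_poly a (c\<^sup>2)) \<C>"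
proof -
  obtain \<alpha> where "cpoly (octic_poly a (c\<^sup>2)) \<alpha> = 0" by (rule octic_root)
  then obtain \<gamma> z where "octic_galois_action a c \<alpha> \<gamma> z"
    by (rule octic_galois_action_of_root[OF irr])
  then show ?thesis by (rule octic_galois_action.galois_type_among_six)
qed

lemma irrational_squares:
  "(k::rat)\<^sup>2 \<noteq> 2" "k\<^sup>2 \<noteq> 3" "k\<^sup>2 \<noteq> 5" "k\<^sup>2 \<noteq> 6" "k\<^sup>2 \<noteq> 10" "k\<^sup>2 \<noteq> 11" "k\<^sup>2 \<noteq> 12"
  "k\<^sup>2 \<noteq> 20" "k\<^sup>2 \<noteq> 22" "k\<^sup>2 \<noteq> 33" "k\<^sup>2 \<noteq> 66"
  using not_square_between[of 1 2 k] not_square_between[of 1 3 k] not_square_between[of 2 5 k]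
    not_square_between[of 2 6 k] not_square_between[of 3 10 k] not_square_between[of 3 11 k]
    not_square_between[of 3 12 k] not_square_between[of 4 20 k] not_square_between[of 4 22 k]
    not_square_between[of 5 33 k] not_square_between[of 8 66 k]
  by simp_all

lemma negative_nonsquares: "(k::rat)\<^sup>2 \<noteq> - numeral n" "(k::rat)\<^sup>2 \<noteq> - 1"
  by (rule not_square_negative, simp)+

lemmas nonsquares = irrational_squares negative_nonsquares

text \<open>The examples are \<open>x\<^sup>8 + 1\<close>, \<open>x\<^sup>8 - x\<^sup>4 + 1\<close> and \<open>x\<^sup>8 + 3 x\<^sup>4 + 1\<close> in order 8, \<open>x\<^sup>8 - 4 x\<^sup>4 + 1\<close> and
  \<open>x\<^sup>8 - 6 x\<^sup>4 + 4\<close> in order 16, and \<open>x\<^sup>8 - 7 x\<^sup>4 + 4\<close> in order 32; the first two are the cyclotomic polynomials of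
  the 16th and 24th roots of unity. In most cases neither \<open>a + 2 c\<close> nor \<open>a - 2 c\<close> is a square, and the last
  assumption of the irreducibility criterion is vacuous.\<close>
lemma irreducible_T8_2: "Factorial_Ring.irreducible (octic_poly 0 (1\<^sup>2))"
proof (rule octic_irreducible)
  fix \<eta> s m n :: rat assume "\<eta> = 1 \<or> \<eta> = - 1" "s\<^sup>2 = 0 - 2 * \<eta>"
  then have "s\<^sup>2 = 2 \<or> s\<^sup>2 = - 2" by auto
  then show False using nonsquares[of s] by blast
qed (use nonsquares in simp_all)

lemma irreducible_T8_3: "Factorial_Ring.irreducible (octic_poly (- 1) (1\<^sup>2))"
proof (rule octic_irreducible)
  fix \<eta> s m n :: rat
  assume \<eta>: "\<eta> = 1 \<or> \<eta> = - 1" and s: "s\<^sup>2 = - 1 - 2 * \<eta>" and 1: "s * (m\<^sup>2 - n\<^sup>2 * 1\<^sup>2) = 2 * \<eta>"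
    and 2: "s * (2 * m * n - (- 1) * n\<^sup>2) = 2"
  have "\<eta> \<noteq> 1"
  proof
    assume "\<eta> = 1"
    then have "s\<^sup>2 = - 3" using s by simp
    then show False using nonsquares[of s] by blast
  qed
  then have \<eta>: "\<eta> = - 1" using \<eta> by blast
  then have s1: "s = 1 \<or> s = - 1" using s by (simp add: power2_eq_1_iff)
  have "s * (m * (m + 2 * n)) = 0" using 1 2 by (simp add: \<eta> power2_eq_square algebra_simps)
  then have "m = 0 \<or> m = - 2 * n" using s1 by (auto simp: eq_neg_iff_add_eq_0)
  then have "s * n\<^sup>2 = 2 \<or> s * (3 * n\<^sup>2) = - 2"
    using 2 by (elim disjE) (simp_all add: power2_eq_square)
  moreover have "(3 * n)\<^sup>2 = 3 * (3 * n\<^sup>2)" by (simp add: power2_eq_square)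
  ultimately have "n\<^sup>2 = 2 \<or> n\<^sup>2 = - 2 \<or> (3 * n)\<^sup>2 = - 6 \<or> (3 * n)\<^sup>2 = 6"
    using s1 by auto
  then show False using nonsquares[of n] nonsquares[of "3 * n"] by blast
qed (use nonsquares in simp_all)

lemma irreducible_T8_4: "Factorial_Ring.irreducible (octic_poly 3 (1\<^sup>2))"
proof (rule octic_irreducible)
  fix \<eta> s m n :: rat
  assume \<eta>: "\<eta> = 1 \<or> \<eta> = - 1" and s: "s\<^sup>2 = 3 - 2 * \<eta>" and 1: "s * (m\<^sup>2 - n\<^sup>2 * 1\<^sup>2) = 2 * \<eta>"
    and 2: "s * (2 * m * n - 3 * n\<^sup>2) = 2"
  have "\<eta> \<noteq> - 1"
  proof
    assume "\<eta> = - 1"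
    then have "s\<^sup>2 = 5" using s by simp
    then show False using nonsquares[of s] by blast
  qed
  then have \<eta>: "\<eta> = 1" using \<eta> by blast
  then have "s \<noteq> 0" using s by auto
  moreover have "s * ((m - n)\<^sup>2 + n\<^sup>2) = 0"
    using 1 2 by (simp add: \<eta> power2_eq_square algebra_simps)
  ultimately have "n = 0" "m = 0" by (auto simp: sum_power2_eq_zero_iff)
  then show False using 2 by simp
qed (use nonsquares in simp_all)

lemma irreducible_T8_9: "Factorial_Ring.irreducible (octic_poly (- 4) (1\<^sup>2))"
proof (rule octic_irreducible)
  fix \<eta> s m n :: rat assume "\<eta> = 1 \<or> \<eta> = - 1" "s\<^sup>2 = - 4 - 2 * \<eta>"
  then have "s\<^sup>2 = - 6 \<or> s\<^sup>2 = - 2" by auto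
  then show False using nonsquares[of s] by blast
qed (use nonsquares in simp_all)

lemma irreducible_T8_11: "Factorial_Ring.irreducible (octic_poly (- 6) (2\<^sup>2))"
proof (rule octic_irreducible)
  fix \<eta> s m n :: rat assume "\<eta> = 2 \<or> \<eta> = - 2" "s\<^sup>2 = - 6 - 2 * \<eta>"
  then have "s\<^sup>2 = - 10 \<or> s\<^sup>2 = - 2" by auto
  then show False using nonsquares[of s] by blast
qed (use nonsquares in simp_all)

lemma irreducible_T8_22: "Factorial_Ring.irreducible (octic_poly (- 7) (2\<^sup>2))"
proof (rule octic_irreducible)
  fix \<eta> s m n :: rat assume "\<eta> = 2 \<or> \<eta> = - 2" "s\<^sup>2 = - 7 - 2 * \<eta>"
  then have "s\<^sup>2 = - 11 \<or> s\<^sup>2 = - 3" by auto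
  then show False using nonsquares[of s] by blast
qed (use nonsquares in simp_all)

text \<open>The four radicands are \<open>2, 2, - 2, 1\<close>.\<close>
lemma example_T8_2: "galois_type_in (octic_poly 0 (1\<^sup>2)) T8_2"
proof -
  obtain \<alpha> where "cpoly (octic_poly 0 (1\<^sup>2)) \<alpha> = 0" by (rule octic_root)
  then obtain \<gamma> z where "octic_galois_action 0 1 \<alpha> \<gamma> z"
    by (rule octic_galois_action_of_root[OF irreducible_T8_2])
  then interpret octic_galois_action 0 1 \<alpha> \<gamma> z .
  show ?thesis by (rule T8_2_of_radicands[of 2 1]) simp_all
qed

text \<open>The four radicands are \<open>3, 1, - 1, 1\<close>.\<close>
lemma example_T8_3: "galois_type_in (octic_poly (- 1) (1\<^sup>2)) T8_3"
proof -
  obtain \<alpha> where "cpoly (octic_poly (- 1) (1\<^sup>2)) \<alpha> = 0" by (rule octic_root)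
  then obtain \<gamma> z where "octic_galois_action (- 1) 1 \<alpha> \<gamma> z"
    by (rule octic_galois_action_of_root[OF irreducible_T8_3])
  then interpret octic_galois_action "- 1" 1 \<alpha> \<gamma> z .
  show ?thesis by (rule T8_3_of_radicands[of 1 1]) simp_all
qed

text \<open>The four radicands are \<open>- 1, 5, - 5, 1\<close>; the product of the first three is \<open>5\<^sup>2\<close>.\<close>
lemma example_T8_4: "galois_type_in (octic_poly 3 (1\<^sup>2)) T8_4"
proof -
  obtain \<alpha> where "cpoly (octic_poly 3 (1\<^sup>2)) \<alpha> = 0" by (rule octic_root)
  then obtain \<gamma> z where "octic_galois_action 3 1 \<alpha> \<gamma> z"
    by (rule octic_galois_action_of_root[OF irreducible_T8_4])
  then interpret octic_galois_action 3 1 \<alpha> \<gamma> z .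
  show ?thesis by (rule T8_4_of_radicands[of 5 1]) simp_all
qed

text \<open>The four radicands are \<open>6, - 2, 2, 1\<close>.\<close>
lemma example_T8_9: "galois_type_in (octic_poly (- 4) (1\<^sup>2)) T8_9"
proof -
  obtain \<alpha> where \<alpha>: "cpoly (octic_poly (- 4) (1\<^sup>2)) \<alpha> = 0" "cnj \<alpha> = \<alpha>"
    by (rule octic_real_root[of "- 4" "1\<^sup>2"]) simp_all
  obtain \<gamma> z where "octic_galois_action (- 4) 1 \<alpha> \<gamma> z"
    by (rule octic_galois_action_of_root[OF irreducible_T8_9 \<alpha>(1)])
  then interpret octic_galois_action "- 4" 1 \<alpha> \<gamma> z .
  show ?thesis by (rule T8_9_of_radicands[OF \<alpha>(2), of 1]) simp
qed

text \<open>The four radicands are \<open>10, - 4, 2, 2\<close>.\<close>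
lemma example_T8_11: "galois_type_in (octic_poly (- 6) (2\<^sup>2)) T8_11"
proof -
  obtain \<alpha> where \<alpha>: "cpoly (octic_poly (- 6) (2\<^sup>2)) \<alpha> = 0" "cnj \<alpha> = \<alpha>"
    by (rule octic_real_root[of "- 6" "2\<^sup>2"]) simp_all
  obtain \<gamma> z where "octic_galois_action (- 6) 2 \<alpha> \<gamma> z"
    by (rule octic_galois_action_of_root[OF irreducible_T8_11 \<alpha>(1)])
  then interpret octic_galois_action "- 6" 2 \<alpha> \<gamma> z .
  show ?thesis by (rule T8_11_of_radicands[OF \<alpha>(2), of 2]) simp
qed

text \<open>The four radicands are \<open>11, - 6, 3, 2\<close>, and no product of some of them is a square.\<close>
lemma example_T8_22: "galois_type_in (octic_poly (- 7) (2\<^sup>2)) T8_22"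
proof -
  obtain \<alpha> where \<alpha>: "cpoly (octic_poly (- 7) (2\<^sup>2)) \<alpha> = 0" "cnj \<alpha> = \<alpha>"
    by (rule octic_real_root[of "- 7" "2\<^sup>2"]) simp_all
  obtain \<gamma> z where "octic_galois_action (- 7) 2 \<alpha> \<gamma> z"
    by (rule octic_galois_action_of_root[OF irreducible_T8_22 \<alpha>(1)])
  then interpret octic_galois_action "- 7" 2 \<alpha> \<gamma> z .
  show ?thesis
  proof (rule T8_22_of_radicands[OF \<alpha>(2)])
    fix l k assume l: "l \<noteq> vzero"
    obtain l1 l2 l3 l4 where l_eq: "l = (l1, l2, l3, l4)" by (cases l)
    show "k\<^sup>2 \<noteq> radicand l"
      using l nonsquares[of k]
      by (cases l1; cases l2; cases l3; cases l4; simp add: l_eq vzero_def)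
  qed
qed

theorem theorem3p6:
  shows "(\<forall>a b :: rat. b \<in> rat_squares \<longrightarrow> Factorial_Ring.irreducible (octic_poly a b) \<longrightarrow>
            (\<exists>\<C> \<in> {T8_2, T8_3, T8_4, T8_9, T8_11, T8_22}. galois_type_in (octic_poly a b) \<C>))
       \<and> (\<forall>\<C> \<in> {T8_2, T8_3, T8_4, T8_9, T8_11, T8_22}.
            \<exists>a b :: rat. b \<in> rat_squares \<and> Factorial_Ring.irreducible (octic_poly a b) \<and>
              galois_type_in (octic_poly a b) \<C>)"
proof (intro conjI allI impI ballI)
  fix a b :: rat assume "b \<in> rat_squares" and irr: "Factorial_Ring.irreducible (octic_poly a b)"
  then obtain c where "b = c\<^sup>2" by (auto simp: rat_squares_def)
  then show "\<exists>\<C> \<in> {T8_2, T8_3, T8_4, T8_9, T8_11, T8_22}. galois_type_in (octic_poly a b) \<C>"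
    using galois_type_cases irr by blast
next
  fix \<C> assume "\<C> \<in> {T8_2, T8_3, T8_4, T8_9, T8_11, T8_22}"
  moreover have "c\<^sup>2 \<in> rat_squares" for c by (auto simp: rat_squares_def)
  ultimately show "\<exists>a b :: rat. b \<in> rat_squares \<and> Factorial_Ring.irreducible (octic_poly a b) \<and>
      galois_type_in (octic_poly a b) \<C>"
    using irreducible_T8_2 example_T8_2 irreducible_T8_3 example_T8_3 irreducible_T8_4 example_T8_4
      irreducible_T8_9 example_T8_9 irreducible_T8_11 example_T8_11 irreducible_T8_22 example_T8_22
    by blast
qed

end
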